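(* Let $1<\gamma<2$, $\gamma_0:=(\gamma-1)/2$, $T>0$, let $\Omega\subset\mathbb R^d$ ($d=2,3$) be a polygon/polyhedron, $\Omega_T:=\Omega\times(0,T)$, and let $u_0\in H_0^1(\Omega)$, $u_1\in L^2(\Omega)$, $f\in L^2(\Omega_T)$. Let $\mathcal K_h$ be a triangulation of $\Omega$ by $d$-simplexes with maximal diameter $h$, let $m\ge1$ be an integer, $V_h:=\{v_h\in H^1(\Omega): v_h|_K\in P_m(K)\ \forall K\in\mathcal K_h\}$, $\mathring V_h:=V_h\cap H_0^1(\Omega)$, let $R_h:H_0^1(\Omega)\to\mathring V_h$ be defined by $(\nabla(v-R_hv),\nabla v_h)_{L^2(\Omega)}=0$ for all $v_h\in\mathring V_h$, and let $u_{h,1}$ be the $L^2(\Omega)$-orthogonal projection of $u_1$ onto $V_h$. Let $M\ge2$ be an integer. Consider the discrete problem: find $U\in P_M[0,T]\otimes\mathring V_h$ with $U(0)=R_hu_0$ such that $$\big(D_{0+}^{\gamma_0}(U'-u_{h,1}),D_{T-}^{\gamma_0}V\big)_{L^2(\Omega_T)}+(\nabla U,\nabla V)_{L^2(\Omega_T)}=(f,V)_{L^2(\Omega_T)}\quad\forall V\in P_{M-1}[0,T]\otimes\mathring V_h,$$ where $u_{h,1}$ is regarded as constant in time. Then this problem has a unique solution $U$, and $$\|U\|_{H^{1+\gamma_0}(0,T;L^2(\Omega))}+\|U(T)\|_{H_0^1(\Omega)}\le c\big(\|u_0\|_{H_0^1(\Omega)}+\|u_1\|_{L^2(\Omega)}+\|f\|_{L^2(\Omega_T)}\big),$$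 where $c>0$ depends only on $\gamma$, $T$, $\Omega$, $m$ and the shape regularity parameter $\max_{K\in\mathcal K_h}h_K/\rho_K$ of $\mathcal K_h$.
   Context: $P_j[0,T]$ denotes polynomials on $[0,T]$ of degree $\le j$, $P_m(K)$ polynomials of degree $\le m$ on $K$, and $P_j[0,T]\otimes\mathring V_h:=\mathrm{span}\{qv_h: q\in P_j[0,T], v_h\in\mathring V_h\}$; $h_K$ is the diameter of $K$ and $\rho_K$ the diameter of its inscribed circle/ball. For a Banach space $X$ and $v\in L^1(0,T;X)$, $(I_{0+}^\alpha v)(t)=\frac1{\Gamma(\alpha)}\int_0^t(t-s)^{\alpha-1}v(s)\,ds$ and $(I_{T-}^\alpha v)(t)=\frac1{\Gamma(\alpha)}\int_t^T(s-t)^{\alpha-1}v(s)\,ds$; for $j-1<\alpha<j$, $j\in\mathbb N_{>0}$, $D_{0+}^\alpha:=D^jI_{0+}^{j-\alpha}$ and $D_{T-}^\alpha:=(-1)^jD^jI_{T-}^{j-\alpha}$ with $D$ the distributional derivative. For a separable Hilbert space $X$ with orthonormal basis $\{e_k\}$ and $\alpha>0$, $H^\alpha(0,T;X):=\{v\in L^2(0,T;X):\sum_k\|(v,e_k)_X\|_{H^\alpha(0,T)}^2<\infty\}$ with norm $\|v\|_{H^\alpha(0,T;X)}:=(\sum_k\|(v,e_k)_X\|^2_{H^\alpha(0,T)})^{1/2}$, where $H^\alpha(0,T)$ is the standard Sobolev space. *)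

theory Defs
  imports "HOL-Analysis.Analysis"
begin

fun Ck_on :: "nat \<Rightarrow> ('a::euclidean_space) set \<Rightarrow> ('a \<Rightarrow> real) \<Rightarrow> bool" where
  "Ck_on 0 S f = continuous_on S f"
| "Ck_on (Suc k) S f = (f differentiable_on S \<and> continuous_on S f \<and>
      (\<forall>v. Ck_on k S (\<lambda>x. frechet_derivative f (at x) v)))"

definition smooth_fun :: "('a::euclidean_space \<Rightarrow> real) \<Rightarrow> bool" where
  "smooth_fun f \<longleftrightarrow> (\<forall>k. Ck_on k UNIV f)"

definition test_fun :: "'a::euclidean_space set \<Rightarrow> ('a \<Rightarrow> real) \<Rightarrow> bool" where
  "test_fun \<Omega> \<phi> \<longleftrightarrow> smooth_fun \<phi> \<and> compact (closure {x. \<phi> x \<noteq> 0})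
      \<and> closure {x. \<phi> x \<noteq> 0} \<subseteq> \<Omega>"

definition pderiv_i :: "('n::finite) \<Rightarrow> (real^'n \<Rightarrow> real) \<Rightarrow> real^'n \<Rightarrow> real" where
  "pderiv_i i \<phi> x = frechet_derivative \<phi> (at x) (axis i 1)"

definition L2 :: "'a::euclidean_space set \<Rightarrow> ('a \<Rightarrow> real) \<Rightarrow> bool" where
  "L2 \<Omega> v \<longleftrightarrow> set_borel_measurable lebesgue \<Omega> v \<and> set_integrable lebesgue \<Omega> (\<lambda>x. (v x)\<^sup>2)"

definition L2norm :: "'a::euclidean_space set \<Rightarrow> ('a \<Rightarrow> real) \<Rightarrow> real" where
  "L2norm \<Omega> v = sqrt (LINT x:\<Omega>|lebesgue. (v x)\<^sup>2)"

definition weak_grad :: "(real^'n) set \<Rightarrow> (real^'n \<Rightarrow> real) \<Rightarrow> (real^'n \<Rightarrow> real^'n) \<Rightarrow> bool" where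
  "weak_grad \<Omega> v g \<longleftrightarrow> (\<forall>i. L2 \<Omega> (\<lambda>x. g x $ i)) \<and>
     (\<forall>\<phi>. test_fun \<Omega> \<phi> \<longrightarrow> (\<forall>i.
        (LINT x:\<Omega>|lebesgue. v x * pderiv_i i \<phi> x) = - (LINT x:\<Omega>|lebesgue. g x $ i * \<phi> x)))"

definition H1 :: "(real^'n) set \<Rightarrow> (real^'n \<Rightarrow> real) \<Rightarrow> bool" where
  "H1 \<Omega> v \<longleftrightarrow> L2 \<Omega> v \<and> (\<exists>g. weak_grad \<Omega> v g)"

definition wgrad :: "(real^'n) set \<Rightarrow> (real^'n \<Rightarrow> real) \<Rightarrow> real^'n \<Rightarrow> real^'n" where
  "wgrad \<Omega> v = (SOME g. weak_grad \<Omega> v g)"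

definition H1norm :: "(real^'n) set \<Rightarrow> (real^'n \<Rightarrow> real) \<Rightarrow> real" where
  "H1norm \<Omega> v = sqrt ((LINT x:\<Omega>|lebesgue. (v x)\<^sup>2) + (LINT x:\<Omega>|lebesgue. (norm (wgrad \<Omega> v x))\<^sup>2))"

definition H10 :: "(real^'n) set \<Rightarrow> (real^'n \<Rightarrow> real) \<Rightarrow> bool" where
  "H10 \<Omega> v \<longleftrightarrow> H1 \<Omega> v \<and> (\<exists>\<phi>::nat \<Rightarrow> real^'n \<Rightarrow> real. (\<forall>k. test_fun \<Omega> (\<phi> k)) \<and>
       (\<lambda>k. H1norm \<Omega> (\<lambda>x. v x - \<phi> k x)) \<longlonglongrightarrow> 0)"

definition H10norm :: "(real^'n) set \<Rightarrow> (real^'n \<Rightarrow> real) \<Rightarrow> real" where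
  "H10norm \<Omega> v = sqrt (LINT x:\<Omega>|lebesgue. (norm (wgrad \<Omega> v x))\<^sup>2)"

definition L2T :: "real \<Rightarrow> (real^'n) set \<Rightarrow> (real \<Rightarrow> real^'n \<Rightarrow> real) \<Rightarrow> bool" where
  "L2T T \<Omega> f \<longleftrightarrow> set_borel_measurable lebesgue ({0<..<T} \<times> \<Omega>) (\<lambda>z. f (fst z) (snd z))
     \<and> set_integrable lebesgue ({0<..<T} \<times> \<Omega>) (\<lambda>z. (f (fst z) (snd z))\<^sup>2)"

definition L2Tnorm :: "real \<Rightarrow> (real^'n) set \<Rightarrow> (real \<Rightarrow> real^'n \<Rightarrow> real) \<Rightarrow> real" where
  "L2Tnorm T \<Omega> f = sqrt (LINT z:({0<..<T} \<times> \<Omega>)|lebesgue. (f (fst z) (snd z))\<^sup>2)"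

definition polyhedral_domain :: "(real^'n) set \<Rightarrow> bool" where
  "polyhedral_domain \<Omega> \<longleftrightarrow> open \<Omega> \<and> bounded \<Omega> \<and> connected \<Omega> \<and> \<Omega> \<noteq> {} \<and>
     interior (closure \<Omega>) = \<Omega> \<and>
     (\<exists>P. finite P \<and> (\<forall>p\<in>P. polytope p) \<and> closure \<Omega> = \<Union>P)"

definition triangulation :: "(real^'n) set \<Rightarrow> (real^'n) set set \<Rightarrow> bool" where
  "triangulation \<Omega> Th \<longleftrightarrow> finite Th \<and> (\<forall>K\<in>Th. int CARD('n) simplex K) \<and>
     \<Union>Th = closure \<Omega> \<and>
     (\<forall>K1\<in>Th. \<forall>K2\<in>Th. K1 \<noteq> K2 \<longrightarrow> (K1 \<inter> K2) face_of K1 \<and> (K1 \<inter> K2) face_of K2)"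

definition inball_diam :: "(real^'n) set \<Rightarrow> real" where
  "inball_diam K = 2 * Sup {r. r \<ge> 0 \<and> (\<exists>x. cball x r \<subseteq> K)}"

definition shape_param :: "(real^'n) set set \<Rightarrow> real" where
  "shape_param Th = Max ((\<lambda>K. diameter K / inball_diam K) ` Th)"

definition poly_on :: "nat \<Rightarrow> (real^'n) set \<Rightarrow> (real^'n \<Rightarrow> real) \<Rightarrow> bool" where
  "poly_on m K v \<longleftrightarrow> (\<exists>c :: ('n \<Rightarrow> nat) \<Rightarrow> real. \<forall>x\<in>K.
      v x = (\<Sum>\<alpha>\<in>{\<alpha>. sum \<alpha> UNIV \<le> m}. c \<alpha> * (\<Prod>i\<in>UNIV. (x $ i) ^ \<alpha> i)))"

definition Vh :: "(real^'n) set \<Rightarrow> (real^'n) set set \<Rightarrow> nat \<Rightarrow> (real^'n \<Rightarrow> real) \<Rightarrow> bool" where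
  "Vh \<Omega> Th m v \<longleftrightarrow> H1 \<Omega> v \<and> (\<forall>K\<in>Th. poly_on m K v)"

definition Vh0 :: "(real^'n) set \<Rightarrow> (real^'n) set set \<Rightarrow> nat \<Rightarrow> (real^'n \<Rightarrow> real) \<Rightarrow> bool" where
  "Vh0 \<Omega> Th m v \<longleftrightarrow> Vh \<Omega> Th m v \<and> H10 \<Omega> v"

definition ritz :: "(real^'n) set \<Rightarrow> (real^'n) set set \<Rightarrow> nat \<Rightarrow> (real^'n \<Rightarrow> real) \<Rightarrow> (real^'n \<Rightarrow> real) \<Rightarrow> bool" where
  "ritz \<Omega> Th m v w \<longleftrightarrow> Vh0 \<Omega> Th m w \<and> (\<forall>vh. Vh0 \<Omega> Th m vh \<longrightarrow>
      (LINT x:\<Omega>|lebesgue. wgrad \<Omega> (\<lambda>y. v y - w y) x \<bullet> wgrad \<Omega> vh x) = 0)"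

definition l2proj :: "(real^'n) set \<Rightarrow> (real^'n) set set \<Rightarrow> nat \<Rightarrow> (real^'n \<Rightarrow> real) \<Rightarrow> (real^'n \<Rightarrow> real) \<Rightarrow> bool" where
  "l2proj \<Omega> Th m u w \<longleftrightarrow> Vh \<Omega> Th m w \<and> (\<forall>vh. Vh \<Omega> Th m vh \<longrightarrow>
      (LINT x:\<Omega>|lebesgue. (u x - w x) * vh x) = 0)"

definition tensor_space :: "(real^'n) set \<Rightarrow> (real^'n) set set \<Rightarrow> nat \<Rightarrow> nat \<Rightarrow> (real \<Rightarrow> real^'n \<Rightarrow> real) \<Rightarrow> bool" where
  "tensor_space \<Omega> Th m M U \<longleftrightarrow> (\<exists>w. (\<forall>i\<le>M. Vh0 \<Omega> Th m (w i)) \<and>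
      (\<forall>t x. U t x = (\<Sum>i\<le>M. t ^ i * w i x)))"

definition RL_I0 :: "real \<Rightarrow> (real \<Rightarrow> real) \<Rightarrow> real \<Rightarrow> real" where
  "RL_I0 \<alpha> v t = (1 / Gamma \<alpha>) * (LINT s:{0..t}|lborel. (t - s) powr (\<alpha> - 1) * v s)"

definition RL_IT :: "real \<Rightarrow> real \<Rightarrow> (real \<Rightarrow> real) \<Rightarrow> real \<Rightarrow> real" where
  "RL_IT T \<alpha> v t = (1 / Gamma \<alpha>) * (LINT s:{t..T}|lborel. (s - t) powr (\<alpha> - 1) * v s)"

definition RL_D0 :: "real \<Rightarrow> (real \<Rightarrow> real) \<Rightarrow> real \<Rightarrow> real" where
  "RL_D0 \<alpha> v t = (let j = nat \<lceil>\<alpha>\<rceil> in (deriv ^^ j) (RL_I0 (real j - \<alpha>) v) t)"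

definition RL_DT :: "real \<Rightarrow> real \<Rightarrow> (real \<Rightarrow> real) \<Rightarrow> real \<Rightarrow> real" where
  "RL_DT T \<alpha> v t = (let j = nat \<lceil>\<alpha>\<rceil> in (-1) ^ j * (deriv ^^ j) (RL_IT T (real j - \<alpha>) v) t)"

definition dt :: "(real \<Rightarrow> real^'n \<Rightarrow> real) \<Rightarrow> real \<Rightarrow> real^'n \<Rightarrow> real" where
  "dt U t x = deriv (\<lambda>s. U s x) t"

text \<open>H^{1+sigma}(0,T;L2(Omega)) norm, 0<sigma<1 (Sobolev-Slobodeckij norm of H^{1+sigma}(0,T),
  summed over an orthonormal basis of L2(Omega), i.e. after Parseval)\<close>
definition H1s_time_norm :: "real \<Rightarrow> real \<Rightarrow> (real^'n) set \<Rightarrow> (real \<Rightarrow> real^'n \<Rightarrow> real) \<Rightarrow> real" where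
  "H1s_time_norm \<sigma> T \<Omega> U = sqrt (
      (LINT t:{0<..<T}|lborel. (L2norm \<Omega> (U t))\<^sup>2)
    + (LINT t:{0<..<T}|lborel. (L2norm \<Omega> (dt U t))\<^sup>2)
    + (LINT t:{0<..<T}|lborel. LINT s:{0<..<T}|lborel.
         (L2norm \<Omega> (\<lambda>x. dt U t x - dt U s x))\<^sup>2 / \<bar>t - s\<bar> powr (1 + 2 * \<sigma>)))"

definition disc_sol :: "real \<Rightarrow> real \<Rightarrow> (real^'n) set \<Rightarrow> (real^'n) set set \<Rightarrow> nat \<Rightarrow> nat \<Rightarrow>
    (real^'n \<Rightarrow> real) \<Rightarrow> (real^'n \<Rightarrow> real) \<Rightarrow> (real \<Rightarrow> real^'n \<Rightarrow> real) \<Rightarrow> (real \<Rightarrow> real^'n \<Rightarrow> real) \<Rightarrow> bool" where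
  "disc_sol \<gamma>0 T \<Omega> Th m M u0 uh1 f U \<longleftrightarrow>
     tensor_space \<Omega> Th m M U \<and> ritz \<Omega> Th m u0 (U 0) \<and>
     (\<forall>V. tensor_space \<Omega> Th m (M - 1) V \<longrightarrow>
        (LINT t:{0<..<T}|lborel. LINT x:\<Omega>|lebesgue.
             RL_D0 \<gamma>0 (\<lambda>s. dt U s x - uh1 x) t * RL_DT T \<gamma>0 (\<lambda>s. V s x) t)
      + (LINT t:{0<..<T}|lborel. LINT x:\<Omega>|lebesgue. wgrad \<Omega> (U t) x \<bullet> wgrad \<Omega> (V t) x)
      = (LINT z:({0<..<T} \<times> \<Omega>)|lebesgue. f (fst z) (snd z) * V (fst z) (snd z)))"

end

theory Submission
  imports Defs
begin

text \<open>Test with \<open>V = U'\<close>. The gradient term becomes half the increment of the Dirichlet energy. For fixed \<open>x\<close>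
  the fractional term only involves the polynomial \<open>p = U'(\<cdot>, x)\<close>; with \<open>\<beta> = 2\<gamma>\<^sub>0 < 1\<close> it equals the integral of
  \<open>p D\<^sup>\<beta> p\<close>, which Marchaud's formula for \<open>D\<^sup>\<beta>\<close> bounds below by the Slobodeckij seminorm plus the weighted norm with
  weight \<open>t powr (- \<beta>)\<close>. The latter absorbs the load and the contribution of \<open>u\<^sub>h\<^sub>,\<^sub>1\<close> by Young's inequality, and integrating
  over \<open>\<Omega>\<close> gives the stability bound with a constant independent of the mesh and of \<open>M\<close>. Uniqueness is stability with
  zero data. Coercivity also makes the linear system for the coefficients of \<open>U'\<close> positive definite, hence solvable.
  Since \<open>wgrad\<close> is a choice, bilinearity of the Dirichlet form rests on the almost everywhere uniqueness of weak gradients.\<close>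

section \<open>Smooth bumps and the fundamental lemma of the calculus of variations\<close>

text \<open>Everything in time is a polynomial, so each form of the scheme is a matrix indexed by
  monomial degrees (\<open>frac_form\<close>, \<open>weight_form\<close>, \<open>slob_form\<close>,
  \<open>gram\<close>) contracted with inner products of coefficients over \<open>\<Omega>\<close>.
  Inequalities are proved for scalar polynomials, as inequalities between quadratic forms; they hold
  at the values \<open>d i x\<close> for each \<open>x\<close>, and integration over
  \<open>\<Omega>\<close> transfers them. Beta integrals thus replace vector-valued fractional
  Sobolev theory, and no inverse inequality brings \<open>M\<close> or the mesh into a constant. The
  obstacle is that \<open>U'\<close> need not vanish at time 0: the initial velocity enters only
  weakly, through \<open>uh1\<close> under the fractional derivative, and the derivative of order
  \<open>\<beta>\<close> of a constant is a multiple of \<open>t powr (- \<beta>)\<close>. The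
  boundary term in Marchaud's formula carries the same weight and pays for \<open>uh1\<close>;
  \<open>\<gamma> < 2\<close>, that is \<open>\<beta> < 1\<close>, makes the weight integrable.
  Testing with \<open>U'\<close> is admissible because trial and test degrees differ by one. The
  energy controls only the gradient of the initial value; its L2 norm comes from Poincare's
  inequality.\<close>

lemma Ck_on_Suc_imp: "Ck_on (Suc k) UNIV f \<Longrightarrow> Ck_on k UNIV f"
proof (induction k arbitrary: f)
  case (Suc k)
  from Suc.prems show ?case
    by (subst Ck_on.simps(2), subst (asm) (2) Ck_on.simps(2)) (blast intro: Suc.IH)
qed simp

text \<open>\<open>Ck_on\<close> speaks of \<open>frechet_derivative\<close>, a choice. Here the
  derivative is any explicit \<open>f'\<close>, so the closure lemmas below only exhibit one and
  apply the induction hypothesis to its terms.\<close>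

lemma Ck_on_SucI:
  assumes "\<And>x. (f has_derivative f' x) (at x)" "\<And>v. Ck_on k UNIV (\<lambda>x. f' x v)"
  shows "Ck_on (Suc k) UNIV f"
proof -
  have "frechet_derivative f (at x) = f' x" for x
    using frechet_derivative_at[OF assms(1)] by simp
  then show ?thesis
    using assms by (auto simp: differentiable_on_def differentiable_def
        intro!: has_derivative_continuous_on)
qed

lemma Ck_on_Suc_derivative:
  "Ck_on (Suc k) UNIV f \<Longrightarrow> (f has_derivative frechet_derivative f (at x)) (at x)"
  by (simp add: differentiable_on_def frechet_derivative_works)

lemma Ck_on_const: "Ck_on k UNIV (\<lambda>x::'a::euclidean_space. c)"
proof (induction k arbitrary: c)
  case (Suc k)
  show ?case by (rule Ck_on_SucI[where f' = "\<lambda>x v. 0"]) (auto intro: Suc.IH)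
qed simp

lemma Ck_on_add:
  "Ck_on k UNIV f \<Longrightarrow> Ck_on k UNIV g \<Longrightarrow> Ck_on k UNIV (\<lambda>x. f x + g x)"
proof (induction k arbitrary: f g)
  case (Suc k)
  show ?case
    by (rule Ck_on_SucI[OF has_derivative_add])
      (use Suc in \<open>auto intro!: Suc.IH intro: Ck_on_Suc_derivative[OF Suc.prems(1)]
         Ck_on_Suc_derivative[OF Suc.prems(2)]\<close>)
qed (simp add: continuous_on_add)

lemma Ck_on_mult:
  "Ck_on k UNIV f \<Longrightarrow> Ck_on k UNIV g \<Longrightarrow> Ck_on k UNIV (\<lambda>x. f x * g x)"
proof (induction k arbitrary: f g)
  case (Suc k)
  \<comment> \<open>The product rule keeps an undifferentiated factor in each term, so both factors
    are also needed at level \<open>k\<close>.\<close>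
  have "Ck_on k UNIV f" "Ck_on k UNIV g"
    using Suc.prems by (blast intro: Ck_on_Suc_imp)+
  then show ?case
    by (intro Ck_on_SucI[OF has_derivative_mult])
      (use Suc in \<open>auto intro!: Suc.IH Ck_on_add intro: Ck_on_Suc_derivative[OF Suc.prems(1)]
         Ck_on_Suc_derivative[OF Suc.prems(2)]\<close>)
qed (simp add: continuous_on_mult)

lemma Ck_on_prod:
  assumes "\<And>i. i \<in> I \<Longrightarrow> Ck_on k UNIV (f i)"
  shows "Ck_on k UNIV (\<lambda>x. \<Prod>i\<in>I. f i x)"
  using assms by (induction I rule: infinite_finite_induct) (simp_all add: Ck_on_const Ck_on_mult)

lemma smooth_fun_const: "smooth_fun (\<lambda>x. c)"
  by (simp add: smooth_fun_def Ck_on_const)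

lemma smooth_fun_add: "smooth_fun f \<Longrightarrow> smooth_fun g \<Longrightarrow> smooth_fun (\<lambda>x. f x + g x)"
  by (simp add: smooth_fun_def Ck_on_add)

lemma smooth_fun_mult: "smooth_fun f \<Longrightarrow> smooth_fun g \<Longrightarrow> smooth_fun (\<lambda>x. f x * g x)"
  by (simp add: smooth_fun_def Ck_on_mult)

lemma smooth_fun_prod: "(\<And>i. i \<in> I \<Longrightarrow> smooth_fun (f i)) \<Longrightarrow> smooth_fun (\<lambda>x. \<Prod>i\<in>I. f i x)"
  by (simp add: smooth_fun_def Ck_on_prod)

lemma smooth_fun_diff: "smooth_fun f \<Longrightarrow> smooth_fun g \<Longrightarrow> smooth_fun (\<lambda>x. f x - g x)"
  using smooth_fun_add[OF _ smooth_fun_mult[OF smooth_fun_const[of "-1"]], of f g] by simp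

lemma smooth_fun_power: "smooth_fun f \<Longrightarrow> smooth_fun (\<lambda>x. f x ^ k)"
  by (induction k) (simp_all add: smooth_fun_const smooth_fun_mult)

lemma smooth_fun_nth: "smooth_fun (\<lambda>x::real^'n. x $ i)"
  unfolding smooth_fun_def
proof
  fix k show "Ck_on k UNIV (\<lambda>x::real^'n. x $ i)"
  proof (cases k)
    case (Suc l)
    have "Ck_on (Suc l) UNIV (\<lambda>x::real^'n. x $ i)"
      by (rule Ck_on_SucI[where f' = "\<lambda>x v. v $ i"])
        (auto simp: Ck_on_const intro: bounded_linear.has_derivative[OF bounded_linear_vec_nth] has_derivative_ident)
    then show ?thesis using Suc by simp
  qed (auto intro!: continuous_intros)
qed

lemma smooth_fun_has_derivative:
  "smooth_fun f \<Longrightarrow> (f has_derivative frechet_derivative f (at x)) (at x)"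
  unfolding smooth_fun_def by (rule Ck_on_Suc_derivative) blast

lemma smooth_fun_continuous: "smooth_fun f \<Longrightarrow> continuous_on S f"
  unfolding smooth_fun_def by (metis Ck_on.simps(1) continuous_on_subset top_greatest)

lemma smooth_fun_pderiv: "smooth_fun f \<Longrightarrow> smooth_fun (pderiv_i i f)"
proof -
  assume "smooth_fun f"
  then have "Ck_on k UNIV (\<lambda>x. frechet_derivative f (at x) (axis i 1))" for k
    unfolding smooth_fun_def by (metis Ck_on.simps(2))
  then show "smooth_fun (pderiv_i i f)"
    by (simp add: smooth_fun_def pderiv_i_def[abs_def])
qed

lemma pderiv_i_mult:
  assumes "smooth_fun f" "smooth_fun g"
  shows "pderiv_i i (\<lambda>x. f x * g x) x = f x * pderiv_i i g x + pderiv_i i f x * g x"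
  unfolding pderiv_i_def
  by (subst frechet_derivative_at[OF has_derivative_mult[OF assms[THEN smooth_fun_has_derivative]], symmetric]) (rule refl)

lemma pderiv_i_nth: "pderiv_i i (\<lambda>x::real^'n. x $ i) x = 1"
  unfolding pderiv_i_def
  by (subst frechet_derivative_at[OF bounded_linear.has_derivative[OF bounded_linear_vec_nth has_derivative_ident], symmetric])
    (simp add: axis_def)

section \<open>Flat functions and bumps supported in a box\<close>

lemma poly_times_exp_tendsto_0: "((\<lambda>y::real. poly P y * exp (- y)) \<longlongrightarrow> 0) at_top"
proof -
  have "((\<lambda>y. (\<Sum>i\<le>degree P. coeff P i * (y ^ i / exp y))) \<longlongrightarrow> (\<Sum>i\<le>degree P. coeff P i * 0)) at_top"
    by (intro tendsto_intros tendsto_power_div_exp_0)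
  moreover have "poly P y * exp (- y) = (\<Sum>i\<le>degree P. coeff P i * (y ^ i / exp y))" for y
    by (simp add: poly_altdef exp_minus sum_distrib_right divide_inverse sum_distrib_left mult_ac)
  ultimately show ?thesis by simp
qed

text \<open>\<open>flat 1\<close> is the classical exp (- 1 / x). In the variable y = 1 / x
  differentiation is - y^2 d/dy, so P(y) exp (- y) becomes y^2 (P - P')(y) exp (- y); this is the
  polynomial \<open>[:0, 0, 1:] * (P - Polynomial.pderiv P)\<close> in
  \<open>DERIV_flat\<close>.\<close>

definition flat :: "real poly \<Rightarrow> real \<Rightarrow> real" where
  "flat P x = (if x \<le> 0 then 0 else poly P (1 / x) * exp (- (1 / x)))"

text \<open>Differentiation stays within the class of functions \<^term>\<open>flat P\<close>; this closure makes
  smoothness an induction that is uniform in \<open>P\<close>.\<close>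
lemma DERIV_flat:
  "(flat P has_real_derivative flat ([:0, 0, 1:] * (P - Polynomial.pderiv P)) x) (at x)"
proof -
  consider "x < 0" | "x = 0" | "x > 0" by linarith
  then show ?thesis
  proof cases
    case 1
    have "((\<lambda>_. 0) has_real_derivative 0) (at x)" by simp
    moreover have "eventually (\<lambda>y. flat P y = 0) (nhds x)"
      using eventually_nhds_in_open[of "{..<0}" x] 1
      by (auto elim!: eventually_mono simp: flat_def)
    ultimately show ?thesis
      using 1 by (subst DERIV_cong_ev) (auto simp: flat_def)
  next
    case 2
    \<comment> \<open>To the right of 0 the difference quotient is y P(y) exp (- y) with y = 1 / h,
      which tends to 0 as y grows.\<close>
    have "((\<lambda>h. poly ([:0, 1:] * P) (inverse h) * exp (- inverse h)) \<longlongrightarrow> 0) (at_right 0)"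
      by (rule filterlim_compose[OF poly_times_exp_tendsto_0 filterlim_inverse_at_top_right])
    then have "((\<lambda>h. flat P h / h) \<longlongrightarrow> 0) (at_right 0)"
      by (rule Lim_transform_eventually)
        (auto simp: eventually_at_right_field flat_def field_simps intro!: exI[of _ 1])
    moreover have "((\<lambda>h. flat P h / h) \<longlongrightarrow> 0) (at_left 0)"
      by (rule Lim_transform_eventually[of "\<lambda>_. 0"])
        (auto simp: eventually_at_left_field flat_def intro!: exI[of _ "-1"])
    ultimately have "((\<lambda>h. flat P h / h) \<longlongrightarrow> 0) (at 0)"
      by (simp add: filterlim_split_at)
    then show ?thesis using 2 by (simp add: DERIV_def flat_def)
  next
    case 3
    have "((\<lambda>x. poly P (1 / x) * exp (- (1 / x))) has_real_derivative
            flat ([:0, 0, 1:] * (P - Polynomial.pderiv P)) x) (at x)"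
      using 3 by (auto intro!: derivative_eq_intros DERIV_chain2[OF poly_DERIV]
          simp: flat_def field_simps power2_eq_square)
    moreover have "eventually (\<lambda>y. flat P y = poly P (1 / y) * exp (- (1 / y))) (nhds x)"
      using eventually_nhds_in_open[of "{0<..}" x] 3
      by (auto elim!: eventually_mono simp: flat_def)
    ultimately show ?thesis by (subst DERIV_cong_ev) auto
  qed
qed

lemma smooth_fun_flat_nth: "smooth_fun (\<lambda>x::real^'n. flat P (c * x $ i + d))"
  unfolding smooth_fun_def
proof
  fix k show "Ck_on k UNIV (\<lambda>x::real^'n. flat P (c * x $ i + d))"
  proof (induction k arbitrary: P)
    case 0
    have "continuous_on UNIV (flat P)"
      by (meson DERIV_flat DERIV_continuous_on has_field_derivative_at_within)
    then show ?case
      by (auto intro!: continuous_on_compose2[of UNIV "flat P"] continuous_intros)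
  next
    case (Suc k)
    let ?Q = "[:0, 0, 1:] * (P - Polynomial.pderiv P)"
    show ?case
    proof (rule Ck_on_SucI)
      fix x :: "real^'n"
      have "((\<lambda>x::real^'n. c * x $ i + d) has_derivative (\<lambda>v. c * v $ i)) (at x)"
        by (auto intro!: derivative_eq_intros bounded_linear.has_derivative[OF bounded_linear_vec_nth])
      from has_derivative_compose[OF this DERIV_flat[unfolded has_field_derivative_def]]
      show "((\<lambda>x. flat P (c * x $ i + d)) has_derivative
          (\<lambda>v. flat ?Q (c * x $ i + d) * (c * v $ i))) (at x)" .
    qed (intro Ck_on_mult Ck_on_const Suc.IH)
  qed
qed

text \<open>The affine arguments are spelled \<open>c * x $ i + d\<close> to match
  \<open>smooth_fun_flat_nth\<close>.\<close>

definition bump :: "real^'n \<Rightarrow> real^'n \<Rightarrow> real^'n \<Rightarrow> real" where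
  "bump a b x = (\<Prod>i\<in>UNIV. flat 1 (1 * x $ i + (- a $ i)) * flat 1 ((-1) * x $ i + b $ i))"

lemma flat_1: "0 \<le> flat 1 x" "flat 1 x \<le> 1" "flat 1 x = 0 \<longleftrightarrow> x \<le> 0"
  by (auto simp: flat_def)

lemma bump_range: "0 \<le> bump a b x" "bump a b x \<le> 1"
  by (auto simp: bump_def flat_1 intro!: prod_nonneg prod_le_1 mult_nonneg_nonneg mult_le_one)

lemma bump_eq_0_iff: "bump a b x = 0 \<longleftrightarrow> x \<notin> box a b"
  by (force simp: bump_def flat_1 mem_box_cart not_less)

lemma smooth_fun_bump: "smooth_fun (bump a b)"
  unfolding bump_def[abs_def] by (intro smooth_fun_prod smooth_fun_mult smooth_fun_flat_nth)

text \<open>These functions are polynomials in the bump that vanish with it, hence smooth with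
  support in the closed box. As \<open>k\<close> grows they increase to the indicator of the open
  box, because \<open>1 - bump a b x\<close> lies in [0, 1) inside it and equals 1 outside.\<close>

lemma test_fun_bump:
  fixes a b :: "real^'n"
  assumes "cbox a b \<subseteq> \<Omega>"
  shows "test_fun \<Omega> (\<lambda>x. 1 - (1 - bump a b x) ^ k)"
proof -
  have "{x. 1 - (1 - bump a b x) ^ k \<noteq> 0} \<subseteq> cbox a b"
  proof
    fix x assume "x \<in> {x. 1 - (1 - bump a b x) ^ k \<noteq> 0}"
    then have "bump a b x \<noteq> 0" by (metis (mono_tags) mem_Collect_eq diff_zero power_one diff_self)
    then show "x \<in> cbox a b" using box_subset_cbox[of a b] bump_eq_0_iff by blast
  qed
  then have *: "closure {x. 1 - (1 - bump a b x) ^ k \<noteq> 0} \<subseteq> cbox a b"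
    by (rule closure_minimal) (rule closed_cbox)
  then have "compact (closure {x. 1 - (1 - bump a b x) ^ k \<noteq> 0})"
    using compact_Int_closed[OF compact_cbox closed_closure] by (metis inf.absorb_iff2)
  with * assms show ?thesis
    unfolding test_fun_def
    by (auto intro!: smooth_fun_diff smooth_fun_power smooth_fun_const smooth_fun_bump)
qed

lemma bump_power_tendsto: "(\<lambda>k. 1 - (1 - bump a b x) ^ k) \<longlonglongrightarrow> indicator (box a b) x"
proof (cases "x \<in> box a b")
  case True
  then have "0 < bump a b x" using bump_range(1) bump_eq_0_iff by (metis less_eq_real_def)
  then have "(\<lambda>k. (1 - bump a b x) ^ k) \<longlonglongrightarrow> 0"
    using bump_range(2)[of a b x] by (intro LIMSEQ_realpow_zero) auto
  from tendsto_diff[OF tendsto_const[of 1] this] True show ?thesis by simp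
next
  case False
  then have "bump a b x = 0" by (simp add: bump_eq_0_iff)
  with False show ?thesis by simp
qed

lemma box_inter_cart:
  fixes a b c d :: "real^'n"
  shows "box a b \<inter> box c d = box (\<chi> i. max (a $ i) (c $ i)) (\<chi> i. min (b $ i) (d $ i))"
    and "cbox (\<chi> i. max (a $ i) (c $ i)) (\<chi> i. min (b $ i) (d $ i)) \<subseteq> cbox a b"
  by (auto simp: mem_box_cart)

text \<open>Powers of a bump converge to the indicator of its box, so \<open>g\<close> has zero integral over every box
  inside \<open>\<Omega>\<close>, and boxes generate the Borel sets.\<close>
lemma AE_zero_if_test_integrals_zero:
  fixes g :: "real^'n \<Rightarrow> real"
  assumes "open \<Omega>" and g: "set_integrable lebesgue \<Omega> g"
    and zero: "\<And>\<phi>. test_fun \<Omega> \<phi> \<Longrightarrow> (LINT x:\<Omega>|lebesgue. g x * \<phi> x) = 0"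
  shows "AE x in lebesgue. x \<in> \<Omega> \<longrightarrow> g x = 0"
proof -
  define h where "h x = indicator \<Omega> x * g x" for x
  have h_int: "integrable lebesgue h"
    using g by (simp add: h_def[abs_def] set_integrable_def)
  \<comment> \<open>Test integrals are taken against the completed measure, whereas boxes only
    generate the Borel sets; a Borel representative \<open>h'\<close> bridges the two.\<close>
  have "\<exists>h'\<in>borel_measurable lborel. AE x in lborel. h x = h' x"
    by (rule completion_ex_borel_measurable_real) (use h_int in auto)
  then obtain h' where h'[measurable]: "h' \<in> borel_measurable borel" and ae: "AE x in lborel. h x = h' x"
    by auto
  have aeL: "AE x in lebesgue. h x = h' x" using ae by (rule AE_completion)
  have h'_leb: "h' \<in> borel_measurable lebesgue"
    using h' by (simp add: measurable_completion)
  have h'L: "integrable lebesgue h'"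
    by (rule integrable_cong_AE_imp[OF h_int h'_leb]) (use aeL in \<open>auto elim: eventually_mono\<close>)
  then have h'_int: "integrable lborel h'" using integrable_completion[of h' lborel] by simp
  have box0: "(LINT x|lborel. indicator (box a b) x * h' x) = 0" if "cbox a b \<subseteq> \<Omega>" for a b
  proof -
    have "(\<lambda>k. LINT x|lborel. (1 - (1 - bump a b x) ^ k) * h' x) \<longlonglongrightarrow> (LINT x|lborel. indicator (box a b) x * h' x)"
    proof (rule integral_dominated_convergence[where w = "\<lambda>x. \<bar>h' x\<bar>"])
      have [measurable]: "bump a b \<in> borel_measurable borel"
        by (simp add: borel_measurable_continuous_onI smooth_fun_bump smooth_fun_continuous)
      show "(\<lambda>x. (1 - (1 - bump a b x) ^ k) * h' x) \<in> borel_measurable lborel" for k by measurable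
      show "AE x in lborel. (\<lambda>k. (1 - (1 - bump a b x) ^ k) * h' x) \<longlonglongrightarrow> indicator (box a b) x * h' x"
        by (auto intro!: AE_I2 tendsto_mult bump_power_tendsto)
      have "\<bar>1 - (1 - bump a b x) ^ k\<bar> \<le> 1" for x k
        using bump_range[of a b x] zero_le_power[of "1 - bump a b x" k] power_le_one[of "1 - bump a b x" k] by auto
      then show "AE x in lborel. norm ((1 - (1 - bump a b x) ^ k) * h' x) \<le> \<bar>h' x\<bar>" for k
        by (auto intro!: AE_I2 simp: abs_mult mult_left_le_one_le)
    qed (use h'_int in auto)
    moreover have "(LINT x|lborel. (1 - (1 - bump a b x) ^ k) * h' x) = 0" for k
    proof -
      have meas: "(\<lambda>x. 1 - (1 - bump a b x) ^ k) \<in> borel_measurable borel"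
        by (intro borel_measurable_continuous_onI continuous_intros smooth_fun_continuous smooth_fun_bump)
      then have "(LINT x|lborel. (1 - (1 - bump a b x) ^ k) * h' x) = (LINT x|lebesgue. (1 - (1 - bump a b x) ^ k) * h' x)"
        by (intro integral_completion[symmetric]) simp
      also have "\<dots> = (LINT x|lebesgue. (1 - (1 - bump a b x) ^ k) * h x)"
      proof (rule integral_cong_AE)
        have "(\<lambda>x. 1 - (1 - bump a b x) ^ k) \<in> borel_measurable lebesgue"
          using meas by (simp add: measurable_completion)
        then show "(\<lambda>x. (1 - (1 - bump a b x) ^ k) * h' x) \<in> borel_measurable lebesgue"
          "(\<lambda>x. (1 - (1 - bump a b x) ^ k) * h x) \<in> borel_measurable lebesgue"
          using h_int h'_leb by (auto intro: borel_measurable_times)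
      qed (use aeL in \<open>auto elim: eventually_mono\<close>)
      also have "\<dots> = 0"
        using zero[OF test_fun_bump[OF that, of k]]
        by (simp add: h_def set_lebesgue_integral_def mult_ac)
      finally show ?thesis .
    qed
    ultimately show ?thesis by (simp add: LIMSEQ_const_iff)
  qed
  \<comment> \<open>Inside a fixed box, the sets over which \<open>h'\<close> integrates to 0 form a
    Dynkin system: complements stay in it because the whole box has integral 0. It contains all
    boxes, since two boxes intersect in a box, hence every Borel set.\<close>
  have box_ae: "AE x in lborel. x \<in> box a b \<longrightarrow> h' x = 0" if ab: "cbox a b \<subseteq> \<Omega>" for a b
  proof -
    have int: "integrable lborel (\<lambda>x. indicator (box a b) x * h' x * indicator S x)" if "S \<in> sets borel" for S
      using h'_int that integrable_real_mult_indicator[of "box a b \<inter> S" lborel h']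
      by (simp add: indicator_inter_arith mult_ac)
    have borel_UNIV: "(UNIV :: (real^'n) set) \<in> sets borel" by simp
    have Gstab: "Int_stable (range (\<lambda>(c, d). box c d :: (real^'n) set))"
      by (force simp: Int_stable_def box_inter_cart(1))
    have Gpow: "range (\<lambda>(c, d). box c d :: (real^'n) set) \<subseteq> Pow UNIV" by simp
    have *: "(LINT x|lborel. indicator (box a b) x * h' x * indicator S x) = 0"
      if S: "S \<in> sigma_sets UNIV (range (\<lambda>(c, d). box c d))" for S :: "(real^'n) set"
      using Gstab Gpow S
    proof (induction rule: sigma_sets_induct_disjoint)
      fix A :: "(real^'n) set" assume "A \<in> range (\<lambda>(c, d). box c d)"
      then obtain c d where A: "A = box c d" by auto
      have "(LINT x|lborel. indicator (box a b) x * h' x * indicator A x)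
          = (LINT x|lborel. indicator (box a b \<inter> box c d) x * h' x)"
        by (simp add: A indicator_inter_arith mult_ac)
      also have "\<dots> = 0"
        unfolding box_inter_cart(1) by (rule box0) (use box_inter_cart(2)[of a c b d] ab in auto)
      finally show "(LINT x|lborel. indicator (box a b) x * h' x * indicator A x) = 0" .
    next
      fix A :: "(real^'n) set" assume A: "A \<in> sigma_sets UNIV (range (\<lambda>(c, d). box c d))"
        and IH: "(LINT x|lborel. indicator (box a b) x * h' x * indicator A x) = 0"
      have Ab: "A \<in> sets borel" using A by (simp add: borel_eq_box)
      have "(LINT x|lborel. indicator (box a b) x * h' x * indicator (UNIV - A) x)
         = (LINT x|lborel. indicator (box a b) x * h' x * indicator UNIV x
              - indicator (box a b) x * h' x * indicator A x)"
        by (intro Bochner_Integration.integral_cong) (auto simp: indicator_def)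
      also have "\<dots> = 0"
        using IH box0[OF ab] by (subst Bochner_Integration.integral_diff[OF int[OF borel_UNIV] int[OF Ab]]) auto
      finally show "(LINT x|lborel. indicator (box a b) x * h' x * indicator (UNIV - A) x) = 0" .
    next
      fix A :: "nat \<Rightarrow> (real^'n) set" assume dj: "disjoint_family A"
        and A: "range A \<subseteq> sigma_sets UNIV (range (\<lambda>(c, d). box c d))"
        and IH: "\<And>i. (LINT x|lborel. indicator (box a b) x * h' x * indicator (A i) x) = 0"
      have Ab: "A i \<in> sets borel" for i using A by (auto simp: borel_eq_box)
      have "(LINT x:(\<Union>i. A i)|lborel. indicator (box a b) x * h' x) = (\<Sum>i. LINT x:A i|lborel. indicator (box a b) x * h' x)"
        using dj Ab int[of "\<Union>i. A i"] by (intro lebesgue_integral_countable_add)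
          (auto simp: disjoint_family_on_def set_integrable_def mult_ac)
      with IH show "(LINT x|lborel. indicator (box a b) x * h' x * indicator (\<Union>i. A i) x) = 0"
        by (simp add: set_lebesgue_integral_def mult_ac)
    qed auto
    have "AE x in lborel. indicator (box a b) x * h' x = 0"
    proof (rule density_unique_real)
      show "integrable lborel (\<lambda>x. indicator (box a b) x * h' x)"
        using int[of UNIV] by simp
      show "(LINT x:A|lborel. indicator (box a b) x * h' x) = (LINT x:A|lborel. 0)" if "A \<in> sets lborel" for A
        using *[of A] that by (simp add: borel_eq_box set_lebesgue_integral_def mult_ac)
    qed simp
    then show ?thesis by (auto elim: eventually_mono)
  qed
  obtain D where D: "countable D" "\<And>X. X \<in> D \<Longrightarrow> X \<subseteq> \<Omega>" "\<And>X. X \<in> D \<Longrightarrow> \<exists>a b. X = cbox a b" "\<Union>D = \<Omega>"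
    using open_countable_Union_open_cbox[OF \<open>open \<Omega>\<close>] by (metis PowD subsetD)
  have "AE x in lborel. x \<in> X \<longrightarrow> h' x = 0" if "X \<in> D" for X
  proof -
    obtain a b where X: "X = cbox a b" using D(3)[OF \<open>X \<in> D\<close>] by auto
    \<comment> \<open>\<open>\<Omega>\<close> is a countable union of closed boxes, while
      \<open>box_ae\<close> treats open ones; the boundaries are null.\<close>
    have "AE x in lebesgue. x \<notin> cbox a b - box a b"
      using negligible_frontier_interval[of a b] by (intro AE_not_in) (simp add: negligible_iff_null_sets)
    then have "AE x in lborel. x \<notin> cbox a b - box a b"
      by (simp add: AE_completion_iff)
    then show ?thesis
      using box_ae[of a b] D(2)[OF \<open>X \<in> D\<close>] X by (auto elim: eventually_elim2)
  qed
  then have "AE x in lborel. \<forall>X\<in>D. x \<in> X \<longrightarrow> h' x = 0"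
    unfolding AE_ball_countable[OF D(1)] by blast
  then have "AE x in lborel. x \<in> \<Omega> \<longrightarrow> h' x = 0"
    by (rule eventually_mono) (use D(4) in blast)
  then have "AE x in lebesgue. x \<in> \<Omega> \<longrightarrow> h' x = 0" by (rule AE_completion)
  with aeL show ?thesis by eventually_elim (auto simp: h_def)
qed

section \<open>Weak gradients, the Dirichlet form and Poincare's inequality\<close>

lemma set_integrable_sum:
  fixes f :: "'i \<Rightarrow> 'a \<Rightarrow> real"
  assumes "\<And>i. i \<in> I \<Longrightarrow> set_integrable M A (f i)"
  shows "set_integrable M A (\<lambda>x. \<Sum>i\<in>I. f i x)"
  using assms unfolding set_integrable_def by (simp add: sum_distrib_left)

lemma set_integral_sum:
  fixes f :: "'i \<Rightarrow> 'a \<Rightarrow> real"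
  assumes "\<And>i. i \<in> I \<Longrightarrow> set_integrable M A (f i)"
  shows "(LINT x:A|M. \<Sum>i\<in>I. f i x) = (\<Sum>i\<in>I. LINT x:A|M. f i x)"
  using assms unfolding set_integrable_def set_lebesgue_integral_def
  by (simp add: sum_distrib_left Bochner_Integration.integral_sum)

lemma set_integral_nonneg_real:
  fixes f :: "'a \<Rightarrow> real"
  assumes "\<And>x. x \<in> A \<Longrightarrow> 0 \<le> f x"
  shows "0 \<le> (LINT x:A|M. f x)"
  unfolding set_lebesgue_integral_def
  by (rule Bochner_Integration.integral_nonneg) (use assms in \<open>auto simp: indicator_def\<close>)

lemma set_borel_measurable_times:
  fixes u v :: "'a \<Rightarrow> real"
  assumes "set_borel_measurable M A u" "set_borel_measurable M A v"
  shows "set_borel_measurable M A (\<lambda>x. u x * v x)"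
proof -
  have "(\<lambda>x. (indicator A x * u x) * (indicator A x * v x)) \<in> borel_measurable M"
    using assms unfolding set_borel_measurable_def by (auto intro: borel_measurable_times)
  also have "(\<lambda>x. (indicator A x * u x) * (indicator A x * v x)) = (\<lambda>x. indicator A x * (u x * v x))"
    by (auto simp: indicator_def)
  finally show ?thesis by (simp add: set_borel_measurable_def)
qed

lemma set_borel_measurable_lin:
  fixes u v :: "'a \<Rightarrow> real"
  assumes "set_borel_measurable M A u" "set_borel_measurable M A v"
  shows "set_borel_measurable M A (\<lambda>x. a * u x + b * v x)"
proof -
  have "(\<lambda>x. a * (indicator A x * u x) + b * (indicator A x * v x)) \<in> borel_measurable M"
    using assms unfolding set_borel_measurable_def
    by (intro borel_measurable_add borel_measurable_const[THEN borel_measurable_times]) auto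
  then show ?thesis by (simp add: set_borel_measurable_def algebra_simps)
qed

lemma set_integrable_times_of_squares:
  fixes u v :: "'a \<Rightarrow> real"
  assumes "set_borel_measurable M A u" "set_integrable M A (\<lambda>x. (u x)\<^sup>2)"
    and "set_borel_measurable M A v" "set_integrable M A (\<lambda>x. (v x)\<^sup>2)"
  shows "set_integrable M A (\<lambda>x. u x * v x)"
proof (rule set_integrable_bound[OF set_integral_add(1)[OF assms(2,4)]])
  show "set_borel_measurable M A (\<lambda>x. u x * v x)"
    using assms by (simp add: set_borel_measurable_times)
  have "\<bar>a * b\<bar> \<le> a\<^sup>2 + b\<^sup>2" for a b :: real
    using sum_squares_bound[of "\<bar>a\<bar>" "\<bar>b\<bar>"] abs_ge_zero[of "a * b"]
    unfolding abs_mult power2_abs by linarith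
  then show "AE x in M. x \<in> A \<longrightarrow> norm (u x * v x) \<le> norm ((u x)\<^sup>2 + (v x)\<^sup>2)"
    by auto
qed

lemma L2_times: "L2 \<Omega> u \<Longrightarrow> L2 \<Omega> v \<Longrightarrow> set_integrable lebesgue \<Omega> (\<lambda>x. u x * v x)"
  by (simp add: L2_def set_integrable_times_of_squares)

lemma L2_lin:
  assumes "L2 \<Omega> u" "L2 \<Omega> v"
  shows "L2 \<Omega> (\<lambda>x. a * u x + b * v x)"
proof -
  have "set_integrable lebesgue \<Omega> (\<lambda>x. a\<^sup>2 * (u x * u x) + (b\<^sup>2 * (v x * v x) + (2 * a * b) * (u x * v x)))"
    using assms by (intro set_integral_add(1) set_integrable_mult_right L2_times)
  also have "(\<lambda>x. a\<^sup>2 * (u x * u x) + (b\<^sup>2 * (v x * v x) + (2 * a * b) * (u x * v x))) = (\<lambda>x. (a * u x + b * v x)\<^sup>2)"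
    by (auto simp: algebra_simps power2_eq_square)
  finally show ?thesis using assms by (simp add: L2_def set_borel_measurable_lin)
qed

lemma L2_zero: "L2 \<Omega> (\<lambda>x. 0)"
  by (simp add: L2_def set_borel_measurable_def set_integrable_def)

lemma L2_sum:
  assumes "finite I" "\<And>i. i \<in> I \<Longrightarrow> L2 \<Omega> (w i)"
  shows "L2 \<Omega> (\<lambda>x. \<Sum>i\<in>I. c i * w i x)"
  using assms
proof (induction I)
  case (insert j J)
  then show ?case using L2_lin[of \<Omega> "w j" "\<lambda>x. \<Sum>i\<in>J. c i * w i x" "c j" 1] by simp
qed (simp add: L2_zero)

lemma L2norm_power2: "(L2norm \<Omega> v)\<^sup>2 = (LINT x:\<Omega>|lebesgue. (v x)\<^sup>2)"
  by (simp add: L2norm_def set_integral_nonneg_real)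

section \<open>Test functions and integration by parts\<close>

lemma test_fun_smooth: "test_fun \<Omega> \<phi> \<Longrightarrow> smooth_fun \<phi>"
  by (simp add: test_fun_def)

lemma test_fun_outside:
  assumes "test_fun \<Omega> \<phi>" "x \<notin> closure {x. \<phi> x \<noteq> 0}"
  shows "\<phi> x = 0" and "pderiv_i i \<phi> x = 0"
proof -
  have 0: "\<phi> y = 0" if "y \<in> - closure {x. \<phi> x \<noteq> 0}" for y
    using subsetD[OF closure_subset, of y "{x. \<phi> x \<noteq> 0}"] that by (metis Compl_iff mem_Collect_eq)
  then show "\<phi> x = 0" using assms(2) by blast
  have "(\<phi> has_derivative (\<lambda>v. 0)) (at x)"
    by (rule has_derivative_transform_within_open[OF has_derivative_const[of 0], of "- closure {x. \<phi> x \<noteq> 0}"])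
      (rule open_Compl[OF closed_closure], use assms(2) in blast, rule 0[symmetric])
  then show "pderiv_i i \<phi> x = 0"
    unfolding pderiv_i_def by (subst frechet_derivative_at[symmetric]) auto
qed

lemma test_fun_outside_domain:
  assumes "test_fun \<Omega> \<phi>" "x \<notin> \<Omega>"
  shows "\<phi> x = 0" and "pderiv_i i \<phi> x = 0"
proof -
  have "x \<notin> closure {x. \<phi> x \<noteq> 0}" using assms unfolding test_fun_def by blast
  then show "\<phi> x = 0" "pderiv_i i \<phi> x = 0" by (rule test_fun_outside[OF assms(1)])+
qed

lemma test_fun_mult:
  assumes "test_fun \<Omega> \<phi>" "smooth_fun \<eta>"
  shows "test_fun \<Omega> (\<lambda>x. \<eta> x * \<phi> x)"
proof -
  have "closure {x. \<eta> x * \<phi> x \<noteq> 0} \<subseteq> closure {x. \<phi> x \<noteq> 0}"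
    by (rule closure_mono) auto
  moreover from this compact_Int_closed[OF _ closed_closure, of "closure {x. \<phi> x \<noteq> 0}" "{x. \<eta> x * \<phi> x \<noteq> 0}"]
  have "compact (closure {x. \<eta> x * \<phi> x \<noteq> 0})"
    using assms(1) by (simp add: Int_absorb1 test_fun_def)
  ultimately show ?thesis
    using assms by (auto simp: test_fun_def smooth_fun_mult)
qed

lemma test_fun_add:
  assumes "test_fun \<Omega> \<phi>" "test_fun \<Omega> \<psi>"
  shows "test_fun \<Omega> (\<lambda>x. \<phi> x + \<psi> x)"
proof -
  let ?S = "closure {x. \<phi> x \<noteq> 0} \<union> closure {x. \<psi> x \<noteq> 0}"
  have sub: "closure {x. \<phi> x + \<psi> x \<noteq> 0} \<subseteq> ?S"
    unfolding closure_Un[symmetric] by (rule closure_mono) auto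
  have "compact ?S" using assms by (auto simp: test_fun_def)
  from compact_Int_closed[OF this closed_closure, of "{x. \<phi> x + \<psi> x \<noteq> 0}"] sub
  have "compact (closure {x. \<phi> x + \<psi> x \<noteq> 0})" by (simp add: Int_absorb1)
  with sub assms show ?thesis
    by (auto simp: test_fun_def smooth_fun_add)
qed

lemma test_fun_lin:
  "test_fun \<Omega> \<phi> \<Longrightarrow> test_fun \<Omega> \<psi> \<Longrightarrow> test_fun \<Omega> (\<lambda>x. a * \<phi> x + b * \<psi> x)"
  by (intro test_fun_add test_fun_mult smooth_fun_const)

text \<open>The support of \<open>\<phi>\<close> serves for any smooth \<open>g\<close> vanishing
  outside it, which covers derivatives of \<open>\<phi>\<close> and products with smooth factors at
  once.\<close>

lemma integrable_smooth_compact: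
  assumes "test_fun \<Omega> \<phi>" "smooth_fun g" "\<And>x. x \<notin> closure {x. \<phi> x \<noteq> 0} \<Longrightarrow> g x = 0"
  shows "integrable lborel g"
proof -
  have "compact (closure {x. \<phi> x \<noteq> 0})" using assms(1) by (simp add: test_fun_def)
  from borel_integrable_compact[OF this smooth_fun_continuous[OF assms(2)]]
  have "integrable lborel (\<lambda>x. indicator (closure {x. \<phi> x \<noteq> 0}) x *\<^sub>R g x)" .
  also have "(\<lambda>x. indicator (closure {x. \<phi> x \<noteq> 0}) x *\<^sub>R g x) = g"
  proof
    fix x show "indicator (closure {x. \<phi> x \<noteq> 0}) x *\<^sub>R g x = g x"
      using assms(3)[of x] by (cases "x \<in> closure {x. \<phi> x \<noteq> 0}") simp_all
  qed
  finally show ?thesis .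
qed

text \<open>Passes from the Lebesgue integral over \<open>\<Omega>\<close> in the definitions to
  \<open>lborel\<close> on the whole space, where translation invariance is available.\<close>

lemma set_integral_test:
  fixes g :: "real^'n \<Rightarrow> real"
  assumes "g \<in> borel_measurable borel" "\<And>x. x \<notin> \<Omega> \<Longrightarrow> g x = 0"
  shows "(LINT x:\<Omega>|lebesgue. g x) = (LINT x|lborel. g x)"
proof -
  have "(\<lambda>x. indicator \<Omega> x *\<^sub>R g x) = g"
  proof
    show "indicator \<Omega> x *\<^sub>R g x = g x" for x using assms(2)[of x] by (cases "x \<in> \<Omega>") simp_all
  qed
  then show ?thesis using assms(1) by (simp add: set_lebesgue_integral_def integral_completion)
qed

lemma L2_test:
  assumes "test_fun \<Omega> \<phi>" "smooth_fun g" "\<And>x. x \<notin> closure {x. \<phi> x \<noteq> 0} \<Longrightarrow> g x = 0"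
  shows "L2 \<Omega> g"
proof -
  have out: "x \<notin> \<Omega> \<Longrightarrow> g x = 0" for x using assms(1,3) by (auto simp: test_fun_def)
  have "indicator \<Omega> x * g x = g x" "indicator \<Omega> x * (g x)\<^sup>2 = (g x)\<^sup>2" for x
    using out[of x] by (cases "x \<in> \<Omega>"; simp)+
  then have "(\<lambda>x. indicator \<Omega> x * g x) = g" "(\<lambda>x. indicator \<Omega> x * (g x)\<^sup>2) = (\<lambda>x. (g x)\<^sup>2)"
    by (intro ext; simp)+
  moreover have "integrable lborel (\<lambda>x. (g x)\<^sup>2)" "integrable lborel g"
    using assms by (auto intro!: integrable_smooth_compact[OF assms(1)] smooth_fun_power)
  ultimately show ?thesis
    by (auto simp: L2_def set_borel_measurable_def set_integrable_def
        intro!: measurable_completion integrable_completion[THEN iffD2])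
qed

lemma L2_test_fun: "test_fun \<Omega> \<phi> \<Longrightarrow> L2 \<Omega> \<phi>" for \<phi> :: "real^'n \<Rightarrow> real"
proof -
  assume \<phi>: "test_fun \<Omega> \<phi>"
  show "L2 \<Omega> \<phi>" by (rule L2_test[OF \<phi> test_fun_smooth[OF \<phi>]]) (rule test_fun_outside(1)[OF \<phi>])
qed

lemma L2_test_pderiv: "test_fun \<Omega> \<phi> \<Longrightarrow> L2 \<Omega> (pderiv_i i \<phi>)"
proof -
  assume \<phi>: "test_fun \<Omega> \<phi>"
  show "L2 \<Omega> (pderiv_i i \<phi>)"
    by (rule L2_test[OF \<phi> smooth_fun_pderiv[OF test_fun_smooth[OF \<phi>]]]) (rule test_fun_outside(2)[OF \<phi>])
qed

text \<open>By translation invariance the integrals of the difference quotients of \<open>\<phi>\<close> vanish.\<close>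
lemma integral_pderiv_test:
  fixes \<phi> :: "real^'n \<Rightarrow> real"
  assumes \<phi>: "test_fun \<Omega> \<phi>"
  shows "(LINT x|lborel. pderiv_i i \<phi> x) = 0"
proof -
  define e :: "real^'n" where "e = axis i 1"
  define h :: "nat \<Rightarrow> real" where "h k = inverse (real (Suc k))" for k
  define q where "q k x = (\<phi> (h k *\<^sub>R e + x) - \<phi> x) / h k" for k x
  let ?S = "closure {x. \<phi> x \<noteq> 0}"
  have h: "0 < h k" "h k \<le> 1" for k by (auto simp: h_def divide_simps)
  have sm: "smooth_fun \<phi>" using \<phi> by (rule test_fun_smooth)
  have int: "integrable lborel \<phi>"
    by (rule integrable_smooth_compact[OF \<phi> sm test_fun_outside(1)[OF \<phi>]])
  then have meas[measurable]: "\<phi> \<in> borel_measurable borel" by auto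
  have cmp: "compact ?S" using \<phi> by (simp add: test_fun_def)
  have "bounded (pderiv_i i \<phi> ` ?S)"
    by (intro compact_imp_bounded compact_continuous_image smooth_fun_continuous smooth_fun_pderiv sm cmp)
  then obtain C0 where C0: "\<And>x. x \<in> ?S \<Longrightarrow> \<bar>pderiv_i i \<phi> x\<bar> \<le> C0"
    unfolding bounded_iff by auto
  \<comment> \<open>The bound must also hold off the support, where the derivative is 0; for an
    empty support \<open>C0\<close> could be negative.\<close>
  define C where "C = max C0 0"
  have C: "\<bar>pderiv_i i \<phi> x\<bar> \<le> C" for x
    using C0[of x] test_fun_outside(2)[OF \<phi>, of x i] by (cases "x \<in> ?S") (auto simp: C_def)
  obtain R where R: "\<And>x. x \<in> ?S \<Longrightarrow> norm x \<le> R"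
    using compact_imp_bounded[OF cmp] unfolding bounded_iff by auto
  have line: "((\<lambda>s. \<phi> (s *\<^sub>R e + x)) has_real_derivative pderiv_i i \<phi> (s *\<^sub>R e + x)) (at s)" for x s
  proof -
    have "((\<lambda>s. s *\<^sub>R e + x) has_derivative (\<lambda>r. r *\<^sub>R e)) (at s)"
      by (auto intro!: derivative_eq_intros)
    from has_derivative_compose[OF this smooth_fun_has_derivative[OF sm]]
    have "((\<lambda>s. \<phi> (s *\<^sub>R e + x)) has_derivative (\<lambda>r. frechet_derivative \<phi> (at (s *\<^sub>R e + x)) (r *\<^sub>R e))) (at s)" .
    moreover have "frechet_derivative \<phi> (at (s *\<^sub>R e + x)) (r *\<^sub>R e) = pderiv_i i \<phi> (s *\<^sub>R e + x) * r" for r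
      using linear_cmul[OF has_derivative_linear[OF smooth_fun_has_derivative[OF sm]]]
      by (simp add: pderiv_i_def e_def mult.commute)
    then have "(\<lambda>r. frechet_derivative \<phi> (at (s *\<^sub>R e + x)) (r *\<^sub>R e)) = (*) (pderiv_i i \<phi> (s *\<^sub>R e + x))"
      by (rule ext)
    ultimately show ?thesis by (simp only: has_field_derivative_def)
  qed
  \<comment> \<open>The mean value theorem bounds every quotient by \<open>C\<close>. The steps have
    length at most 1, so beyond radius \<open>R + 1\<close> both evaluation points miss the
    support.\<close>
  have "(\<lambda>k. LINT x|lborel. q k x) \<longlonglongrightarrow> (LINT x|lborel. pderiv_i i \<phi> x)"
  proof (rule integral_dominated_convergence[where w = "\<lambda>x. indicator (cball 0 (R + 1)) x * C"])
    show "pderiv_i i \<phi> \<in> borel_measurable lborel"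
      by (simp add: borel_measurable_continuous_onI smooth_fun_continuous smooth_fun_pderiv sm)
    show "q k \<in> borel_measurable lborel" for k
      unfolding q_def[abs_def] by measurable
    show "integrable lborel (\<lambda>x. indicator (cball (0::real^'n) (R + 1)) x * C :: real)"
      using borel_integrable_compact[OF compact_cball[of "0::real^'n" "R + 1"] continuous_on_const[of _ C]] by simp
    show "AE x in lborel. (\<lambda>k. q k x) \<longlonglongrightarrow> pderiv_i i \<phi> x"
    proof (rule AE_I2)
      fix x
      have "((\<lambda>t. (\<phi> ((0 + t) *\<^sub>R e + x) - \<phi> (0 *\<^sub>R e + x)) / t) \<longlongrightarrow> pderiv_i i \<phi> (0 *\<^sub>R e + x)) (at 0)"
        using line[of x 0] by (simp add: DERIV_def)
      moreover have "filterlim h (at 0) sequentially"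
        unfolding filterlim_at h_def
        using LIMSEQ_inverse_real_of_nat by (auto simp: less_imp_neq[symmetric])
      ultimately show "(\<lambda>k. q k x) \<longlonglongrightarrow> pderiv_i i \<phi> x"
        unfolding q_def by (auto dest: filterlim_compose)
    qed
    show "AE x in lborel. norm (q k x) \<le> indicator (cball 0 (R + 1)) x * C" for k
    proof (rule AE_I2)
      fix x
      obtain z where z: "\<phi> (h k *\<^sub>R e + x) - \<phi> (0 *\<^sub>R e + x) = (h k - 0) * pderiv_i i \<phi> (z *\<^sub>R e + x)"
        using MVT2[OF h(1)[of k], of "\<lambda>s. \<phi> (s *\<^sub>R e + x)" "\<lambda>s. pderiv_i i \<phi> (s *\<^sub>R e + x)"] line by blast
      then have qC: "\<bar>q k x\<bar> \<le> C" using C h(1)[of k] by (simp add: q_def)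
      show "norm (q k x) \<le> indicator (cball 0 (R + 1)) x * C"
      proof (cases "x \<in> cball 0 (R + 1)")
        case False
        then have "norm x > R + 1" by simp
        moreover have "norm (h k *\<^sub>R e) \<le> 1" using h[of k] by (simp add: e_def)
        ultimately have "norm (h k *\<^sub>R e + x) > R" "norm x > R"
          using norm_triangle_ineq4[of "h k *\<^sub>R e + x" "h k *\<^sub>R e"] by auto
        then have "h k *\<^sub>R e + x \<notin> ?S" "x \<notin> ?S" using R by (meson not_le)+
        from this[THEN test_fun_outside(1)[OF \<phi>]] show ?thesis using False by (simp add: q_def)
      qed (use qC in simp)
    qed
  qed
  moreover have "(LINT x|lborel. q k x) = 0" for k
  proof -
    have "(LINT x|lborel. \<phi> x) = (LINT x|distr lborel borel ((+) (h k *\<^sub>R e)). \<phi> x)"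
      by (simp add: lborel_distr_plus)
    also have "\<dots> = (LINT x|lborel. \<phi> (h k *\<^sub>R e + x))"
      by (subst integral_distr) auto
    finally have eq: "(LINT x|lborel. \<phi> (h k *\<^sub>R e + x)) = (LINT x|lborel. \<phi> x)" ..
    have "integrable (distr lborel borel ((+) (h k *\<^sub>R e))) \<phi>"
      using int by (simp add: lborel_distr_plus)
    then have "integrable lborel (\<lambda>x. \<phi> (h k *\<^sub>R e + x))"
      by (subst (asm) integrable_distr_eq) auto
    then show ?thesis unfolding q_def using int eq by simp
  qed
  ultimately show ?thesis by (simp add: LIMSEQ_const_iff)
qed

text \<open>Apply \<open>integral_pderiv_test\<close> to the product of \<open>\<eta>\<close> and
  \<open>\<phi>\<close>, which has compact support even when \<open>\<eta>\<close> has not.\<close>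

lemma test_integration_by_parts:
  assumes \<phi>: "test_fun \<Omega> \<phi>" and \<eta>: "smooth_fun \<eta>"
  shows "(LINT x:\<Omega>|lebesgue. \<eta> x * pderiv_i i \<phi> x) = - (LINT x:\<Omega>|lebesgue. pderiv_i i \<eta> x * \<phi> x)"
proof -
  have sm: "smooth_fun \<phi>" using \<phi> by (rule test_fun_smooth)
  have sms: "smooth_fun (\<lambda>x. \<eta> x * pderiv_i i \<phi> x)" "smooth_fun (\<lambda>x. pderiv_i i \<eta> x * \<phi> x)"
    by (intro smooth_fun_mult smooth_fun_pderiv \<eta> sm)+
  have int: "integrable lborel (\<lambda>x. \<eta> x * pderiv_i i \<phi> x)" "integrable lborel (\<lambda>x. pderiv_i i \<eta> x * \<phi> x)"
    using integrable_smooth_compact[OF \<phi> sms(1)] integrable_smooth_compact[OF \<phi> sms(2)] test_fun_outside[OF \<phi>]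
    by (metis mult_zero_right)+
  have "0 = (LINT x|lborel. \<eta> x * pderiv_i i \<phi> x + pderiv_i i \<eta> x * \<phi> x)"
    using integral_pderiv_test[OF test_fun_mult[OF \<phi> \<eta>]] by (simp add: pderiv_i_mult[OF \<eta> sm])
  also have "\<dots> = (LINT x|lborel. \<eta> x * pderiv_i i \<phi> x) + (LINT x|lborel. pderiv_i i \<eta> x * \<phi> x)"
    by (rule Bochner_Integration.integral_add[OF int])
  also have "(LINT x|lborel. \<eta> x * pderiv_i i \<phi> x) = (LINT x:\<Omega>|lebesgue. \<eta> x * pderiv_i i \<phi> x)"
    using int by (intro set_integral_test[symmetric]) (auto simp: test_fun_outside_domain[OF \<phi>])
  also have "(LINT x|lborel. pderiv_i i \<eta> x * \<phi> x) = (LINT x:\<Omega>|lebesgue. pderiv_i i \<eta> x * \<phi> x)"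
    using int by (intro set_integral_test[symmetric]) (auto simp: test_fun_outside_domain[OF \<phi>])
  finally show ?thesis by simp
qed

lemma weak_grad_test:
  assumes \<phi>: "test_fun \<Omega> \<phi>"
  shows "weak_grad \<Omega> \<phi> (\<lambda>x. \<chi> i. pderiv_i i \<phi> x)"
  unfolding weak_grad_def
  using L2_test_pderiv[OF \<phi>] test_integration_by_parts[OF _ test_fun_smooth[OF \<phi>]] by simp

section \<open>Weak gradients and the Dirichlet form\<close>

lemma weak_grad_lin:
  assumes "weak_grad \<Omega> u g" "weak_grad \<Omega> v h" "L2 \<Omega> u" "L2 \<Omega> v"
  shows "weak_grad \<Omega> (\<lambda>x. a * u x + b * v x) (\<lambda>x. a *\<^sub>R g x + b *\<^sub>R h x)"
  unfolding weak_grad_def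
proof (intro conjI allI impI)
  fix i show "L2 \<Omega> (\<lambda>x. (a *\<^sub>R g x + b *\<^sub>R h x) $ i)"
    using assms(1,2) by (simp add: weak_grad_def L2_lin)
next
  fix \<phi> i assume \<phi>: "test_fun \<Omega> \<phi>"
  have gh: "L2 \<Omega> (\<lambda>x. g x $ i)" "L2 \<Omega> (\<lambda>x. h x $ i)" using assms(1,2) by (auto simp: weak_grad_def)
  note int = L2_times[OF assms(3) L2_test_pderiv[OF \<phi>, of i]] L2_times[OF assms(4) L2_test_pderiv[OF \<phi>, of i]]
    L2_times[OF gh(1) L2_test_fun[OF \<phi>]] L2_times[OF gh(2) L2_test_fun[OF \<phi>]]
  have "(LINT x:\<Omega>|lebesgue. (a * u x + b * v x) * pderiv_i i \<phi> x)
      = (LINT x:\<Omega>|lebesgue. a * (u x * pderiv_i i \<phi> x) + b * (v x * pderiv_i i \<phi> x))"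
    by (simp add: algebra_simps)
  also have "\<dots> = a * (LINT x:\<Omega>|lebesgue. u x * pderiv_i i \<phi> x) + b * (LINT x:\<Omega>|lebesgue. v x * pderiv_i i \<phi> x)"
    using int by (subst set_integral_add(2)) auto
  also have "\<dots> = - (a * (LINT x:\<Omega>|lebesgue. g x $ i * \<phi> x) + b * (LINT x:\<Omega>|lebesgue. h x $ i * \<phi> x))"
    using assms(1,2) \<phi> by (simp add: weak_grad_def)
  also have "a * (LINT x:\<Omega>|lebesgue. g x $ i * \<phi> x) + b * (LINT x:\<Omega>|lebesgue. h x $ i * \<phi> x)
      = (LINT x:\<Omega>|lebesgue. a * (g x $ i * \<phi> x) + b * (h x $ i * \<phi> x))"
    using int by (subst set_integral_add(2)) auto
  finally show "(LINT x:\<Omega>|lebesgue. (a * u x + b * v x) * pderiv_i i \<phi> x)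
      = - (LINT x:\<Omega>|lebesgue. (a *\<^sub>R g x + b *\<^sub>R h x) $ i * \<phi> x)"
    by (simp add: algebra_simps)
qed

lemma H1_weak_grad: "H1 \<Omega> u \<Longrightarrow> weak_grad \<Omega> u (wgrad \<Omega> u)"
  unfolding H1_def wgrad_def by (elim conjE someI_ex)

lemma H1_L2: "H1 \<Omega> u \<Longrightarrow> L2 \<Omega> u"
  by (simp add: H1_def)

lemma H1_lin: "H1 \<Omega> u \<Longrightarrow> H1 \<Omega> v \<Longrightarrow> H1 \<Omega> (\<lambda>x. a * u x + b * v x)"
  unfolding H1_def by (blast intro: L2_lin weak_grad_lin)

lemma H1_test: "test_fun \<Omega> \<phi> \<Longrightarrow> H1 \<Omega> \<phi>"
  unfolding H1_def by (blast intro: L2_test_fun weak_grad_test)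

lemma set_integrable_weak_grad_inner:
  assumes "weak_grad \<Omega> u g" "weak_grad \<Omega> v h"
  shows "set_integrable lebesgue \<Omega> (\<lambda>x. g x \<bullet> h x)"
  using assms unfolding weak_grad_def inner_vec_def inner_real_def
  by (auto intro!: set_integrable_sum L2_times)

definition dirichlet :: "(real^'n) set \<Rightarrow> (real^'n \<Rightarrow> real) \<Rightarrow> (real^'n \<Rightarrow> real) \<Rightarrow> real" where
  "dirichlet \<Omega> u v = (LINT x:\<Omega>|lebesgue. wgrad \<Omega> u x \<bullet> wgrad \<Omega> v x)"

definition ip :: "(real^'n) set \<Rightarrow> (real^'n \<Rightarrow> real) \<Rightarrow> (real^'n \<Rightarrow> real) \<Rightarrow> real" where
  "ip \<Omega> u v = (LINT x:\<Omega>|lebesgue. u x * v x)"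

lemma ip_sym: "ip \<Omega> u v = ip \<Omega> v u"
  by (simp add: ip_def mult.commute)

lemma ip_nonneg: "0 \<le> ip \<Omega> v v"
  unfolding ip_def by (rule set_integral_nonneg_real) simp

lemma L2norm_ip: "(L2norm \<Omega> v)\<^sup>2 = ip \<Omega> v v"
  unfolding L2norm_power2 ip_def by (simp add: power2_eq_square)

lemma ip_lin:
  assumes "L2 \<Omega> u" "L2 \<Omega> v" "L2 \<Omega> w"
  shows "ip \<Omega> (\<lambda>x. a * u x + b * v x) w = a * ip \<Omega> u w + b * ip \<Omega> v w"
proof -
  have "ip \<Omega> (\<lambda>x. a * u x + b * v x) w = (LINT x:\<Omega>|lebesgue. a * (u x * w x) + b * (v x * w x))"
    by (simp add: ip_def algebra_simps)
  also have "\<dots> = a * ip \<Omega> u w + b * ip \<Omega> v w"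
    unfolding ip_def using assms by (subst set_integral_add(2)) (auto intro: L2_times)
  finally show ?thesis .
qed

lemma dirichlet_sym: "dirichlet \<Omega> u v = dirichlet \<Omega> v u"
  by (simp add: dirichlet_def inner_commute)

lemma dirichlet_nonneg: "0 \<le> dirichlet \<Omega> v v"
  unfolding dirichlet_def by (rule set_integral_nonneg_real) simp

lemma H10norm_power2: "(H10norm \<Omega> v)\<^sup>2 = dirichlet \<Omega> v v"
  by (simp add: H10norm_def dirichlet_def power2_norm_eq_inner set_integral_nonneg_real)

lemma H1norm_power2: "(H1norm \<Omega> v)\<^sup>2 = ip \<Omega> v v + dirichlet \<Omega> v v"
proof -
  have "ip \<Omega> v v = (LINT x:\<Omega>|lebesgue. (v x)\<^sup>2)"
    by (simp add: ip_def power2_eq_square)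
  moreover have "dirichlet \<Omega> v v = (LINT x:\<Omega>|lebesgue. (norm (wgrad \<Omega> v x))\<^sup>2)"
    by (simp add: dirichlet_def power2_norm_eq_inner)
  ultimately show ?thesis
    using ip_nonneg[of \<Omega> v] dirichlet_nonneg[of \<Omega> v] by (simp add: H1norm_def)
qed

lemma ip_lin_expand:
  assumes "L2 \<Omega> u" "L2 \<Omega> v"
  shows "ip \<Omega> (\<lambda>x. a * u x + b * v x) (\<lambda>x. a * u x + b * v x)
    = a\<^sup>2 * ip \<Omega> u u + 2 * a * b * ip \<Omega> u v + b\<^sup>2 * ip \<Omega> v v"
proof -
  let ?w = "\<lambda>x. a * u x + b * v x"
  have w: "L2 \<Omega> ?w" by (rule L2_lin[OF assms])
  have "ip \<Omega> u ?w = a * ip \<Omega> u u + b * ip \<Omega> u v"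
    "ip \<Omega> v ?w = a * ip \<Omega> u v + b * ip \<Omega> v v"
    using ip_lin[OF assms assms(1), of a b] ip_lin[OF assms assms(2), of a b]
      ip_sym[of \<Omega> u ?w] ip_sym[of \<Omega> v ?w] ip_sym[of \<Omega> u v] by simp_all
  then show ?thesis
    unfolding ip_lin[OF assms w] by (simp add: algebra_simps power2_eq_square)
qed

text \<open>Parallelogram law: adding the nonnegative value at \<open>a * u - b * v\<close> cancels
  the mixed term and doubles the squares.\<close>

lemma ip_lin_le:
  assumes "L2 \<Omega> u" "L2 \<Omega> v"
  shows "ip \<Omega> (\<lambda>x. a * u x + b * v x) (\<lambda>x. a * u x + b * v x)
    \<le> 2 * a\<^sup>2 * ip \<Omega> u u + 2 * b\<^sup>2 * ip \<Omega> v v"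
  using ip_nonneg[of \<Omega> "\<lambda>x. a * u x + (-b) * v x"]
    ip_lin_expand[OF assms, of a "-b"] ip_lin_expand[OF assms, of a b] by (simp add: algebra_simps)

lemma H10_H1: "H10 \<Omega> v \<Longrightarrow> H1 \<Omega> v"
  by (simp add: H10_def)

context
  fixes \<Omega> :: "(real^'n) set"
  assumes opn: "open \<Omega>" and bdd: "bounded \<Omega>"
begin

lemma set_integrable_bounded_domain:
  fixes g :: "real^'n \<Rightarrow> real"
  assumes "L2 \<Omega> g"
  shows "set_integrable lebesgue \<Omega> g"
proof -
  have "\<Omega> \<in> lmeasurable" using opn bdd by (simp add: lmeasurable_open)
  then have "L2 \<Omega> (\<lambda>x. 1)"
    by (auto simp: L2_def set_integrable_def set_borel_measurable_def fmeasurable_def)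
  from L2_times[OF assms this] show ?thesis by simp
qed

text \<open>Each component of the difference integrates to 0 against every test function. On a
  bounded domain L2 functions are integrable, as the fundamental lemma asks.\<close>

lemma weak_grad_unique:
  assumes "weak_grad \<Omega> v g" "weak_grad \<Omega> v h"
  shows "AE x in lebesgue. x \<in> \<Omega> \<longrightarrow> g x = h x"
proof -
  have "AE x in lebesgue. x \<in> \<Omega> \<longrightarrow> g x $ i - h x $ i = 0" for i
  proof (rule AE_zero_if_test_integrals_zero[OF opn])
    have gh: "L2 \<Omega> (\<lambda>x. g x $ i)" "L2 \<Omega> (\<lambda>x. h x $ i)"
      using assms by (auto simp: weak_grad_def)
    then show "set_integrable lebesgue \<Omega> (\<lambda>x. g x $ i - h x $ i)"
      by (intro set_integral_diff(1) set_integrable_bounded_domain)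
    fix \<phi> assume \<phi>: "test_fun \<Omega> \<phi>"
    show "(LINT x:\<Omega>|lebesgue. (g x $ i - h x $ i) * \<phi> x) = 0"
      using assms \<phi> L2_times[OF gh(1) L2_test_fun[OF \<phi>]] L2_times[OF gh(2) L2_test_fun[OF \<phi>]]
      by (simp add: left_diff_distrib weak_grad_def set_integral_diff(2))
  qed
  then have "AE x in lebesgue. \<forall>i. x \<in> \<Omega> \<longrightarrow> g x $ i - h x $ i = 0"
    unfolding AE_all_countable by blast
  then show ?thesis by eventually_elim (auto simp: vec_eq_iff)
qed

text \<open>Lets any explicit weak gradient stand in for the one chosen by \<open>wgrad\<close>;
  linearity and the computations with test functions go through it.\<close>

lemma dirichlet_eq:
  assumes "weak_grad \<Omega> u g" "weak_grad \<Omega> v h"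
  shows "dirichlet \<Omega> u v = (LINT x:\<Omega>|lebesgue. g x \<bullet> h x)"
proof -
  have w: "weak_grad \<Omega> u (wgrad \<Omega> u)" "weak_grad \<Omega> v (wgrad \<Omega> v)"
    unfolding wgrad_def using someI[of "weak_grad \<Omega> u", OF assms(1)] someI[of "weak_grad \<Omega> v", OF assms(2)] by simp_all
  have "AE x\<in>\<Omega> in lebesgue. wgrad \<Omega> u x \<bullet> wgrad \<Omega> v x = g x \<bullet> h x"
    using weak_grad_unique[OF w(1) assms(1)] weak_grad_unique[OF w(2) assms(2)]
    by eventually_elim auto
  then have "AE x in lebesgue. indicator \<Omega> x *\<^sub>R (wgrad \<Omega> u x \<bullet> wgrad \<Omega> v x) = indicator \<Omega> x *\<^sub>R (g x \<bullet> h x)"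
    by eventually_elim (auto simp: indicator_def)
  then show ?thesis unfolding dirichlet_def set_lebesgue_integral_def
    using set_integrable_weak_grad_inner[OF w] set_integrable_weak_grad_inner[OF assms]
    by (intro integral_cong_AE) (auto simp: set_integrable_def dest: borel_measurable_integrable)
qed

lemma dirichlet_lin:
  assumes "H1 \<Omega> u" "H1 \<Omega> v" "H1 \<Omega> w"
  shows "dirichlet \<Omega> (\<lambda>x. a * u x + b * v x) w = a * dirichlet \<Omega> u w + b * dirichlet \<Omega> v w"
proof -
  note g = assms[THEN H1_weak_grad]
  have "dirichlet \<Omega> (\<lambda>x. a * u x + b * v x) w
      = (LINT x:\<Omega>|lebesgue. (a *\<^sub>R wgrad \<Omega> u x + b *\<^sub>R wgrad \<Omega> v x) \<bullet> wgrad \<Omega> w x)"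
    by (rule dirichlet_eq[OF weak_grad_lin[OF g(1,2)] g(3)]) (use assms in \<open>auto simp: H1_def\<close>)
  also have "\<dots> = (LINT x:\<Omega>|lebesgue. a * (wgrad \<Omega> u x \<bullet> wgrad \<Omega> w x) + b * (wgrad \<Omega> v x \<bullet> wgrad \<Omega> w x))"
    by (simp add: inner_add_left)
  also have "\<dots> = a * dirichlet \<Omega> u w + b * dirichlet \<Omega> v w"
    unfolding dirichlet_def using g
    by (subst set_integral_add(2)) (auto intro: set_integrable_weak_grad_inner)
  finally show ?thesis .
qed

lemma H1_zero: "H1 \<Omega> (\<lambda>x. 0)"
  using H1_test[of \<Omega> "\<lambda>x. 0"] by (simp add: test_fun_def smooth_fun_const)

lemma H1_sum:
  assumes "finite I" "\<And>i. i \<in> I \<Longrightarrow> H1 \<Omega> (w i)"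
  shows "H1 \<Omega> (\<lambda>x. \<Sum>i\<in>I. c i * w i x)"
  using assms
proof (induction I)
  case (insert j J)
  then show ?case using H1_lin[of \<Omega> "w j" "\<lambda>x. \<Sum>i\<in>J. c i * w i x" "c j" 1] by simp
qed (simp add: H1_zero)

lemma dirichlet_sum_left:
  assumes "finite I" "\<And>i. i \<in> I \<Longrightarrow> H1 \<Omega> (w i)" "H1 \<Omega> v"
  shows "dirichlet \<Omega> (\<lambda>x. \<Sum>i\<in>I. c i * w i x) v = (\<Sum>i\<in>I. c i * dirichlet \<Omega> (w i) v)"
  using assms
proof (induction I)
  case empty
  then show ?case using dirichlet_lin[OF H1_zero H1_zero, of v 0 0] by simp
next
  case (insert j J)
  then show ?case
    using dirichlet_lin[of "w j" "\<lambda>x. \<Sum>i\<in>J. c i * w i x" v "c j" 1] by (simp add: H1_sum)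
qed

lemma dirichlet_sum_right:
  assumes "finite I" "\<And>i. i \<in> I \<Longrightarrow> H1 \<Omega> (w i)" "H1 \<Omega> v"
  shows "dirichlet \<Omega> v (\<lambda>x. \<Sum>i\<in>I. c i * w i x) = (\<Sum>i\<in>I. c i * dirichlet \<Omega> v (w i))"
  by (subst (1 2) dirichlet_sym) (rule dirichlet_sum_left[OF assms])

lemma dirichlet_lin_expand:
  assumes "H1 \<Omega> u" "H1 \<Omega> v"
  shows "dirichlet \<Omega> (\<lambda>x. a * u x + b * v x) (\<lambda>x. a * u x + b * v x)
    = a\<^sup>2 * dirichlet \<Omega> u u + 2 * a * b * dirichlet \<Omega> u v + b\<^sup>2 * dirichlet \<Omega> v v"
proof -
  let ?w = "\<lambda>x. a * u x + b * v x"
  have w: "H1 \<Omega> ?w" by (rule H1_lin[OF assms])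
  have "dirichlet \<Omega> u ?w = a * dirichlet \<Omega> u u + b * dirichlet \<Omega> u v"
    "dirichlet \<Omega> v ?w = a * dirichlet \<Omega> u v + b * dirichlet \<Omega> v v"
    using dirichlet_lin[OF assms assms(1), of a b] dirichlet_lin[OF assms assms(2), of a b]
      dirichlet_sym[of \<Omega> u ?w] dirichlet_sym[of \<Omega> v ?w] dirichlet_sym[of \<Omega> u v] by simp_all
  then show ?thesis
    unfolding dirichlet_lin[OF assms w] by (simp add: algebra_simps power2_eq_square)
qed

lemma dirichlet_young:
  assumes "H1 \<Omega> u" "H1 \<Omega> v"
  shows "2 * dirichlet \<Omega> u v \<le> dirichlet \<Omega> u u + dirichlet \<Omega> v v"
  using dirichlet_nonneg[of \<Omega> "\<lambda>x. 1 * u x + (-1) * v x"] dirichlet_lin_expand[OF assms, of 1 "-1"] by simp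

lemma dirichlet_lin_le:
  assumes "H1 \<Omega> u" "H1 \<Omega> v"
  shows "dirichlet \<Omega> (\<lambda>x. a * u x + b * v x) (\<lambda>x. a * u x + b * v x)
    \<le> 2 * a\<^sup>2 * dirichlet \<Omega> u u + 2 * b\<^sup>2 * dirichlet \<Omega> v v"
  using dirichlet_nonneg[of \<Omega> "\<lambda>x. a * u x + (-b) * v x"]
    dirichlet_lin_expand[OF assms, of a "-b"] dirichlet_lin_expand[OF assms, of a b] by (simp add: algebra_simps)

lemma H1norm_lin_le:
  assumes "H1 \<Omega> u" "H1 \<Omega> v"
  shows "(H1norm \<Omega> (\<lambda>x. a * u x + b * v x))\<^sup>2 \<le> 2 * a\<^sup>2 * (H1norm \<Omega> u)\<^sup>2 + 2 * b\<^sup>2 * (H1norm \<Omega> v)\<^sup>2"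
  using dirichlet_lin_le[OF assms, of a b] ip_lin_le[OF assms[THEN H1_L2], of a b]
  by (simp add: H1norm_power2 algebra_simps)

text \<open>Combine the approximating sequences. Convergence is shown for squared norms, where the
  parallelogram bound \<open>H1norm_lin_le\<close> applies, and the root is taken at the
  end.\<close>

lemma H10_lin:
  assumes "H10 \<Omega> u" "H10 \<Omega> v"
  shows "H10 \<Omega> (\<lambda>x. a * u x + b * v x)"
proof -
  obtain \<phi> \<psi> :: "nat \<Rightarrow> real^'n \<Rightarrow> real" where t: "\<And>k. test_fun \<Omega> (\<phi> k)" "\<And>k. test_fun \<Omega> (\<psi> k)"
    and lim: "(\<lambda>k. H1norm \<Omega> (\<lambda>x. u x - \<phi> k x)) \<longlonglongrightarrow> 0" "(\<lambda>k. H1norm \<Omega> (\<lambda>x. v x - \<psi> k x)) \<longlonglongrightarrow> 0"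
    using assms unfolding H10_def by blast
  have H1s: "H1 \<Omega> (\<lambda>x. u x - \<phi> k x)" "H1 \<Omega> (\<lambda>x. v x - \<psi> k x)" for k
    using H1_lin[OF H10_H1[OF assms(1)] H1_test[OF t(1)], of 1 "-1"]
      H1_lin[OF H10_H1[OF assms(2)] H1_test[OF t(2)], of 1 "-1"] by simp_all
  let ?d = "\<lambda>k x. (a * u x + b * v x) - (a * \<phi> k x + b * \<psi> k x)"
  have "(\<lambda>k. (H1norm \<Omega> (?d k))\<^sup>2) \<longlonglongrightarrow> 0"
  proof (rule tendsto_sandwich[OF always_eventually always_eventually tendsto_const])
    show "(\<lambda>k. 2 * a\<^sup>2 * (H1norm \<Omega> (\<lambda>x. u x - \<phi> k x))\<^sup>2 + 2 * b\<^sup>2 * (H1norm \<Omega> (\<lambda>x. v x - \<psi> k x))\<^sup>2) \<longlonglongrightarrow> 0"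
      using tendsto_add[OF tendsto_mult_left[OF tendsto_power[OF lim(1), of 2], of "2 * a\<^sup>2"]
        tendsto_mult_left[OF tendsto_power[OF lim(2), of 2], of "2 * b\<^sup>2"]] by simp
    show "\<forall>k. (H1norm \<Omega> (?d k))\<^sup>2 \<le> 2 * a\<^sup>2 * (H1norm \<Omega> (\<lambda>x. u x - \<phi> k x))\<^sup>2
        + 2 * b\<^sup>2 * (H1norm \<Omega> (\<lambda>x. v x - \<psi> k x))\<^sup>2"
    proof
      fix k
      have "?d k = (\<lambda>x. a * (u x - \<phi> k x) + b * (v x - \<psi> k x))"
        by (simp add: algebra_simps)
      then show "(H1norm \<Omega> (?d k))\<^sup>2 \<le> 2 * a\<^sup>2 * (H1norm \<Omega> (\<lambda>x. u x - \<phi> k x))\<^sup>2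
        + 2 * b\<^sup>2 * (H1norm \<Omega> (\<lambda>x. v x - \<psi> k x))\<^sup>2"
        using H1norm_lin_le[OF H1s, of a k b k] by simp
    qed
  qed simp
  from tendsto_real_sqrt[OF this] have "(\<lambda>k. H1norm \<Omega> (?d k)) \<longlonglongrightarrow> 0"
    by (simp add: H1norm_def ip_nonneg[unfolded ip_def] set_integral_nonneg_real)
  moreover have "H1 \<Omega> (\<lambda>x. a * u x + b * v x)"
    by (rule H1_lin[OF assms[THEN H10_H1]])
  ultimately show ?thesis
    unfolding H10_def using test_fun_lin[OF t]
    by (intro conjI exI[of _ "\<lambda>k x. a * \<phi> k x + b * \<psi> k x"]) auto
qed

lemma H10_zero: "H10 \<Omega> (\<lambda>x. 0)"
proof -
  have t: "test_fun \<Omega> (\<lambda>x. 0)" by (simp add: test_fun_def smooth_fun_const)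
  have "dirichlet \<Omega> (\<lambda>x. 0) (\<lambda>x. 0) = 0"
    using dirichlet_lin[OF H1_zero H1_zero H1_zero, of 0 0] by simp
  then have "(H1norm \<Omega> (\<lambda>x. 0 - 0))\<^sup>2 = 0"
    by (simp add: H1norm_power2 ip_def set_lebesgue_integral_def)
  then show ?thesis
    unfolding H10_def using t by (intro conjI H1_zero exI[of _ "\<lambda>k x. 0"]) auto
qed

section \<open>Poincare's inequality\<close>

text \<open>Write 1 as the derivative of \<open>x $ i\<close> and integrate it against the square of
  \<open>\<phi>\<close> by parts: the result is -2 times the integral of
  \<open>x $ i * \<phi> x * pderiv_i i \<phi> x\<close>. Expanding the square of
  \<open>\<phi> x + 2 * x $ i * pderiv_i i \<phi> x\<close> bounds this by half the left side, which
  is absorbed, plus 2 R^2 times the squared derivative; hence 4 R^2.\<close>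

lemma poincare_test:
  assumes R: "\<And>x. x \<in> \<Omega> \<Longrightarrow> norm x \<le> R" and \<phi>: "test_fun \<Omega> \<phi>"
  shows "ip \<Omega> \<phi> \<phi> \<le> 4 * R\<^sup>2 * dirichlet \<Omega> \<phi> \<phi>"
proof -
  \<comment> \<open>A single coordinate direction suffices, and any will do.\<close>
  fix i :: 'n
  let ?d = "pderiv_i i \<phi>"
  have sm: "smooth_fun \<phi>" using \<phi> by (rule test_fun_smooth)
  note i1 = L2_times[OF L2_test_fun[OF \<phi>] L2_test_fun[OF \<phi>]]
  note i2 = L2_times[OF L2_test_pderiv[OF \<phi>, of i] L2_test_pderiv[OF \<phi>, of i]]
  have xphi: "test_fun \<Omega> (\<lambda>x. x $ i * \<phi> x)" by (rule test_fun_mult[OF \<phi> smooth_fun_nth])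
  note i3 = L2_times[OF L2_test_fun[OF xphi] L2_test_pderiv[OF \<phi>, of i]]
  have "ip \<Omega> \<phi> \<phi> = (LINT x:\<Omega>|lebesgue. pderiv_i i (\<lambda>x. x $ i) x * (\<phi> x * \<phi> x))"
    by (simp add: ip_def pderiv_i_nth)
  also have "\<dots> = - (LINT x:\<Omega>|lebesgue. x $ i * pderiv_i i (\<lambda>x. \<phi> x * \<phi> x) x)"
    using test_integration_by_parts[OF test_fun_mult[OF \<phi> sm] smooth_fun_nth, of i i] by simp
  also have "\<dots> = (LINT x:\<Omega>|lebesgue. (-2) * ((x $ i * \<phi> x) * ?d x))"
  proof -
    have "x $ i * pderiv_i i (\<lambda>x. \<phi> x * \<phi> x) x = 2 * ((x $ i * \<phi> x) * ?d x)" for x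
      by (simp add: pderiv_i_mult[OF sm sm])
    then show ?thesis by (simp only: set_integral_mult_right)
  qed
  also have "\<dots> \<le> (LINT x:\<Omega>|lebesgue. (1/2) * (\<phi> x * \<phi> x) + (2 * R\<^sup>2) * (?d x * ?d x))"
  proof (rule set_integral_mono)
    fix x assume "x \<in> \<Omega>"
    then have "\<bar>x $ i\<bar> \<le> R" using R component_le_norm_cart order_trans by blast
    then have "(x $ i)\<^sup>2 \<le> R\<^sup>2" by (simp add: abs_le_square_iff[symmetric])
    then have "(x $ i)\<^sup>2 * (?d x)\<^sup>2 \<le> R\<^sup>2 * (?d x)\<^sup>2" by (rule mult_right_mono) simp
    moreover have "0 \<le> (\<phi> x + 2 * x $ i * ?d x)\<^sup>2" by simp
    ultimately show "(-2) * ((x $ i * \<phi> x) * ?d x) \<le> (1/2) * (\<phi> x * \<phi> x) + (2 * R\<^sup>2) * (?d x * ?d x)"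
      by (simp add: power2_eq_square algebra_simps)
  qed (intro set_integral_add(1) set_integrable_mult_right i1 i2 i3)+
  also have "\<dots> = (1/2) * ip \<Omega> \<phi> \<phi> + 2 * R\<^sup>2 * (LINT x:\<Omega>|lebesgue. ?d x * ?d x)"
    unfolding ip_def using i1 i2 by (subst set_integral_add(2)) auto
  finally have "ip \<Omega> \<phi> \<phi> \<le> 4 * R\<^sup>2 * (LINT x:\<Omega>|lebesgue. ?d x * ?d x)" by simp
  moreover have "(LINT x:\<Omega>|lebesgue. ?d x * ?d x) \<le> dirichlet \<Omega> \<phi> \<phi>"
    unfolding dirichlet_eq[OF weak_grad_test[OF \<phi>] weak_grad_test[OF \<phi>]]
  proof (rule set_integral_mono[OF i2 set_integrable_weak_grad_inner[OF weak_grad_test[OF \<phi>] weak_grad_test[OF \<phi>]]])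
    fix x
    show "?d x * ?d x \<le> (\<chi> i. pderiv_i i \<phi> x) \<bullet> (\<chi> i. pderiv_i i \<phi> x)"
      unfolding inner_vec_def using member_le_sum[of i UNIV "\<lambda>i. pderiv_i i \<phi> x * pderiv_i i \<phi> x"] by simp
  qed
  ultimately show ?thesis
    by (meson mult_left_mono order_trans zero_le_power2 mult_nonneg_nonneg zero_le_numeral)
qed

lemma poincare: "\<exists>C>0. \<forall>v. H10 \<Omega> v \<longrightarrow> ip \<Omega> v v \<le> C * dirichlet \<Omega> v v"
proof -
  obtain R where R: "0 < R" "\<And>x. x \<in> \<Omega> \<Longrightarrow> norm x \<le> R"
    using bdd bounded_pos[of \<Omega>] by blast
  have "ip \<Omega> v v \<le> 16 * R\<^sup>2 * dirichlet \<Omega> v v" if v: "H10 \<Omega> v" for v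
  proof -
    obtain \<phi> :: "nat \<Rightarrow> real^'n \<Rightarrow> real" where t: "\<And>k. test_fun \<Omega> (\<phi> k)"
      and lim: "(\<lambda>k. H1norm \<Omega> (\<lambda>x. v x - \<phi> k x)) \<longlonglongrightarrow> 0"
      using v unfolding H10_def by blast
    \<comment> \<open>Passing to \<open>\<phi> k\<close> and back costs a factor 2 each time, so 4
      R^2 becomes 16 R^2. The error factor \<open>16 * R\<^sup>2 + 2\<close> covers the gradient
      part and the L2 part of the remainder.\<close>
    have est: "ip \<Omega> v v \<le> 16 * R\<^sup>2 * dirichlet \<Omega> v v + (16 * R\<^sup>2 + 2) * (H1norm \<Omega> (\<lambda>x. v x - \<phi> k x))\<^sup>2" for k
    proof -
      let ?d = "\<lambda>x. v x - \<phi> k x"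
      have d: "H1 \<Omega> ?d" using H1_lin[OF H10_H1[OF v] H1_test[OF t], of 1 "-1"] by simp
      have "ip \<Omega> v v \<le> 2 * ip \<Omega> (\<phi> k) (\<phi> k) + 2 * ip \<Omega> ?d ?d"
        using ip_lin_le[OF L2_test_fun[OF t[of k]] H1_L2[OF d], of 1 1] by simp
      moreover have "ip \<Omega> (\<phi> k) (\<phi> k) \<le> 4 * R\<^sup>2 * dirichlet \<Omega> (\<phi> k) (\<phi> k)"
        by (rule poincare_test[OF R(2) t])
      moreover have "dirichlet \<Omega> (\<phi> k) (\<phi> k) \<le> 2 * dirichlet \<Omega> v v + 2 * dirichlet \<Omega> ?d ?d"
        using dirichlet_lin_le[OF H10_H1[OF v] d, of 1 "-1"] by simp
      then have "4 * R\<^sup>2 * dirichlet \<Omega> (\<phi> k) (\<phi> k) \<le> 4 * R\<^sup>2 * (2 * dirichlet \<Omega> v v + 2 * dirichlet \<Omega> ?d ?d)"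
        by (rule mult_left_mono) simp
      ultimately have "ip \<Omega> v v \<le> 2 * (4 * R\<^sup>2 * (2 * dirichlet \<Omega> v v + 2 * dirichlet \<Omega> ?d ?d)) + 2 * ip \<Omega> ?d ?d"
        by linarith
      moreover have "0 \<le> 16 * R\<^sup>2 * ip \<Omega> ?d ?d" by (simp add: ip_nonneg)
      moreover have "0 \<le> dirichlet \<Omega> ?d ?d" by (rule dirichlet_nonneg)
      ultimately show ?thesis by (simp add: H1norm_power2 algebra_simps)
    qed
    have "(\<lambda>k. 16 * R\<^sup>2 * dirichlet \<Omega> v v + (16 * R\<^sup>2 + 2) * (H1norm \<Omega> (\<lambda>x. v x - \<phi> k x))\<^sup>2)
        \<longlonglongrightarrow> 16 * R\<^sup>2 * dirichlet \<Omega> v v + (16 * R\<^sup>2 + 2) * 0\<^sup>2"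
      by (intro tendsto_intros lim)
    then show ?thesis using est by (intro LIMSEQ_le_const[of _ _ "ip \<Omega> v v"]) auto
  qed
  then show ?thesis using R(1) by (intro exI[of _ "16 * R\<^sup>2"]) auto
qed

end

section \<open>The finite element spaces\<close>

text \<open>Solvability by induction on the index set: the new unknown is split off by an oblique
  projection, which needs no symmetry of \<open>A\<close>.\<close>
lemma positive_definite_solvable:
  fixes A :: "'i \<Rightarrow> 'i \<Rightarrow> real"
  assumes "finite I"
    and "\<And>c. \<exists>p\<in>I. c p \<noteq> 0 \<Longrightarrow> 0 < (\<Sum>p\<in>I. \<Sum>q\<in>I. c p * c q * A p q)"
  shows "\<exists>c. \<forall>q\<in>I. (\<Sum>p\<in>I. c p * A p q) = L q"
  using assms
proof (induction I arbitrary: L)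
  case (insert r J)
  have pos: "0 < (\<Sum>p\<in>J. \<Sum>q\<in>J. c p * c q * A p q)" if "\<exists>p\<in>J. c p \<noteq> 0" for c
  proof -
    \<comment> \<open>Extension by zero restricts positivity from \<open>insert r J\<close> to
      \<open>J\<close>.\<close>
    let ?c = "c(r := 0)"
    have "0 < (\<Sum>p\<in>insert r J. \<Sum>q\<in>insert r J. ?c p * ?c q * A p q)"
      by (rule insert.prems) (use that insert.hyps in auto)
    also have "\<dots> = (\<Sum>p\<in>J. \<Sum>q\<in>J. ?c p * ?c q * A p q)"
      using insert.hyps by simp
    also have "\<dots> = (\<Sum>p\<in>J. \<Sum>q\<in>J. c p * c q * A p q)"
      using insert.hyps by (intro sum.cong refl) auto
    finally show ?thesis .
  qed
  obtain s where s: "\<And>q. q \<in> J \<Longrightarrow> (\<Sum>p\<in>J. s p * A p q) = A r q"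
    using insert.IH[OF pos, of "A r"] by blast
  obtain y where y: "\<And>q. q \<in> J \<Longrightarrow> (\<Sum>p\<in>J. y p * A p q) = L q"
    using insert.IH[OF pos, of L] by blast
  \<comment> \<open>\<open>e\<close> is the unit vector at \<open>r\<close> minus its oblique
    projection onto \<open>J\<close>. Its image under \<open>A\<close> vanishes on \<open>J\<close>,
    so the form at \<open>e\<close> reduces to the Schur complement \<open>d\<close>, which is
    therefore positive.\<close>
  define d where "d = A r r - (\<Sum>p\<in>J. s p * A p r)"
  define e where "e = (\<lambda>p. - s p)(r := 1)"
  have sumJ: "(\<Sum>p\<in>J. (f(r := z)) p * A p q) = (\<Sum>p\<in>J. f p * A p q)" for f z q
    using insert.hyps by (intro sum.cong refl) auto
  have "(\<Sum>p\<in>J. e p * A p q) = - (\<Sum>p\<in>J. s p * A p q)" for q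
    unfolding e_def sumJ by (simp add: sum_negf)
  then have e: "(\<Sum>p\<in>insert r J. e p * A p q) = A r q - (\<Sum>p\<in>J. s p * A p q)" for q
    using insert.hyps by (simp add: e_def)
  have "0 < (\<Sum>p\<in>insert r J. \<Sum>q\<in>insert r J. e p * e q * A p q)"
    by (rule insert.prems) (auto simp: e_def)
  also have "\<dots> = (\<Sum>q\<in>insert r J. e q * (\<Sum>p\<in>insert r J. e p * A p q))"
    by (subst sum.swap) (simp add: sum_distrib_left mult_ac)
  also have "\<dots> = e r * (\<Sum>p\<in>insert r J. e p * A p r) + (\<Sum>q\<in>J. e q * (\<Sum>p\<in>insert r J. e p * A p q))"
    using insert.hyps by (subst sum.insert) simp_all
  also have "(\<Sum>q\<in>J. e q * (\<Sum>p\<in>insert r J. e p * A p q)) = 0"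
    unfolding e using s by simp
  also have "(\<Sum>p\<in>insert r J. e p * A p r) = d"
    unfolding e d_def ..
  finally have "0 < d" by (simp add: e_def)
  \<comment> \<open>The correction by \<open>- a * s\<close> offsets the effect of the new unknown
    on the equations in \<open>J\<close>. The equation at \<open>r\<close> then says that
    \<open>a * d\<close> is the residual of \<open>y\<close> there.\<close>
  define a where "a = (L r - (\<Sum>p\<in>J. y p * A p r)) / d"
  define c where "c = (\<lambda>p. y p - a * s p)(r := a)"
  have "(\<Sum>p\<in>J. c p * A p q) = (\<Sum>p\<in>J. y p * A p q) - a * (\<Sum>p\<in>J. s p * A p q)" for q
    unfolding c_def sumJ by (simp add: left_diff_distrib sum_subtractf sum_distrib_left mult.assoc)
  then have c: "(\<Sum>p\<in>insert r J. c p * A p q) = a * A r q + (\<Sum>p\<in>J. y p * A p q) - a * (\<Sum>p\<in>J. s p * A p q)" for q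
    using insert.hyps by (simp add: c_def)
  have "(\<Sum>p\<in>insert r J. c p * A p q) = L q" if "q \<in> insert r J" for q
  proof (cases "q = r")
    case True
    have "a * d = L r - (\<Sum>p\<in>J. y p * A p r)" using \<open>0 < d\<close> by (simp add: a_def)
    then show ?thesis unfolding c True by (simp add: d_def algebra_simps)
  next
    case False
    then have "q \<in> J" using that by simp
    then show ?thesis unfolding c using s y by simp
  qed
  then show ?case by blast
qed simp

text \<open>Finite element functions are only determined on the domain, so span and independence are
  relative to \<open>S\<close> and a basis is a finite sequence of representatives. The induction
  runs over the spanning family \<open>g\<close>, whose members need not lie in
  \<open>V\<close>.\<close>

lemma subspace_of_finite_span_has_basis:
  fixes g :: "'i \<Rightarrow> 'a \<Rightarrow> real" and V :: "('a \<Rightarrow> real) \<Rightarrow> bool"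
  assumes "finite I" and zero: "V (\<lambda>x. 0)"
    and lin: "\<And>a b u v. V u \<Longrightarrow> V v \<Longrightarrow> V (\<lambda>x. a * u x + b * v x)"
    and span: "\<And>v. V v \<Longrightarrow> \<exists>c. \<forall>x\<in>S. v x = (\<Sum>i\<in>I. c i * g i x)"
  shows "\<exists>(N::nat) b. (\<forall>k<N. V (b k)) \<and> (\<forall>v. V v \<longrightarrow> (\<exists>c. \<forall>x\<in>S. v x = (\<Sum>k<N. c k * b k x)))
    \<and> (\<forall>c. (\<forall>x\<in>S. (\<Sum>k<N. c k * b k x) = 0) \<longrightarrow> (\<forall>k<N. c k = 0))"
  using assms
proof (induction I arbitrary: V)
  case empty
  then show ?case by (intro exI[of _ "0::nat"]) auto
next
  case (insert j J)
  \<comment> \<open>The members of \<open>V\<close> that can be written without \<open>g j\<close>: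
    a subspace of codimension at most one.\<close>
  define W where "W v \<longleftrightarrow> V v \<and> (\<exists>c. \<forall>x\<in>S. v x = (\<Sum>i\<in>J. c i * g i x))" for v
  have Wlin: "W (\<lambda>x. a * u x + b * v x)" if u: "W u" and v: "W v" for a b u v
  proof -
    obtain c d where "\<forall>x\<in>S. u x = (\<Sum>i\<in>J. c i * g i x)" "\<forall>x\<in>S. v x = (\<Sum>i\<in>J. d i * g i x)"
      using u v unfolding W_def by blast
    then have "\<forall>x\<in>S. a * u x + b * v x = (\<Sum>i\<in>J. (a * c i + b * d i) * g i x)"
      by (simp add: algebra_simps sum.distrib sum_distrib_left)
    moreover have "V (\<lambda>x. a * u x + b * v x)"
      using insert.prems(2) u v by (simp add: W_def)
    ultimately show ?thesis unfolding W_def by (intro conjI exI)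
  qed
  have "\<exists>(N::nat) b. (\<forall>k<N. W (b k)) \<and> (\<forall>v. W v \<longrightarrow> (\<exists>c. \<forall>x\<in>S. v x = (\<Sum>k<N. c k * b k x)))
    \<and> (\<forall>c. (\<forall>x\<in>S. (\<Sum>k<N. c k * b k x) = 0) \<longrightarrow> (\<forall>k<N. c k = 0))"
  proof (rule insert.IH)
    show "W (\<lambda>x. 0)" unfolding W_def using insert.prems(1) by (auto intro!: exI[of _ "\<lambda>_. 0"])
  qed (use Wlin in \<open>auto simp: W_def\<close>)
  then obtain N :: nat and b where b: "\<And>k. k < N \<Longrightarrow> W (b k)"
    and sp: "\<And>v. W v \<Longrightarrow> \<exists>c. \<forall>x\<in>S. v x = (\<Sum>k<N. c k * b k x)"
    and ind: "\<And>c. \<forall>x\<in>S. (\<Sum>k<N. c k * b k x) = 0 \<Longrightarrow> \<forall>k<N. c k = 0"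
    by blast
  show ?case
  proof (cases "\<forall>v. V v \<longrightarrow> W v")
    case True
    then show ?thesis
      using b sp ind by (intro exI[of _ N] exI[of _ b]) (auto simp: W_def)
  next
    case False
    then obtain v0 where v0: "V v0" "\<not> W v0" by blast
    obtain c0 where c0: "\<And>x. x \<in> S \<Longrightarrow> v0 x = c0 j * g j x + (\<Sum>i\<in>J. c0 i * g i x)"
      using insert.prems(3)[OF v0(1)] insert.hyps by auto
    have c0j: "c0 j \<noteq> 0"
    proof
      assume "c0 j = 0"
      then have "\<forall>x\<in>S. v0 x = (\<Sum>i\<in>J. c0 i * g i x)" using c0 by simp
      then have "W v0" unfolding W_def using v0(1) by (intro conjI exI)
      with v0(2) show False ..
    qed
    have sumW: "W (\<lambda>x. \<Sum>k<n. c k * b k x)" if "n \<le> N" for n c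
      using that
    proof (induction n)
      case 0
      then show ?case unfolding W_def using insert.prems(1) by (auto intro!: exI[of _ "\<lambda>_. 0"])
    next
      case (Suc n)
      then show ?case using Wlin[of "\<lambda>x. \<Sum>k<n. c k * b k x" "b n" 1 "c n"] b[of n] by simp
    qed
    let ?b = "b(N := v0)"
    have sum_b: "(\<Sum>k<Suc N. c k * ?b k x) = (\<Sum>k<N. c k * b k x) + c N * v0 x" for c x
      by simp
    show ?thesis
    proof (intro exI[of _ "Suc N"] exI[of _ ?b] conjI allI impI)
      fix k assume "k < Suc N" then show "V (?b k)" using b v0 by (auto simp: W_def less_Suc_eq)
    next
      fix v assume v: "V v"
      obtain c where c: "\<And>x. x \<in> S \<Longrightarrow> v x = c j * g j x + (\<Sum>i\<in>J. c i * g i x)"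
        using insert.prems(3)[OF v] insert.hyps by auto
      \<comment> \<open>Subtracting this multiple of \<open>v0\<close> cancels the coefficient of
        \<open>g j\<close> and lands in \<open>W\<close>.\<close>
      let ?a = "c j / c0 j"
      have W1: "\<forall>x\<in>S. 1 * v x + (- ?a) * v0 x = (\<Sum>i\<in>J. (c i - ?a * c0 i) * g i x)"
        using c c0 c0j by (simp add: left_diff_distrib sum_subtractf sum_distrib_left algebra_simps sum_negf)
      have "W (\<lambda>x. 1 * v x + (- ?a) * v0 x)"
        unfolding W_def by (rule conjI, rule insert.prems(2)[OF v v0(1)], rule exI, rule W1)
      from sp[OF this] obtain d where d: "\<And>x. x \<in> S \<Longrightarrow> v x - ?a * v0 x = (\<Sum>k<N. d k * b k x)"
        by auto
      have "\<forall>x\<in>S. v x = (\<Sum>k<Suc N. (d(N := ?a)) k * ?b k x)"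
        unfolding sum_b using d by (auto simp: algebra_simps)
      then show "\<exists>c. \<forall>x\<in>S. v x = (\<Sum>k<Suc N. c k * ?b k x)" by blast
    next
      fix c k assume z: "\<forall>x\<in>S. (\<Sum>k<Suc N. c k * ?b k x) = 0" and k: "k < Suc N"
      have cN: "c N = 0"
      proof (rule ccontr)
        assume cN: "c N \<noteq> 0"
        \<comment> \<open>A dependence with nonzero \<open>c N\<close> would express
          \<open>v0\<close> on \<open>S\<close> through the basis of \<open>W\<close>, against its
          choice. The zero summand only fits the shape of \<open>Wlin\<close>.\<close>
        have "W (\<lambda>x. (- 1 / c N) * (\<Sum>k<N. c k * b k x) + 0 * (\<Sum>k<N. c k * b k x))"
          by (rule Wlin[OF sumW sumW]) auto
        then obtain d where d: "\<And>x. x \<in> S \<Longrightarrow> (- 1 / c N) * (\<Sum>k<N. c k * b k x) = (\<Sum>i\<in>J. d i * g i x)"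
          unfolding W_def by auto
        have "v0 x = (- 1 / c N) * (\<Sum>k<N. c k * b k x)" if "x \<in> S" for x
        proof -
          have "(\<Sum>k<N. c k * b k x) + c N * v0 x = 0" using z that unfolding sum_b by blast
          then show ?thesis using cN by (simp add: field_simps add_eq_0_iff2)
        qed
        then have "\<forall>x\<in>S. v0 x = (\<Sum>i\<in>J. d i * g i x)" using d by metis
        then have "W v0" unfolding W_def using v0(1) by (intro conjI exI)
        with v0(2) show False ..
      qed
      then have "\<forall>x\<in>S. (\<Sum>k<N. c k * b k x) = 0" using z unfolding sum_b by simp
      from ind[OF this] cN k show "c k = 0" by (auto simp: less_Suc_eq)
    qed
  qed
qed

section \<open>Piecewise polynomials: continuity, definiteness, bases\<close>

lemma poly_on_lin:
  assumes "poly_on m K u" "poly_on m K v"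
  shows "poly_on m K (\<lambda>x. a * u x + b * v x)"
proof -
  obtain c d where "\<forall>x\<in>K. u x = (\<Sum>\<alpha>\<in>{\<alpha>. sum \<alpha> UNIV \<le> m}. c \<alpha> * (\<Prod>i\<in>UNIV. (x $ i) ^ \<alpha> i))"
    "\<forall>x\<in>K. v x = (\<Sum>\<alpha>\<in>{\<alpha>. sum \<alpha> UNIV \<le> m}. d \<alpha> * (\<Prod>i\<in>UNIV. (x $ i) ^ \<alpha> i))"
    using assms unfolding poly_on_def by blast
  then show ?thesis unfolding poly_on_def
    by (intro exI[of _ "\<lambda>\<alpha>. a * c \<alpha> + b * d \<alpha>"])
      (simp add: algebra_simps sum.distrib sum_distrib_left)
qed

lemma poly_on_zero: "poly_on m K (\<lambda>x. 0)"
  unfolding poly_on_def by (intro exI[of _ "\<lambda>_. 0"]) simp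

lemma poly_on_continuous: "poly_on m K v \<Longrightarrow> continuous_on K v"
proof -
  assume "poly_on m K v"
  then obtain c where c: "\<And>x. x \<in> K \<Longrightarrow> v x = (\<Sum>\<alpha>\<in>{\<alpha>. sum \<alpha> UNIV \<le> m}. c \<alpha> * (\<Prod>i\<in>UNIV. (x $ i) ^ \<alpha> i))"
    unfolding poly_on_def by blast
  have "continuous_on K (\<lambda>x. \<Sum>\<alpha>\<in>{\<alpha>. sum \<alpha> UNIV \<le> m}. c \<alpha> * (\<Prod>i\<in>UNIV. (x $ i) ^ \<alpha> i))"
    by (intro continuous_intros)
  then show ?thesis using c by (subst continuous_on_cong[OF refl c]) auto
qed

lemma finite_multiindices: "finite {\<alpha> :: 'n::finite \<Rightarrow> nat. sum \<alpha> UNIV \<le> m}"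
proof (rule finite_subset)
  show "{\<alpha> :: 'n \<Rightarrow> nat. sum \<alpha> UNIV \<le> m} \<subseteq> PiE UNIV (\<lambda>_. {..m})"
  proof
    fix \<alpha> :: "'n \<Rightarrow> nat" assume "\<alpha> \<in> {\<alpha>. sum \<alpha> UNIV \<le> m}"
    moreover have "\<alpha> i \<le> sum \<alpha> UNIV" for i by (rule member_le_sum) auto
    ultimately have "\<alpha> i \<le> m" for i using order_trans by blast
    then show "\<alpha> \<in> PiE UNIV (\<lambda>_. {..m})" by auto
  qed
qed (simp add: finite_PiE)

lemma triangulation_closed: "triangulation \<Omega> Th \<Longrightarrow> K \<in> Th \<Longrightarrow> closed K"
  unfolding triangulation_def by (meson closed_simplex)

text \<open>The polynomial representation holds at every point of the closed simplices, so the
  pieces agree on common faces, and finitely many closed pieces paste together.\<close>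

lemma Vh_continuous:
  assumes "triangulation \<Omega> Th" "Vh \<Omega> Th m v"
  shows "continuous_on (closure \<Omega>) v"
proof -
  have "continuous_on (\<Union>K\<in>Th. K) v"
    by (rule continuous_on_closed_Union)
      (use assms triangulation_closed in \<open>auto simp: triangulation_def Vh_def intro: poly_on_continuous\<close>)
  then show ?thesis using assms(1) by (simp add: triangulation_def)
qed

lemma L2_cong: "(\<And>x. x \<in> \<Omega> \<Longrightarrow> u x = v x) \<Longrightarrow> L2 \<Omega> u \<longleftrightarrow> L2 \<Omega> v"
proof -
  assume eq: "\<And>x. x \<in> \<Omega> \<Longrightarrow> u x = v x"
  have "(\<lambda>x. indicator \<Omega> x *\<^sub>R u x) = (\<lambda>x. indicator \<Omega> x *\<^sub>R v x)"
    "(\<lambda>x. indicator \<Omega> x *\<^sub>R (u x)\<^sup>2) = (\<lambda>x. indicator \<Omega> x *\<^sub>R (v x)\<^sup>2)"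
    using eq by (auto simp: indicator_def fun_eq_iff)
  then show ?thesis unfolding L2_def set_borel_measurable_def set_integrable_def by simp
qed

lemma set_integral_cong_on:
  fixes f g :: "'a \<Rightarrow> real"
  shows "(\<And>x. x \<in> A \<Longrightarrow> f x = g x) \<Longrightarrow> (LINT x:A|M. f x) = (LINT x:A|M. g x)"
  unfolding set_lebesgue_integral_def
  by (rule Bochner_Integration.integral_cong) (auto simp: indicator_def)

text \<open>Equality of the two predicates makes the \<open>SOME\<close> in \<open>wgrad\<close>
  choose the same field, so \<open>wgrad_cong\<close> is a literal equality.\<close>

lemma weak_grad_cong:
  assumes "\<And>x. x \<in> \<Omega> \<Longrightarrow> u x = v x"
  shows "weak_grad \<Omega> u = weak_grad \<Omega> v"
proof
  fix g
  have "(LINT x:\<Omega>|lebesgue. u x * pderiv_i i \<phi> x) = (LINT x:\<Omega>|lebesgue. v x * pderiv_i i \<phi> x)" for i \<phi>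
    by (rule set_integral_cong_on) (simp add: assms)
  then show "weak_grad \<Omega> u g = weak_grad \<Omega> v g" by (simp add: weak_grad_def)
qed

lemma wgrad_cong: "(\<And>x. x \<in> \<Omega> \<Longrightarrow> u x = v x) \<Longrightarrow> wgrad \<Omega> u = wgrad \<Omega> v"
  unfolding wgrad_def by (simp add: weak_grad_cong[of \<Omega> u v])

lemma dirichlet_cong:
  "(\<And>x. x \<in> \<Omega> \<Longrightarrow> u x = u' x) \<Longrightarrow> (\<And>x. x \<in> \<Omega> \<Longrightarrow> v x = v' x) \<Longrightarrow> dirichlet \<Omega> u v = dirichlet \<Omega> u' v'"
  unfolding dirichlet_def by (simp add: wgrad_cong[of \<Omega> u u'] wgrad_cong[of \<Omega> v v'])

lemma ip_cong:
  "(\<And>x. x \<in> \<Omega> \<Longrightarrow> u x = u' x) \<Longrightarrow> (\<And>x. x \<in> \<Omega> \<Longrightarrow> v x = v' x) \<Longrightarrow> ip \<Omega> u v = ip \<Omega> u' v'"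
  unfolding ip_def by (rule set_integral_cong_on) simp

text \<open>The set where \<open>v\<close> is nonzero is open by continuity and null because the
  square integrates to 0; a nonempty open set is not null.\<close>

lemma continuous_eq_0_if_ip_eq_0:
  assumes "open \<Omega>" "L2 \<Omega> v" "continuous_on \<Omega> v" "ip \<Omega> v v = 0" "x \<in> \<Omega>"
  shows "v x = 0"
proof -
  have "integrable lebesgue (\<lambda>x. indicator \<Omega> x *\<^sub>R (v x * v x))"
    using L2_times[OF assms(2,2)] by (simp add: set_integrable_def)
  then have "AE x in lebesgue. indicator \<Omega> x *\<^sub>R (v x * v x) = 0"
    using assms(4) by (subst integral_nonneg_eq_0_iff_AE[symmetric]) (auto simp: ip_def set_lebesgue_integral_def)
  then have "AE x in lebesgue. x \<notin> {x \<in> \<Omega>. v x \<noteq> 0}"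
    by eventually_elim (auto simp: indicator_def)
  moreover have op: "open {x \<in> \<Omega>. v x \<noteq> 0}"
    using continuous_open_preimage[OF assms(3,1), of "- {0}"] by (simp add: vimage_def Int_def open_Compl)
  ultimately have "{x \<in> \<Omega>. v x \<noteq> 0} \<in> null_sets lebesgue"
    by (simp add: AE_iff_null_sets[symmetric] del: mem_Collect_eq)
  then have "negligible {x \<in> \<Omega>. v x \<noteq> 0}" by (simp add: negligible_iff_null_sets)
  then have "{x \<in> \<Omega>. v x \<noteq> 0} = {}" using op open_not_negligible by blast
  then show ?thesis using assms(5) by blast
qed

context
  fixes \<Omega> :: "(real^'n) set" and Th :: "(real^'n) set set" and m :: nat
  assumes opn: "open \<Omega>" and bdd: "bounded \<Omega>" and tri: "triangulation \<Omega> Th"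
begin

lemma Vh_lin: "Vh \<Omega> Th m u \<Longrightarrow> Vh \<Omega> Th m v \<Longrightarrow> Vh \<Omega> Th m (\<lambda>x. a * u x + b * v x)"
  unfolding Vh_def using H1_lin poly_on_lin by blast

lemma Vh0_lin: "Vh0 \<Omega> Th m u \<Longrightarrow> Vh0 \<Omega> Th m v \<Longrightarrow> Vh0 \<Omega> Th m (\<lambda>x. a * u x + b * v x)"
  unfolding Vh0_def using Vh_lin H10_lin[OF opn bdd] by blast

lemma Vh0_zero: "Vh0 \<Omega> Th m (\<lambda>x. 0)"
  unfolding Vh0_def Vh_def using H1_zero[OF opn bdd] H10_zero[OF opn bdd] poly_on_zero by blast

lemma Vh0_sum:
  assumes "finite I" "\<And>i. i \<in> I \<Longrightarrow> Vh0 \<Omega> Th m (w i)"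
  shows "Vh0 \<Omega> Th m (\<lambda>x. \<Sum>i\<in>I. c i * w i x)"
  using assms
proof (induction I)
  case (insert j J)
  then show ?case using Vh0_lin[of "w j" "\<lambda>x. \<Sum>i\<in>J. c i * w i x" "c j" 1] by simp
qed (simp add: Vh0_zero)

lemma Vh_L2: "Vh \<Omega> Th m v \<Longrightarrow> L2 \<Omega> v"
  and Vh0_Vh: "Vh0 \<Omega> Th m v \<Longrightarrow> Vh \<Omega> Th m v" and Vh0_H10: "Vh0 \<Omega> Th m v \<Longrightarrow> H10 \<Omega> v"
  and Vh0_H1: "Vh0 \<Omega> Th m v \<Longrightarrow> H1 \<Omega> v" and Vh0_L2: "Vh0 \<Omega> Th m v \<Longrightarrow> L2 \<Omega> v"
  by (auto simp: Vh_def Vh0_def H1_def)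

text \<open>Turns L2 statements into pointwise ones; definiteness of the linear systems and
  pointwise uniqueness rest on it.\<close>

lemma Vh_eq_0:
  assumes "Vh \<Omega> Th m v" "ip \<Omega> v v = 0" "x \<in> \<Omega>"
  shows "v x = 0"
  using continuous_eq_0_if_ip_eq_0[OF opn Vh_L2[OF assms(1)] _ assms(2,3)]
    Vh_continuous[OF tri assms(1)] closure_subset continuous_on_subset by blast

text \<open>\<open>\<kappa>\<close> assigns to each point of \<open>\<Omega>\<close> one simplex
  containing it, so monomials cut off to the fibres of \<open>\<kappa>\<close> span all piecewise
  polynomials on \<open>\<Omega>\<close>. They need not lie in \<open>Vh0\<close>;
  \<open>subspace_of_finite_span_has_basis\<close> extracts a basis that does.\<close>

lemma Vh0_basis:
  obtains N :: nat and b where "\<And>k. k < N \<Longrightarrow> Vh0 \<Omega> Th m (b k)"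
    "\<And>v. Vh0 \<Omega> Th m v \<Longrightarrow> \<exists>c. \<forall>x\<in>\<Omega>. v x = (\<Sum>k<N. c k * b k x)"
    "\<And>c k. \<forall>x\<in>\<Omega>. (\<Sum>k<N. c k * b k x) = 0 \<Longrightarrow> k < N \<Longrightarrow> c k = 0"
proof -
  define \<kappa> where "\<kappa> x = (SOME K. K \<in> Th \<and> x \<in> K)" for x
  let ?I = "{\<alpha> :: 'n \<Rightarrow> nat. sum \<alpha> UNIV \<le> m}"
  let ?mono = "\<lambda>\<alpha> x. \<Prod>i\<in>UNIV. (x $ i) ^ \<alpha> i :: real"
  define g where "g = (\<lambda>(K, \<alpha>) x. if \<kappa> x = K then ?mono \<alpha> x else 0)"
  have \<kappa>: "\<kappa> x \<in> Th \<and> x \<in> \<kappa> x" if "x \<in> \<Omega>" for x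
  proof -
    have "\<Union>Th = closure \<Omega>" using tri by (simp add: triangulation_def)
    then have "x \<in> \<Union>Th" using subsetD[OF closure_subset that] by simp
    then have "\<exists>K. K \<in> Th \<and> x \<in> K" by blast
    from someI_ex[OF this] show ?thesis unfolding \<kappa>_def .
  qed
  have fin: "finite Th" using tri by (simp add: triangulation_def)
  have "\<exists>c. \<forall>x\<in>\<Omega>. v x = (\<Sum>p\<in>Th \<times> ?I. c p * g p x)" if v: "Vh0 \<Omega> Th m v" for v
  proof -
    have "\<forall>K\<in>Th. \<exists>c. \<forall>x\<in>K. v x = (\<Sum>\<alpha>\<in>?I. c \<alpha> * ?mono \<alpha> x)"
      using v unfolding Vh0_def Vh_def poly_on_def by blast
    from bchoice[OF this] obtain c where
      c: "\<And>K x. K \<in> Th \<Longrightarrow> x \<in> K \<Longrightarrow> v x = (\<Sum>\<alpha>\<in>?I. c K \<alpha> * ?mono \<alpha> x)"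
      by blast
    have "v x = (\<Sum>p\<in>Th \<times> ?I. (\<lambda>(K, \<alpha>). c K \<alpha>) p * g p x)" if "x \<in> \<Omega>" for x
    proof -
      have "(\<Sum>p\<in>Th \<times> ?I. (\<lambda>(K, \<alpha>). c K \<alpha>) p * g p x) = (\<Sum>K\<in>Th. \<Sum>\<alpha>\<in>?I. if \<kappa> x = K then c K \<alpha> * ?mono \<alpha> x else 0)"
        unfolding sum.cartesian_product by (rule sum.cong) (simp_all add: g_def split: prod.split)
      also have "\<dots> = (\<Sum>K\<in>Th. if \<kappa> x = K then (\<Sum>\<alpha>\<in>?I. c K \<alpha> * ?mono \<alpha> x) else 0)"
        by (rule sum.cong) simp_all
      also have "\<dots> = (\<Sum>\<alpha>\<in>?I. c (\<kappa> x) \<alpha> * ?mono \<alpha> x)"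
        using \<kappa>[OF that] fin by (subst sum.delta') simp_all
      also have "\<dots> = v x" using c[of "\<kappa> x" x] \<kappa>[OF that] by metis
      finally show ?thesis ..
    qed
    then show ?thesis by blast
  qed
  note sp = this
  have fin2: "finite (Th \<times> ?I)" using fin finite_multiindices by (rule finite_cartesian_product)
  have "\<exists>(N::nat) b. (\<forall>k<N. Vh0 \<Omega> Th m (b k))
    \<and> (\<forall>v. Vh0 \<Omega> Th m v \<longrightarrow> (\<exists>c. \<forall>x\<in>\<Omega>. v x = (\<Sum>k<N. c k * b k x)))
    \<and> (\<forall>c. (\<forall>x\<in>\<Omega>. (\<Sum>k<N. c k * b k x) = 0) \<longrightarrow> (\<forall>k<N. c k = 0))"
    by (rule subspace_of_finite_span_has_basis[where V = "Vh0 \<Omega> Th m", OF fin2]) (rule Vh0_zero, erule (1) Vh0_lin, erule sp)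
  then obtain N :: nat and b where bb: "(\<forall>k<N. Vh0 \<Omega> Th m (b k))
    \<and> (\<forall>v. Vh0 \<Omega> Th m v \<longrightarrow> (\<exists>c. \<forall>x\<in>\<Omega>. v x = (\<Sum>k<N. c k * b k x)))
    \<and> (\<forall>c. (\<forall>x\<in>\<Omega>. (\<Sum>k<N. c k * b k x) = 0) \<longrightarrow> (\<forall>k<N. c k = 0))"
    by (elim exE)
  show thesis by (rule that[of N b]) (use bb in blast)+
qed

section \<open>The Ritz projection and the stability of both projections\<close>

text \<open>Galerkin equations in a basis. They are definite because, by Poincare's inequality and
  \<open>Vh_eq_0\<close>, a discrete function of zero Dirichlet energy vanishes on
  \<open>\<Omega>\<close>.\<close>

lemma ritz_exists:
  assumes u0: "H10 \<Omega> u0"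
  shows "\<exists>w. ritz \<Omega> Th m u0 w"
proof -
  obtain N :: nat and b where b: "\<And>k. k < N \<Longrightarrow> Vh0 \<Omega> Th m (b k)"
    and span: "\<And>v. Vh0 \<Omega> Th m v \<Longrightarrow> \<exists>c. \<forall>x\<in>\<Omega>. v x = (\<Sum>k<N. c k * b k x)"
    and ind: "\<And>c k. \<forall>x\<in>\<Omega>. (\<Sum>k<N. c k * b k x) = 0 \<Longrightarrow> k < N \<Longrightarrow> c k = 0"
    by (rule Vh0_basis) (rule that)
  obtain C where C: "0 < C" "\<And>v. H10 \<Omega> v \<Longrightarrow> ip \<Omega> v v \<le> C * dirichlet \<Omega> v v"
    using poincare[OF opn bdd] by blast
  have b1: "\<And>k. k \<in> {..<N} \<Longrightarrow> H1 \<Omega> (b k)" using b Vh0_H1 by auto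
  have "\<exists>c. \<forall>l\<in>{..<N}. (\<Sum>k<N. c k * dirichlet \<Omega> (b k) (b l)) = dirichlet \<Omega> u0 (b l)"
  proof (rule positive_definite_solvable)
    fix c :: "nat \<Rightarrow> real" assume c: "\<exists>k\<in>{..<N}. c k \<noteq> 0"
    let ?v = "\<lambda>x. \<Sum>k<N. c k * b k x"
    have v: "Vh0 \<Omega> Th m ?v" by (rule Vh0_sum) (use b in auto)
    have "dirichlet \<Omega> ?v ?v = (\<Sum>k<N. c k * dirichlet \<Omega> (b k) ?v)"
      by (rule dirichlet_sum_left[OF opn bdd finite_lessThan b1 Vh0_H1[OF v]])
    also have "\<dots> = (\<Sum>k<N. c k * (\<Sum>l<N. c l * dirichlet \<Omega> (b k) (b l)))"
      by (intro sum.cong refl arg_cong2[where f = "(*)"] dirichlet_sum_right[OF opn bdd finite_lessThan b1 b1])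
    finally have "dirichlet \<Omega> ?v ?v = (\<Sum>k<N. \<Sum>l<N. c k * c l * dirichlet \<Omega> (b k) (b l))"
      by (simp add: sum_distrib_left mult_ac)
    moreover have "0 \<noteq> ip \<Omega> ?v ?v"
    proof
      assume "0 = ip \<Omega> ?v ?v"
      then have "\<forall>x\<in>\<Omega>. ?v x = 0" using Vh_eq_0[OF Vh0_Vh[OF v]] by metis
      from ind[OF this] c show False by blast
    qed
    then have "0 < C * dirichlet \<Omega> ?v ?v"
      using C(2)[OF Vh0_H10[OF v]] ip_nonneg[of \<Omega> ?v] by linarith
    then have "0 < dirichlet \<Omega> ?v ?v" using C(1) by (simp add: zero_less_mult_iff)
    ultimately show "0 < (\<Sum>k<N. \<Sum>l<N. c k * c l * dirichlet \<Omega> (b k) (b l))" by simp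
  qed simp
  then obtain c where c: "\<And>l. l < N \<Longrightarrow> (\<Sum>k<N. c k * dirichlet \<Omega> (b k) (b l)) = dirichlet \<Omega> u0 (b l)"
    by auto
  let ?w = "\<lambda>x. \<Sum>k<N. c k * b k x"
  have w: "Vh0 \<Omega> Th m ?w" by (rule Vh0_sum) (use b in auto)
  have "dirichlet \<Omega> (\<lambda>y. u0 y - ?w y) v = 0" if v: "Vh0 \<Omega> Th m v" for v
  proof -
    obtain d where d: "\<And>x. x \<in> \<Omega> \<Longrightarrow> v x = (\<Sum>k<N. d k * b k x)" using span[OF v] by blast
    have diff: "H1 \<Omega> (\<lambda>y. u0 y - ?w y)"
      using H1_lin[OF H10_H1[OF u0] Vh0_H1[OF w], of 1 "-1"] by simp
    have "dirichlet \<Omega> (\<lambda>y. u0 y - ?w y) (b l) = 0" if "l < N" for l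
      using dirichlet_lin[OF opn bdd H10_H1[OF u0] Vh0_H1[OF w] Vh0_H1[OF b[OF that]], of 1 "-1"]
        dirichlet_sum_left[OF opn bdd finite_lessThan b1 Vh0_H1[OF b[OF that]], where c = c] c[OF that] by simp
    then show ?thesis
      using dirichlet_cong[of \<Omega> "\<lambda>y. u0 y - ?w y" "\<lambda>y. u0 y - ?w y" v, OF refl d]
        dirichlet_sum_right[OF opn bdd finite_lessThan b1 diff, where c = d] by simp
  qed
  then show ?thesis using w unfolding ritz_def dirichlet_def by blast
qed

lemma ritz_dirichlet:
  assumes "ritz \<Omega> Th m u0 w" "H10 \<Omega> u0" "Vh0 \<Omega> Th m v"
  shows "dirichlet \<Omega> w v = dirichlet \<Omega> u0 v"
proof -
  have w: "Vh0 \<Omega> Th m w" using assms(1) by (simp add: ritz_def)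
  have "dirichlet \<Omega> (\<lambda>y. u0 y - w y) v = 0"
    using assms by (auto simp: ritz_def dirichlet_def)
  then show ?thesis
    using dirichlet_lin[OF opn bdd H10_H1[OF assms(2)] Vh0_H1[OF w] Vh0_H1[OF assms(3)], of 1 "-1"] by simp
qed

text \<open>Testing with \<open>w\<close> turns its energy into
  \<open>dirichlet \<Omega> u0 w\<close>, and Young's inequality absorbs half of it.\<close>

lemma ritz_stable:
  assumes "ritz \<Omega> Th m u0 w" "H10 \<Omega> u0"
  shows "dirichlet \<Omega> w w \<le> dirichlet \<Omega> u0 u0"
proof -
  have w: "Vh0 \<Omega> Th m w" using assms(1) by (simp add: ritz_def)
  show ?thesis
    using ritz_dirichlet[OF assms w] dirichlet_young[OF opn bdd H10_H1[OF assms(2)] Vh0_H1[OF w]] by simp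
qed

text \<open>By orthogonality the nonnegative square of \<open>u - w\<close> is the difference of the
  squares of \<open>u\<close> and \<open>w\<close>.\<close>

lemma l2proj_stable:
  assumes "l2proj \<Omega> Th m u w" "L2 \<Omega> u"
  shows "ip \<Omega> w w \<le> ip \<Omega> u u"
proof -
  have w: "Vh \<Omega> Th m w" using assms(1) by (simp add: l2proj_def)
  have "ip \<Omega> (\<lambda>x. u x - w x) w = 0"
    using assms w by (auto simp: l2proj_def ip_def)
  then have "ip \<Omega> u w = ip \<Omega> w w"
    using ip_lin[OF assms(2) Vh_L2[OF w] Vh_L2[OF w], of 1 "-1"] by simp
  moreover have "0 \<le> ip \<Omega> u u - 2 * ip \<Omega> u w + ip \<Omega> w w"
    using ip_nonneg[of \<Omega> "\<lambda>x. 1 * u x + (-1) * w x"] ip_lin_expand[OF assms(2) Vh_L2[OF w], of 1 "-1"]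
    by simp
  ultimately show ?thesis by simp
qed

end

section \<open>Fractional derivatives of polynomials\<close>

text \<open>Euler's Beta integral under the substitution s = t x. All fractional integrals of
  polynomials reduce to it; on the open interval both bases of \<open>powr\<close> are
  positive.\<close>

lemma beta_integral_scaled:
  fixes a b t :: real
  assumes "0 < a" "0 < b" "0 < t"
  shows "set_integrable lborel {0<..<t} (\<lambda>s. s powr (a - 1) * (t - s) powr (b - 1))"
    and "(LINT s:{0<..<t}|lborel. s powr (a - 1) * (t - s) powr (b - 1)) = t powr (a + b - 1) * Beta a b"
proof -
  let ?g = "\<lambda>x. x powr (a - 1) * (1 - x) powr (b - 1)"
  let ?f = "\<lambda>s. indicator {0<..<t} s *\<^sub>R (s powr (a - 1) * (t - s) powr (b - 1))"
  have int: "set_integrable lborel {0<..<1} ?g"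
    using integrable_Beta[OF assms(1,2)] by (rule set_integrable_subset) auto
  have "(LINT x:{0<..<1}|lborel. ?g x) = Beta a b"
    using set_borel_integral_eq_integral(2)[OF int] has_integral_Beta_real[OF assms(1,2)]
    by (simp add: has_integral_Icc_iff_Ioo integral_unique)
  then have "has_bochner_integral lborel (\<lambda>x. indicator {0<..<1} x *\<^sub>R ?g x) (Beta a b)"
    using int by (simp add: has_bochner_integral_iff set_integrable_def set_lebesgue_integral_def)
  then have "has_bochner_integral lborel (\<lambda>x. t powr (a + b - 2) * (indicator {0<..<1} x *\<^sub>R ?g x)) (t powr (a + b - 2) * Beta a b)"
    by (intro has_bochner_integral_mult_right) auto
  moreover have "?f (0 + t * x) = t powr (a + b - 2) * (indicator {0<..<1} x *\<^sub>R ?g x)" for x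
  proof (cases "0 < x \<and> x < 1")
    case True
    have "t - t * x = t * (1 - x)" by (simp add: algebra_simps)
    then have "(t * x) powr (a - 1) * (t - t * x) powr (b - 1) = (t powr (a - 1) * t powr (b - 1)) * ?g x"
      using True assms(3) by (simp add: powr_mult)
    also have "t powr (a - 1) * t powr (b - 1) = t powr (a + b - 2)"
      by (simp flip: powr_add)
    finally show ?thesis using True assms(3) by (simp add: indicator_def)
  next
    case False
    then show ?thesis using assms(3) by (auto simp: indicator_def zero_less_mult_iff)
  qed
  ultimately have "has_bochner_integral lborel (\<lambda>x. ?f (0 + t * x)) (t powr (a + b - 2) * Beta a b)"
    by simp
  moreover have "t powr (a + b - 2) * Beta a b = (t powr (a + b - 1) * Beta a b) /\<^sub>R \<bar>t\<bar>"
  proof -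
    have "t powr (a + b - 1) = t powr (a + b - 2) * t powr 1" by (subst powr_add[symmetric]) simp
    then show ?thesis using assms(3) by simp
  qed
  ultimately have "has_bochner_integral lborel ?f (t powr (a + b - 1) * Beta a b)"
    using lborel_has_bochner_integral_real_affine_iff[of t ?f "t powr (a + b - 1) * Beta a b" 0] assms(3)
    by simp
  then show "set_integrable lborel {0<..<t} (\<lambda>s. s powr (a - 1) * (t - s) powr (b - 1))"
    "(LINT s:{0<..<t}|lborel. s powr (a - 1) * (t - s) powr (b - 1)) = t powr (a + b - 1) * Beta a b"
    by (simp_all add: has_bochner_integral_iff set_integrable_def set_lebesgue_integral_def)
qed

lemma set_integrable_cong_on:
  fixes f g :: "'a \<Rightarrow> real"
  shows "(\<And>x. x \<in> A \<Longrightarrow> f x = g x) \<Longrightarrow> set_integrable M A f \<longleftrightarrow> set_integrable M A g"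
  unfolding set_integrable_def
  by (rule Bochner_Integration.integrable_cong) (auto simp: indicator_def)

lemma set_integral_Icc_eq_Ioo:
  fixes f :: "real \<Rightarrow> real"
  shows "(LINT x:{a..b}|lborel. f x) = (LINT x:{a<..<b}|lborel. f x)"
  unfolding set_lebesgue_integral_def
  by (rule integral_discrete_difference[where X = "{a, b}"]) (auto simp: indicator_def)

lemma RL_I0_power:
  assumes "0 < \<delta>" "0 < t"
  shows "set_integrable lborel {0<..<t} (\<lambda>s. (t - s) powr (\<delta> - 1) * s ^ k)"
    and "RL_I0 \<delta> (\<lambda>s. s ^ k) t = fact k / Gamma (real k + 1 + \<delta>) * t powr (real k + \<delta>)"
proof -
  have eq: "(t - s) powr (\<delta> - 1) * s ^ k = s powr ((real k + 1) - 1) * (t - s) powr (\<delta> - 1)" if "s \<in> {0<..<t}" for s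
    using that by (simp add: powr_realpow)
  note B = beta_integral_scaled[of "real k + 1" \<delta> t, OF _ assms]
  show "set_integrable lborel {0<..<t} (\<lambda>s. (t - s) powr (\<delta> - 1) * s ^ k)"
    using B(1) by (subst set_integrable_cong_on[OF eq]) auto
  have "RL_I0 \<delta> (\<lambda>s. s ^ k) t = (1 / Gamma \<delta>) * (t powr (real k + 1 + \<delta> - 1) * Beta (real k + 1) \<delta>)"
    unfolding RL_I0_def set_integral_Icc_eq_Ioo using B(2) by (subst set_integral_cong_on[OF eq]) auto
  moreover have "Beta (real k + 1) \<delta> = fact k * Gamma \<delta> / Gamma (real k + 1 + \<delta>)"
    using Gamma_fact[of k, where 'a = real] by (simp add: Beta_def add_ac)
  moreover have "Gamma \<delta> \<noteq> 0" using assms(1) by (simp add: Gamma_real_pos less_imp_neq[symmetric])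
  ultimately show "RL_I0 \<delta> (\<lambda>s. s ^ k) t = fact k / Gamma (real k + 1 + \<delta>) * t powr (real k + \<delta>)"
    by (simp add: add_ac)
qed

text \<open>The index set is arbitrary and the exponents \<open>e j\<close> may repeat. This covers
  the extra constant \<open>uh\<close>, binomial expansions and squares of polynomials without
  collecting coefficients.\<close>

lemma RL_I0_poly:
  assumes "finite J" "0 < \<delta>" "0 < t"
  shows "RL_I0 \<delta> (\<lambda>s. \<Sum>j\<in>J. c j * s ^ e j) t
    = (\<Sum>j\<in>J. c j * (fact (e j) / Gamma (real (e j) + 1 + \<delta>) * t powr (real (e j) + \<delta>)))"
proof -
  have "RL_I0 \<delta> (\<lambda>s. \<Sum>j\<in>J. c j * s ^ e j) t
      = (1 / Gamma \<delta>) * (LINT s:{0<..<t}|lborel. \<Sum>j\<in>J. c j * ((t - s) powr (\<delta> - 1) * s ^ e j))"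
    unfolding RL_I0_def set_integral_Icc_eq_Ioo by (simp add: sum_distrib_left mult_ac)
  also have "\<dots> = (\<Sum>j\<in>J. c j * RL_I0 \<delta> (\<lambda>s. s ^ e j) t)"
    unfolding RL_I0_def set_integral_Icc_eq_Ioo using RL_I0_power(1)[OF assms(2,3)]
    by (subst set_integral_sum) (auto simp: sum_distrib_left intro!: sum.cong)
  finally show ?thesis using RL_I0_power(2)[OF assms(2,3)] by simp
qed

text \<open>For \<open>0 < \<alpha>\<close>, \<open>\<alpha> < 1\<close> and positive
  \<open>t\<close> this is the Riemann-Liouville derivative of order \<open>\<alpha>\<close> of the
  \<open>k\<close>-th power.\<close>

definition rl_mono :: "real \<Rightarrow> nat \<Rightarrow> real \<Rightarrow> real" where
  "rl_mono \<alpha> k t = fact k / Gamma (real k + 1 - \<alpha>) * t powr (real k - \<alpha>)"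

lemma RL_I0_poly_DERIV:
  assumes "finite J" "0 < \<alpha>" "\<alpha> < 1" "0 < t"
  shows "(RL_I0 (1 - \<alpha>) (\<lambda>s. \<Sum>j\<in>J. c j * s ^ e j) has_real_derivative (\<Sum>j\<in>J. c j * rl_mono \<alpha> (e j) t)) (at t)"
proof -
  let ?G = "\<lambda>t. \<Sum>j\<in>J. c j * (fact (e j) / Gamma (real (e j) + 1 + (1 - \<alpha>)) * t powr (real (e j) + (1 - \<alpha>)))"
  have "(?G has_real_derivative (\<Sum>j\<in>J. c j * (fact (e j) / Gamma (real (e j) + 1 + (1 - \<alpha>))
      * ((real (e j) + (1 - \<alpha>)) * t powr (real (e j) + (1 - \<alpha>) - 1))))) (at t)"
    using assms(4) by (intro DERIV_sum DERIV_cmult has_real_derivative_powr) auto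
  also have "(\<Sum>j\<in>J. c j * (fact (e j) / Gamma (real (e j) + 1 + (1 - \<alpha>))
      * ((real (e j) + (1 - \<alpha>)) * t powr (real (e j) + (1 - \<alpha>) - 1)))) = (\<Sum>j\<in>J. c j * rl_mono \<alpha> (e j) t)"
  proof (intro sum.cong refl arg_cong2[where f = "(*)"])
    fix j
    \<comment> \<open>The factor produced by differentiation cancels against Gamma (z + 1) = z Gamma
      z with z = \<open>real (e j) + 1 - \<alpha>\<close>, which is positive.\<close>
    have pos: "0 < real (e j) + 1 - \<alpha>" using assms(3) by simp
    then have "real (e j) + 1 - \<alpha> \<notin> \<int>\<^sub>\<le>\<^sub>0" by (auto dest: nonpos_Ints_nonpos)
    note G = Gamma_plus1[OF this]
    have e: "real (e j) + 1 + (1 - \<alpha>) = real (e j) + 1 - \<alpha> + 1" "real (e j) + (1 - \<alpha>) = real (e j) + 1 - \<alpha>"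
      "real (e j) + 1 - \<alpha> - 1 = real (e j) - \<alpha>" by simp_all
    show "fact (e j) / Gamma (real (e j) + 1 + (1 - \<alpha>)) * ((real (e j) + (1 - \<alpha>)) * t powr (real (e j) + (1 - \<alpha>) - 1))
        = rl_mono \<alpha> (e j) t"
      unfolding e G rl_mono_def using pos by simp
  qed
  finally have "(?G has_real_derivative (\<Sum>j\<in>J. c j * rl_mono \<alpha> (e j) t)) (at t)" .
  \<comment> \<open>The closed formula is available at positive times, hence on a neighbourhood of
    \<open>t\<close>, which determines the derivative.\<close>
  moreover have "eventually (\<lambda>t. RL_I0 (1 - \<alpha>) (\<lambda>s. \<Sum>j\<in>J. c j * s ^ e j) t = ?G t) (nhds t)"
  proof (rule eventually_mono)
    show "eventually (\<lambda>x. x \<in> {0<..}) (nhds t)"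
      using assms(4) by (intro eventually_nhds_in_open) auto
    show "RL_I0 (1 - \<alpha>) (\<lambda>s. \<Sum>j\<in>J. c j * s ^ e j) x = ?G x" if "x \<in> {0<..}" for x
      by (rule RL_I0_poly) (use that assms in auto)
  qed
  ultimately show ?thesis by (subst DERIV_cong_ev) auto
qed

lemma ceiling_frac: "0 < \<alpha> \<Longrightarrow> \<alpha> < 1 \<Longrightarrow> nat \<lceil>\<alpha>\<rceil> = 1"
proof -
  assume "0 < \<alpha>" "\<alpha> < 1"
  then have "\<lceil>\<alpha>\<rceil> = 1" by (simp add: ceiling_eq_iff)
  then show ?thesis by simp
qed

lemma RL_D0_poly:
  assumes "finite J" "0 < \<alpha>" "\<alpha> < 1" "0 < t"
  shows "RL_D0 \<alpha> (\<lambda>s. \<Sum>j\<in>J. c j * s ^ e j) t = (\<Sum>j\<in>J. c j * rl_mono \<alpha> (e j) t)"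
  using DERIV_imp_deriv[OF RL_I0_poly_DERIV[OF assms]] ceiling_frac[OF assms(2,3)]
  by (simp add: RL_D0_def Let_def)

text \<open>Substitute s = T - r: the right-sided integral is the left-sided one in reversed time,
  so right-sided derivatives follow once \<open>v\<close> is expanded in powers of
  \<open>T - t\<close>.\<close>

lemma RL_IT_reflect: "RL_IT T \<delta> v t = RL_I0 \<delta> (\<lambda>r. v (T - r)) (T - t)"
proof -
  have "(LINT s:{t..T}|lborel. (s - t) powr (\<delta> - 1) * v s)
      = (LINT r:{0..T - t}|lborel. ((T - t) - r) powr (\<delta> - 1) * v (T - r))"
    unfolding set_lebesgue_integral_def
    by (subst lborel_integral_real_affine[where c = "-1" and t = T])
      (auto intro!: Bochner_Integration.integral_cong simp: indicator_def algebra_simps)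
  then show ?thesis by (simp add: RL_IT_def RL_I0_def)
qed

lemma RL_DT_poly:
  assumes "finite J" "0 < \<alpha>" "\<alpha> < 1" "t < T" and v: "\<And>r. v (T - r) = (\<Sum>j\<in>J. c j * r ^ e j)"
  shows "RL_DT T \<alpha> v t = (\<Sum>j\<in>J. c j * rl_mono \<alpha> (e j) (T - t))"
proof -
  have "RL_IT T (1 - \<alpha>) v = (\<lambda>t. RL_I0 (1 - \<alpha>) (\<lambda>s. \<Sum>j\<in>J. c j * s ^ e j) (T - t))"
    by (simp add: fun_eq_iff RL_IT_reflect v)
  moreover have "((\<lambda>t. RL_I0 (1 - \<alpha>) (\<lambda>s. \<Sum>j\<in>J. c j * s ^ e j) (T - t)) has_real_derivative
      (\<Sum>j\<in>J. c j * rl_mono \<alpha> (e j) (T - t)) * (-1)) (at t)"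
    using assms(4) by (intro DERIV_chain2[OF RL_I0_poly_DERIV[OF assms(1-3)]]) (auto intro!: derivative_eq_intros)
  ultimately show ?thesis
    using ceiling_frac[OF assms(2,3)] by (simp add: RL_DT_def Let_def DERIV_imp_deriv)
qed

definition reflect_coeff :: "real \<Rightarrow> nat \<Rightarrow> nat \<Rightarrow> real" where
  "reflect_coeff T j l = real (j choose l) * (-1) ^ l * T ^ (j - l)"

lemma reflect_power: "(T - r) ^ j = (\<Sum>l\<le>j. reflect_coeff T j l * r ^ l)" for r :: real
proof -
  have "(T - r) ^ j = (- r + T) ^ j" by simp
  also have "\<dots> = (\<Sum>l\<le>j. real (j choose l) * (- r) ^ l * T ^ (j - l))"
    by (rule binomial_ring)
  finally show ?thesis
    by (simp add: reflect_coeff_def power_minus[of r] mult_ac)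
qed

text \<open>The right-sided derivative of the \<open>j\<close>-th power, through its expansion in
  powers of \<open>T - t\<close>.\<close>

definition rl_monoT :: "real \<Rightarrow> real \<Rightarrow> nat \<Rightarrow> real \<Rightarrow> real" where
  "rl_monoT T \<alpha> j t = (\<Sum>l\<le>j. reflect_coeff T j l * rl_mono \<alpha> l (T - t))"

lemma RL_DT_poly':
  assumes "0 < \<alpha>" "\<alpha> < 1" "t < T"
  shows "RL_DT T \<alpha> (\<lambda>s. \<Sum>j<n. c j * s ^ j) t = (\<Sum>j<n. c j * rl_monoT T \<alpha> j t)"
proof -
  have "RL_DT T \<alpha> (\<lambda>s. \<Sum>j<n. c j * s ^ j) t
      = (\<Sum>p\<in>Sigma {..<n} (\<lambda>j. {..j}). (c (fst p) * reflect_coeff T (fst p) (snd p)) * rl_mono \<alpha> (snd p) (T - t))"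
    by (rule RL_DT_poly[OF _ assms])
      (auto simp: reflect_power sum_distrib_left sum.Sigma split_beta mult.assoc)
  then show ?thesis
    by (simp add: rl_monoT_def sum_distrib_left sum.Sigma split_beta mult.assoc)
qed

section \<open>The fractional bilinear form in monomials\<close>

text \<open>The value depends on the two orders only through \<open>\<mu> + \<nu>\<close>, so order
  can be moved freely from one factor to the other.\<close>

lemma powr_times_powr_integral:
  assumes "\<mu> < real i + 1" "\<nu> < real l + 1" "0 < (T::real)"
  shows "set_integrable lborel {0<..<T} (\<lambda>t. rl_mono \<mu> i t * rl_mono \<nu> l (T - t))"
    and "(LINT t:{0<..<T}|lborel. rl_mono \<mu> i t * rl_mono \<nu> l (T - t))
      = fact i * fact l / Gamma (real i + real l + 2 - (\<mu> + \<nu>)) * T powr (real i + real l + 1 - (\<mu> + \<nu>))"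
proof -
  let ?a = "real i + 1 - \<mu>" and ?b = "real l + 1 - \<nu>"
  let ?C = "fact i / Gamma ?a * (fact l / Gamma ?b)"
  have ab: "0 < ?a" "0 < ?b" using assms by auto
  note B = beta_integral_scaled[OF ab assms(3)]
  have eq: "rl_mono \<mu> i t * rl_mono \<nu> l (T - t) = ?C * (t powr (?a - 1) * (T - t) powr (?b - 1))" for t
    by (simp add: rl_mono_def algebra_simps)
  show "set_integrable lborel {0<..<T} (\<lambda>t. rl_mono \<mu> i t * rl_mono \<nu> l (T - t))"
    unfolding eq using B(1) by (intro set_integrable_mult_right)
  have "Gamma ?a \<noteq> 0" "Gamma ?b \<noteq> 0"
    using Gamma_real_pos[OF ab(1)] Gamma_real_pos[OF ab(2)] by linarith+
  then have "?C * (T powr (?a + ?b - 1) * Beta ?a ?b)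
      = fact i * fact l / Gamma (?a + ?b) * T powr (?a + ?b - 1)"
    by (simp add: Beta_def)
  moreover have "?a + ?b = real i + real l + 2 - (\<mu> + \<nu>)" by simp
  ultimately show "(LINT t:{0<..<T}|lborel. rl_mono \<mu> i t * rl_mono \<nu> l (T - t))
      = fact i * fact l / Gamma (real i + real l + 2 - (\<mu> + \<nu>)) * T powr (real i + real l + 1 - (\<mu> + \<nu>))"
    unfolding eq set_integral_mult_right B(2) by (simp add: algebra_simps)
qed

text \<open>Order 0 is the identity; this lets ordinary powers take part in
  \<open>powr_times_powr_integral\<close>.\<close>

lemma rl_mono_0: "0 < t \<Longrightarrow> rl_mono 0 k t = t ^ k"
  using Gamma_fact[of k, where 'a = real] by (simp add: rl_mono_def powr_realpow add_ac)

text \<open>The first index belongs to the trial function under the left-sided derivative, the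
  second to the test function under the right-sided one.\<close>

definition frac_form :: "real \<Rightarrow> real \<Rightarrow> nat \<Rightarrow> nat \<Rightarrow> real" where
  "frac_form T \<alpha> i j = (LINT t:{0<..<T}|lborel. rl_mono \<alpha> i t * rl_monoT T \<alpha> j t)"

lemma frac_form_integrable:
  assumes "\<alpha> < 1" "0 < T"
  shows "set_integrable lborel {0<..<T} (\<lambda>t. rl_mono \<alpha> i t * rl_monoT T \<alpha> j t)"
proof -
  have "set_integrable lborel {0<..<T} (\<lambda>t. \<Sum>l\<le>j. reflect_coeff T j l * (rl_mono \<alpha> i t * rl_mono \<alpha> l (T - t)))"
    using assms by (intro set_integrable_sum set_integrable_mult_right powr_times_powr_integral(1)) auto
  then show ?thesis by (simp add: rl_monoT_def sum_distrib_left mult_ac)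
qed

lemma rl_mono_power_integrable:
  assumes "\<beta> < 1" "0 < T"
  shows "set_integrable lborel {0<..<T} (\<lambda>t. rl_mono \<beta> i t * t ^ j)"
proof -
  have "set_integrable lborel {0<..<T} (\<lambda>t. \<Sum>l\<le>j. reflect_coeff T j l * (rl_mono \<beta> i t * rl_mono 0 l (T - t)))"
    using assms by (intro set_integrable_sum set_integrable_mult_right powr_times_powr_integral(1)) auto
  moreover have "(\<Sum>l\<le>j. reflect_coeff T j l * (rl_mono \<beta> i t * rl_mono 0 l (T - t))) = rl_mono \<beta> i t * t ^ j"
    if "t \<in> {0<..<T}" for t
    using that reflect_power[of T "T - t" j] by (simp add: rl_mono_0 sum_distrib_left mult_ac)
  ultimately show ?thesis by (subst (asm) set_integrable_cong_on) auto
qed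

text \<open>The semigroup property in disguise: moving \<open>D\<^sup>\<alpha>\<close> across the inner product turns the other
  derivative into one of order \<open>2\<alpha>\<close>.\<close>
lemma frac_form_eq:
  assumes "\<alpha> < 1 / 2" "0 < \<alpha>" "0 < T"
  shows "frac_form T \<alpha> i j = (LINT t:{0<..<T}|lborel. rl_mono (2 * \<alpha>) i t * t ^ j)"
proof -
  have "frac_form T \<alpha> i j = (LINT t:{0<..<T}|lborel. \<Sum>l\<le>j. reflect_coeff T j l * (rl_mono \<alpha> i t * rl_mono \<alpha> l (T - t)))"
    unfolding frac_form_def by (simp add: rl_monoT_def sum_distrib_left mult_ac)
  also have "\<dots> = (\<Sum>l\<le>j. reflect_coeff T j l * (LINT t:{0<..<T}|lborel. rl_mono \<alpha> i t * rl_mono \<alpha> l (T - t)))"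
    using assms by (subst set_integral_sum) (auto intro!: powr_times_powr_integral(1))
  also have "\<dots> = (\<Sum>l\<le>j. reflect_coeff T j l * (LINT t:{0<..<T}|lborel. rl_mono (2 * \<alpha>) i t * rl_mono 0 l (T - t)))"
  proof (intro sum.cong refl arg_cong2[where f = "(*)"])
    fix l
    have "\<alpha> + \<alpha> = 2 * \<alpha> + 0" by simp
    then show "(LINT t:{0<..<T}|lborel. rl_mono \<alpha> i t * rl_mono \<alpha> l (T - t))
        = (LINT t:{0<..<T}|lborel. rl_mono (2 * \<alpha>) i t * rl_mono 0 l (T - t))"
      using assms powr_times_powr_integral(2)[of \<alpha> i \<alpha> l T] powr_times_powr_integral(2)[of "2 * \<alpha>" i 0 l T]
      by simp
  qed
  also have "\<dots> = (LINT t:{0<..<T}|lborel. \<Sum>l\<le>j. reflect_coeff T j l * (rl_mono (2 * \<alpha>) i t * rl_mono 0 l (T - t)))"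
    using assms by (subst set_integral_sum) (auto intro!: powr_times_powr_integral(1))
  also have "\<dots> = (LINT t:{0<..<T}|lborel. rl_mono (2 * \<alpha>) i t * t ^ j)"
    by (rule set_integral_cong_on) (use reflect_power[of T "T - _" j] in \<open>simp add: rl_mono_0 sum_distrib_left mult_ac\<close>)
  finally show ?thesis .
qed

section \<open>Marchaud's formula\<close>

text \<open>Integrate the derivative of \<open>(s ^ k - t ^ k) * (t - s) powr (- \<beta>)\<close>
  over (0, t). Its first part gives the Riemann-Liouville derivative up to
  \<open>Gamma (1 - \<beta>)\<close>, its second the Marchaud integral, and the value at
  \<open>s = 0\<close> the boundary term with the weight.\<close>

lemma marchaud_power:
  fixes \<beta> t :: real
  assumes \<beta>: "0 < \<beta>" "\<beta> < 1" and t: "0 < t"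
  shows "set_integrable lborel {0<..<t} (\<lambda>s. (t ^ k - s ^ k) * (t - s) powr (- 1 - \<beta>))"
    and "Gamma (1 - \<beta>) * rl_mono \<beta> k t
      = t ^ k * t powr (- \<beta>) + \<beta> * (LINT s:{0<..<t}|lborel. (t ^ k - s ^ k) * (t - s) powr (- 1 - \<beta>))"
proof -
  let ?f = "\<lambda>s. (t ^ k - s ^ k) * (t - s) powr (- 1 - \<beta>)"
  have "0 < Gamma (1 - \<beta>)" using \<beta> by (intro Gamma_real_pos) simp
  then have G: "Gamma (1 - \<beta>) \<noteq> 0" by linarith
  have "set_integrable lborel {0<..<t} ?f \<and>
    Gamma (1 - \<beta>) * rl_mono \<beta> k t = t ^ k * t powr (- \<beta>) + \<beta> * (LINT s:{0<..<t}|lborel. ?f s)"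
  proof (cases k)
    case 0
    then show ?thesis using G by (simp add: rl_mono_def set_integrable_def)
  next
    case (Suc k')
    define h where "h s = (\<Sum>i<k. s ^ (k - Suc i) * t ^ i)" for s
    \<comment> \<open>One factor \<open>t - s\<close> is cancelled, so the exponent
      \<open>1 - \<beta>\<close> is positive and \<open>F\<close> is continuous up to
      \<open>s = t\<close>.\<close>
    define F where "F s = - ((t - s) powr (1 - \<beta>)) * h s" for s
    have h: "t ^ k - s ^ k = (t - s) * h s" for s
      by (simp add: h_def power_diff_sumr2)
    have F_eq: "F s = (s ^ k - t ^ k) * (t - s) powr (- \<beta>)" if "s < t" for s
    proof -
      have "(t - s) powr (1 - \<beta>) = (t - s) * (t - s) powr (- \<beta>)"
        using that by (simp add: powr_diff powr_minus divide_inverse)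
      then have "F s = - ((t - s) * h s) * (t - s) powr (- \<beta>)" by (simp add: F_def)
      then show ?thesis by (simp flip: h)
    qed
    let ?F' = "\<lambda>s. real k * (s ^ k' * (t - s) powr (- \<beta>)) - \<beta> * ?f s"
    have "(?F' has_integral (F t - F 0)) {0..t}"
    proof (rule fundamental_theorem_of_calculus_interior)
      show "continuous_on {0..t} F"
        unfolding F_def[abs_def] h_def using \<beta>
        by (intro continuous_on_mult continuous_on_minus continuous_on_powr' continuous_intros) auto
      fix s assume s: "s \<in> {0<..<t}"
      have "((\<lambda>s. s ^ k - t ^ k) has_real_derivative real k * s ^ k') (at s)"
        using DERIV_diff[OF DERIV_pow[of k s] DERIV_const[of "t ^ k"]] by (simp add: Suc)
      moreover have "((\<lambda>s. (t - s) powr (- \<beta>)) has_real_derivative \<beta> * (t - s) powr (- 1 - \<beta>)) (at s)"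
        using s by (auto intro!: derivative_eq_intros simp: powr_diff powr_minus field_simps)
      ultimately have "((\<lambda>s. (s ^ k - t ^ k) * (t - s) powr (- \<beta>)) has_real_derivative ?F' s) (at s)"
        by (rule DERIV_cong[OF DERIV_mult]) (simp add: algebra_simps)
      moreover have "eventually (\<lambda>s. F s = (s ^ k - t ^ k) * (t - s) powr (- \<beta>)) (nhds s)"
        using eventually_nhds_in_open[of "{..<t}" s] s F_eq by (auto elim!: eventually_mono)
      ultimately have "(F has_real_derivative ?F' s) (at s)" by (subst DERIV_cong_ev) auto
      then show "(F has_vector_derivative ?F' s) (at s)"
        by (simp add: has_real_derivative_iff_has_vector_derivative)
    qed (use t in auto)
    moreover have "F t - F 0 = t ^ k * t powr (- \<beta>)"
      using F_eq[of 0] t \<beta> by (simp add: F_def Suc)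
    ultimately have FTC: "(?F' has_integral t ^ k * t powr (- \<beta>)) {0<..<t}"
      by (simp add: has_integral_Icc_iff_Ioo)
    have R: "set_integrable lborel {0<..<t} (\<lambda>s. (t - s) powr ((1 - \<beta>) - 1) * s ^ k')"
      "RL_I0 (1 - \<beta>) (\<lambda>s. s ^ k') t = fact k' / Gamma (real k' + 1 + (1 - \<beta>)) * t powr (real k' + (1 - \<beta>))"
      using RL_I0_power[of "1 - \<beta>" t k'] \<beta> t by auto
    have "(LINT s:{0<..<t}|lborel. (t - s) powr ((1 - \<beta>) - 1) * s ^ k')
        = Gamma (1 - \<beta>) * (fact k' / Gamma (real k' + 1 + (1 - \<beta>)) * t powr (real k' + (1 - \<beta>)))"
      using R(2) G by (simp add: RL_I0_def set_integral_Icc_eq_Ioo field_simps)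
    then have "((\<lambda>s. s ^ k' * (t - s) powr (- \<beta>)) has_integral
        Gamma (1 - \<beta>) * (fact k' / Gamma (real k' + 1 + (1 - \<beta>)) * t powr (real k' + (1 - \<beta>)))) {0<..<t}"
      using set_borel_integral_eq_integral[OF R(1)] by (simp add: has_integral_iff mult.commute)
    from has_integral_mult_right[OF this, of "real k"]
    have "((\<lambda>s. real k * (s ^ k' * (t - s) powr (- \<beta>))) has_integral Gamma (1 - \<beta>) * rl_mono \<beta> k t) {0<..<t}"
      by (simp add: rl_mono_def Suc algebra_simps)
    from has_integral_diff[OF this FTC]
    have "((\<lambda>s. \<beta> * ?f s) has_integral Gamma (1 - \<beta>) * rl_mono \<beta> k t - t ^ k * t powr (- \<beta>)) {0<..<t}"
      by simp
    from has_integral_mult_right[OF this, of "1 / \<beta>"]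
    have f: "(?f has_integral (Gamma (1 - \<beta>) * rl_mono \<beta> k t - t ^ k * t powr (- \<beta>)) / \<beta>) {0<..<t}"
      using \<beta> by simp
    \<comment> \<open>\<open>t ^ k - s ^ k\<close> is nonnegative here, so gauge integrability is
      already absolute integrability.\<close>
    then have "?f absolutely_integrable_on {0<..<t}"
      by (intro nonnegative_absolutely_integrable_1) (auto simp: has_integral_iff intro!: mult_nonneg_nonneg power_mono)
    moreover have "(\<lambda>s. indicator {0<..<t} s *\<^sub>R ?f s) \<in> borel_measurable lborel" by measurable
    ultimately have int: "set_integrable lborel {0<..<t} ?f"
      by (simp add: set_integrable_def integrable_completion)
    have "(LINT s:{0<..<t}|lborel. ?f s) = (Gamma (1 - \<beta>) * rl_mono \<beta> k t - t ^ k * t powr (- \<beta>)) / \<beta>"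
      using set_borel_integral_eq_integral(2)[OF int] f by (simp add: integral_unique)
    then show ?thesis using int \<beta> by (simp add: field_simps)
  qed
  then show "set_integrable lborel {0<..<t} ?f"
    "Gamma (1 - \<beta>) * rl_mono \<beta> k t = t ^ k * t powr (- \<beta>) + \<beta> * (LINT s:{0<..<t}|lborel. ?f s)"
    by auto
qed

lemma marchaud_poly:
  fixes \<beta> t :: real
  assumes "0 < \<beta>" "\<beta> < 1" "0 < t" "finite J" and p: "\<And>s. p s = (\<Sum>j\<in>J. c j * s ^ e j)"
  shows "set_integrable lborel {0<..<t} (\<lambda>s. (p t - p s) * (t - s) powr (- 1 - \<beta>))"
    and "Gamma (1 - \<beta>) * (\<Sum>j\<in>J. c j * rl_mono \<beta> (e j) t)
      = p t * t powr (- \<beta>) + \<beta> * (LINT s:{0<..<t}|lborel. (p t - p s) * (t - s) powr (- 1 - \<beta>))"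
proof -
  note M = marchaud_power[OF assms(1-3)]
  have eq: "(p t - p s) * (t - s) powr (- 1 - \<beta>) = (\<Sum>j\<in>J. c j * ((t ^ e j - s ^ e j) * (t - s) powr (- 1 - \<beta>)))" for s
    by (simp add: p right_diff_distrib left_diff_distrib sum_subtractf sum_distrib_right sum_distrib_left mult_ac)
  show "set_integrable lborel {0<..<t} (\<lambda>s. (p t - p s) * (t - s) powr (- 1 - \<beta>))"
    unfolding eq by (intro set_integrable_sum set_integrable_mult_right M(1))
  have "(LINT s:{0<..<t}|lborel. (p t - p s) * (t - s) powr (- 1 - \<beta>))
      = (\<Sum>j\<in>J. c j * (LINT s:{0<..<t}|lborel. (t ^ e j - s ^ e j) * (t - s) powr (- 1 - \<beta>)))"
    unfolding eq using M(1) by (subst set_integral_sum) auto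
  moreover have "Gamma (1 - \<beta>) * (\<Sum>j\<in>J. c j * rl_mono \<beta> (e j) t) = (\<Sum>j\<in>J. c j * (Gamma (1 - \<beta>) * rl_mono \<beta> (e j) t))"
    by (simp add: sum_distrib_left mult_ac)
  ultimately show "Gamma (1 - \<beta>) * (\<Sum>j\<in>J. c j * rl_mono \<beta> (e j) t)
      = p t * t powr (- \<beta>) + \<beta> * (LINT s:{0<..<t}|lborel. (p t - p s) * (t - s) powr (- 1 - \<beta>))"
    unfolding M(2) by (simp add: p algebra_simps sum.distrib sum_distrib_left)
qed

text \<open>Moving the whole order \<open>\<beta>\<close> onto the constant 1 leaves
  \<open>q\<close> integrated against a positive multiple of
  \<open>(T - t) powr (- \<beta>)\<close>.\<close>

lemma rl_mono_integral_nonneg: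
  fixes q :: "real \<Rightarrow> real"
  assumes "\<beta> < 1" "0 < T" "finite J" and q: "\<And>s. q s = (\<Sum>j\<in>J. c j * s ^ e j)" "\<And>s. 0 \<le> q s"
  shows "set_integrable lborel {0<..<T} (\<lambda>t. \<Sum>j\<in>J. c j * rl_mono \<beta> (e j) t)"
    and "0 \<le> (LINT t:{0<..<T}|lborel. \<Sum>j\<in>J. c j * rl_mono \<beta> (e j) t)"
proof -
  have i1: "set_integrable lborel {0<..<T} (\<lambda>t. rl_mono \<beta> k t)" for k
    using rl_mono_power_integrable[OF assms(1,2), of k 0] by simp
  then show "set_integrable lborel {0<..<T} (\<lambda>t. \<Sum>j\<in>J. c j * rl_mono \<beta> (e j) t)"
    by (intro set_integrable_sum set_integrable_mult_right)
  have i2: "set_integrable lborel {0<..<T} (\<lambda>t. rl_mono 0 k t * rl_mono \<beta> 0 (T - t))" for k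
    using assms by (intro powr_times_powr_integral(1)) auto
  have eq: "(LINT t:{0<..<T}|lborel. rl_mono \<beta> k t) = (LINT t:{0<..<T}|lborel. rl_mono 0 k t * rl_mono \<beta> 0 (T - t))" for k
  proof -
    have "(LINT t:{0<..<T}|lborel. rl_mono \<beta> k t) = (LINT t:{0<..<T}|lborel. rl_mono \<beta> k t * rl_mono 0 0 (T - t))"
      by (rule set_integral_cong_on) (simp add: rl_mono_0)
    then show ?thesis
      using assms powr_times_powr_integral(2)[of \<beta> k 0 0 T] powr_times_powr_integral(2)[of 0 k \<beta> 0 T] by simp
  qed
  have "(LINT t:{0<..<T}|lborel. \<Sum>j\<in>J. c j * rl_mono \<beta> (e j) t)
      = (\<Sum>j\<in>J. c j * (LINT t:{0<..<T}|lborel. rl_mono 0 (e j) t * rl_mono \<beta> 0 (T - t)))"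
    using i1 by (subst set_integral_sum) (auto simp: eq)
  also have "\<dots> = (LINT t:{0<..<T}|lborel. \<Sum>j\<in>J. c j * (rl_mono 0 (e j) t * rl_mono \<beta> 0 (T - t)))"
    using i2 by (subst set_integral_sum) auto
  also have "\<dots> = (LINT t:{0<..<T}|lborel. q t * rl_mono \<beta> 0 (T - t))"
    by (rule set_integral_cong_on) (simp add: q(1) rl_mono_0 sum_distrib_right mult.assoc)
  also have "0 \<le> \<dots>"
    using q(2) Gamma_real_pos[of "1 - \<beta>"] assms(1)
    by (intro set_integral_nonneg_real mult_nonneg_nonneg) (auto simp: rl_mono_def)
  finally show "0 \<le> (LINT t:{0<..<T}|lborel. \<Sum>j\<in>J. c j * rl_mono \<beta> (e j) t)" .
qed

section \<open>Weighted and Slobodeckij forms; coercivity\<close>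

definition weight_form :: "real \<Rightarrow> real \<Rightarrow> nat \<Rightarrow> nat \<Rightarrow> real" where
  "weight_form T \<beta> i j = (LINT t:{0<..<T}|lborel. t ^ i * t ^ j * t powr (- \<beta>))"

text \<open>For \<open>\<beta> = 2 * \<alpha>\<close> the kernel, and the order of the iterated
  integrals, are those of \<open>H1s_time_norm\<close> with smoothness
  \<open>\<alpha>\<close>.\<close>

definition slob_form :: "real \<Rightarrow> real \<Rightarrow> nat \<Rightarrow> nat \<Rightarrow> real" where
  "slob_form T \<beta> i j = (LINT t:{0<..<T}|lborel. LINT s:{0<..<T}|lborel.
     (t ^ i - s ^ i) * (t ^ j - s ^ j) / \<bar>t - s\<bar> powr (1 + \<beta>))"

lemma weight_integrable:
  fixes \<beta> T :: real
  assumes "\<beta> < 1" "0 < T"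
  shows "set_integrable lborel {0<..<T} (\<lambda>t. t ^ i * t powr (- \<beta>))"
proof -
  have *: "0 < Gamma (1 - \<beta>)" using assms by (intro Gamma_real_pos) simp
  have "set_integrable lborel {0<..<T} (\<lambda>t. Gamma (1 - \<beta>) * (rl_mono \<beta> 0 t * t ^ i))"
    using assms by (intro set_integrable_mult_right rl_mono_power_integrable)
  also have "(\<lambda>t. Gamma (1 - \<beta>) * (rl_mono \<beta> 0 t * t ^ i)) = (\<lambda>t. t ^ i * t powr (- \<beta>))"
    using * by (simp add: rl_mono_def fun_eq_iff)
  finally show ?thesis .
qed

lemma weight_form_poly:
  assumes "\<beta> < 1" "0 < T"
  shows "set_integrable lborel {0<..<T} (\<lambda>t. (\<Sum>i<n. c i * t ^ i)\<^sup>2 * t powr (- \<beta>))"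
    and "(LINT t:{0<..<T}|lborel. (\<Sum>i<n. c i * t ^ i)\<^sup>2 * t powr (- \<beta>))
      = (\<Sum>i<n. \<Sum>j<n. c i * c j * weight_form T \<beta> i j)"
proof -
  have eq: "(\<Sum>i<n. c i * t ^ i)\<^sup>2 * t powr (- \<beta>) = (\<Sum>i<n. \<Sum>j<n. c i * c j * (t ^ i * t ^ j * t powr (- \<beta>)))" for t
  proof -
    have "(\<Sum>i<n. c i * t ^ i)\<^sup>2 = (\<Sum>i<n. \<Sum>j<n. (c i * t ^ i) * (c j * t ^ j))"
      by (simp add: power2_eq_square sum_product)
    then show ?thesis by (simp only:) (simp add: sum_distrib_left sum_distrib_right mult_ac)
  qed
  have int: "set_integrable lborel {0<..<T} (\<lambda>t. t ^ i * t ^ j * t powr (- \<beta>))" for i j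
    using weight_integrable[OF assms, of "i + j"] by (simp add: power_add)
  show "set_integrable lborel {0<..<T} (\<lambda>t. (\<Sum>i<n. c i * t ^ i)\<^sup>2 * t powr (- \<beta>))"
    unfolding eq by (intro set_integrable_sum set_integrable_mult_right int)
  show "(LINT t:{0<..<T}|lborel. (\<Sum>i<n. c i * t ^ i)\<^sup>2 * t powr (- \<beta>))
      = (\<Sum>i<n. \<Sum>j<n. c i * c j * weight_form T \<beta> i j)"
    unfolding eq weight_form_def
    by (subst set_integral_sum, intro set_integrable_sum set_integrable_mult_right int, intro sum.cong refl,
        subst set_integral_sum, intro set_integrable_mult_right int, simp)
qed

text \<open>Cancelling one factor of \<open>t - s\<close> per difference shows that the kernel is continuous up to the diagonal,
  where both sides are \<open>0\<close> by the convention \<open>x / 0 = 0\<close>.\<close>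
lemma slob_kernel_eq:
  fixes t s \<beta> :: real
  assumes "\<beta> < 1"
  shows "(t ^ i - s ^ i) * (t ^ j - s ^ j) / \<bar>t - s\<bar> powr (1 + \<beta>)
    = \<bar>t - s\<bar> powr (1 - \<beta>) * ((\<Sum>k<i. s ^ (i - Suc k) * t ^ k) * (\<Sum>k<j. s ^ (j - Suc k) * t ^ k))"
proof (cases "t = s")
  case False
  then have "\<bar>t - s\<bar> powr (1 - \<beta>) * \<bar>t - s\<bar> powr (1 + \<beta>) = (t - s)\<^sup>2"
    by (simp flip: powr_add)
  moreover have "\<bar>t - s\<bar> powr (1 + \<beta>) \<noteq> 0" using False by simp
  moreover have "(x * h) * (x * g) / B = A * (h * g)" if "A * B = x\<^sup>2" "B \<noteq> 0" for x h g A B :: real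
  proof -
    have "(x * h) * (x * g) = x\<^sup>2 * (h * g)" by (simp add: power2_eq_square)
    then have "(x * h) * (x * g) = (A * (h * g)) * B" by (simp flip: that(1))
    then show ?thesis using nonzero_divide_eq_eq[OF that(2)] by blast
  qed
  ultimately show ?thesis
    unfolding power_diff_sumr2[of t i s] power_diff_sumr2[of t j s] by blast
qed simp

definition slob_kernel :: "real \<Rightarrow> nat \<Rightarrow> nat \<Rightarrow> real \<times> real \<Rightarrow> real" where
  "slob_kernel \<beta> i j z = (fst z ^ i - snd z ^ i) * (fst z ^ j - snd z ^ j) / \<bar>fst z - snd z\<bar> powr (1 + \<beta>)"

lemma slob_kernel_integrable:
  assumes "\<beta> < 1" "0 < T"
  shows "integrable (lborel \<Otimes>\<^sub>M lborel) (\<lambda>z. indicator ({0<..<T} \<times> {0<..<T}) z * slob_kernel \<beta> i j z)"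
proof -
  have "slob_kernel \<beta> i j = (\<lambda>z. \<bar>fst z - snd z\<bar> powr (1 - \<beta>) *
      ((\<Sum>k<i. snd z ^ (i - Suc k) * fst z ^ k) * (\<Sum>k<j. snd z ^ (j - Suc k) * fst z ^ k)))"
    by (simp add: slob_kernel_def slob_kernel_eq[OF assms(1)] fun_eq_iff)
  moreover have "continuous_on ({0..T} \<times> {0..T}) (\<lambda>z. \<bar>fst z - snd z\<bar> powr (1 - \<beta>) *
      ((\<Sum>k<i. snd z ^ (i - Suc k) * fst z ^ k) * (\<Sum>k<j. snd z ^ (j - Suc k) * fst z ^ k)))"
    using assms by (intro continuous_on_mult continuous_on_powr' continuous_intros) auto
  ultimately have "integrable lborel (\<lambda>z. indicator ({0..T} \<times> {0..T}) z *\<^sub>R slob_kernel \<beta> i j z)"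
    by (intro borel_integrable_compact compact_Times compact_Icc) auto
  then have "set_integrable lborel ({0..T} \<times> {0..T}) (slob_kernel \<beta> i j)"
    by (simp add: set_integrable_def)
  then have "set_integrable lborel ({0<..<T} \<times> {0<..<T}) (slob_kernel \<beta> i j)"
    by (rule set_integrable_subset) (auto intro!: borel_open open_Times)
  then show ?thesis by (simp add: set_integrable_def lborel_prod)
qed

lemma set_lint_nested:
  fixes f :: "real \<times> real \<Rightarrow> real"
  assumes "integrable (lborel \<Otimes>\<^sub>M lborel) (\<lambda>z. indicator (A \<times> B) z * f z)"
  shows "(LINT t:A|lborel. LINT s:B|lborel. f (t, s)) = (LINT z|(lborel \<Otimes>\<^sub>M lborel). indicator (A \<times> B) z * f z)"
proof -
  have "(LINT t:A|lborel. LINT s:B|lborel. f (t, s)) = (LINT t|lborel. LINT s|lborel. indicator (A \<times> B) (t, s) * f (t, s))"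
    by (simp add: set_lebesgue_integral_def indicator_times mult.assoc)
  also have "\<dots> = (LINT z|(lborel \<Otimes>\<^sub>M lborel). indicator (A \<times> B) z * f z)"
    by (rule lborel_pair.integral_fst'[OF assms])
  finally show ?thesis .
qed

text \<open>The coefficients \<open>m i j\<close> are arbitrary because two cases occur: products
  \<open>c i * c j\<close> of reals and inner products
  \<open>ip \<Omega> (d i) (d j)\<close>.\<close>

lemma slob_form_bilinear:
  assumes "\<beta> < 1" "0 < T"
  shows "(LINT t:{0<..<T}|lborel. LINT s:{0<..<T}|lborel.
      (\<Sum>i<n. \<Sum>j<n. m i j * ((t ^ i - s ^ i) * (t ^ j - s ^ j) / \<bar>t - s\<bar> powr (1 + \<beta>))))
    = (\<Sum>i<n. \<Sum>j<n. m i j * slob_form T \<beta> i j)"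
proof -
  let ?S = "{0<..<T} \<times> {0<..<T}"
  note int = slob_kernel_integrable[OF assms]
  have dist: "indicator ?S z * (\<Sum>i<n. \<Sum>j<n. m i j * slob_kernel \<beta> i j z)
      = (\<Sum>i<n. \<Sum>j<n. m i j * (indicator ?S z * slob_kernel \<beta> i j z))" for z
    by (simp add: sum_distrib_left mult_ac)
  have int2: "integrable (lborel \<Otimes>\<^sub>M lborel) (\<lambda>z. indicator ?S z * (\<Sum>i<n. \<Sum>j<n. m i j * slob_kernel \<beta> i j z))"
    unfolding dist by (intro Bochner_Integration.integrable_sum integrable_mult_right int)
  have sl: "slob_form T \<beta> i j = (LINT z|(lborel \<Otimes>\<^sub>M lborel). indicator ?S z * slob_kernel \<beta> i j z)" for i j
    using set_lint_nested[OF int, of i j] by (simp add: slob_form_def slob_kernel_def)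
  have "(LINT t:{0<..<T}|lborel. LINT s:{0<..<T}|lborel. (\<Sum>i<n. \<Sum>j<n. m i j * slob_kernel \<beta> i j (t, s)))
      = (LINT z|(lborel \<Otimes>\<^sub>M lborel). (\<Sum>i<n. \<Sum>j<n. m i j * (indicator ?S z * slob_kernel \<beta> i j z)))"
    using set_lint_nested[OF int2] unfolding dist by simp
  also have "\<dots> = (\<Sum>i<n. \<Sum>j<n. m i j * slob_form T \<beta> i j)"
    unfolding sl by (subst Bochner_Integration.integral_sum, intro Bochner_Integration.integrable_sum integrable_mult_right int,
      intro sum.cong refl, subst Bochner_Integration.integral_sum, intro integrable_mult_right int, simp)
  finally show ?thesis by (simp add: slob_kernel_def)
qed

lemma double_square_expand:
  fixes t s d :: real
  shows "((\<Sum>i<n. c i * t ^ i) - (\<Sum>i<n. c i * s ^ i))\<^sup>2 / d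
    = (\<Sum>i<n. \<Sum>j<n. (c i * c j) * ((t ^ i - s ^ i) * (t ^ j - s ^ j) / d))"
proof -
  have "(\<Sum>i<n. c i * t ^ i) - (\<Sum>i<n. c i * s ^ i) = (\<Sum>i<n. c i * (t ^ i - s ^ i))"
    by (simp add: sum_subtractf right_diff_distrib)
  then show ?thesis
    by (simp add: power2_eq_square sum_product sum_divide_distrib mult_ac)
qed

text \<open>Marchaud's formula sees only \<open>s < t\<close>. The kernel is symmetric and vanishes
  on the diagonal, so the integral over the square is twice the one over the triangle.\<close>

lemma slob_form_poly:
  assumes "\<beta> < 1" "0 < T" and p: "\<And>s. p s = (\<Sum>i<n. c i * s ^ i)"
  shows "(\<Sum>i<n. \<Sum>j<n. c i * c j * slob_form T \<beta> i j)
    = 2 * (LINT t:{0<..<T}|lborel. LINT s:{0<..<t}|lborel. (p t - p s)\<^sup>2 * (t - s) powr (- 1 - \<beta>))"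
proof -
  let ?S = "{0<..<T} \<times> {0<..<T}"
  define k where "k z = (p (fst z) - p (snd z))\<^sup>2 / \<bar>fst z - snd z\<bar> powr (1 + \<beta>)" for z
  define F where "F z = indicator ?S z * k z" for z
  have k: "k z = (\<Sum>i<n. \<Sum>j<n. (c i * c j) * slob_kernel \<beta> i j z)" for z
    unfolding k_def p double_square_expand slob_kernel_def ..
  have F_int: "integrable (lborel \<Otimes>\<^sub>M lborel) F"
  proof -
    have "F = (\<lambda>z. \<Sum>i<n. \<Sum>j<n. (c i * c j) * (indicator ?S z * slob_kernel \<beta> i j z))"
      by (simp add: F_def k fun_eq_iff sum_distrib_left mult_ac)
    then show ?thesis
      by (simp only:) (intro Bochner_Integration.integrable_sum integrable_mult_right slob_kernel_integrable assms(1,2))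
  qed
  define L where "L = {z :: real \<times> real. snd z < fst z}"
  define R where "R = {z :: real \<times> real. fst z < snd z}"
  have LR: "open L" "open R" unfolding L_def R_def by (intro open_Collect_less continuous_intros)+
  have sets: "L \<in> sets (lborel \<Otimes>\<^sub>M lborel)" "R \<in> sets (lborel \<Otimes>\<^sub>M lborel)"
    unfolding lborel_prod using LR by simp_all
  have FL: "integrable (lborel \<Otimes>\<^sub>M lborel) (\<lambda>z. F z * indicator L z)"
    and FR: "integrable (lborel \<Otimes>\<^sub>M lborel) (\<lambda>z. F z * indicator R z)"
    using F_int sets by (auto intro: integrable_real_mult_indicator)
  have split: "F z = F z * indicator L z + F z * indicator R z" for z
  proof (cases "fst z = snd z")
    case True
    then show ?thesis by (simp add: F_def k_def)
  next
    case False
    then show ?thesis by (auto simp: L_def R_def indicator_def)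
  qed
  have "(\<Sum>i<n. \<Sum>j<n. c i * c j * slob_form T \<beta> i j)
      = (LINT t:{0<..<T}|lborel. LINT s:{0<..<T}|lborel. k (t, s))"
    unfolding slob_form_bilinear[OF assms(1,2), symmetric] k slob_kernel_def by simp
  also have "\<dots> = (LINT z|(lborel \<Otimes>\<^sub>M lborel). F z)"
    unfolding F_def by (rule set_lint_nested[OF F_int[unfolded F_def[abs_def]]])
  also have "\<dots> = (LINT z|(lborel \<Otimes>\<^sub>M lborel). F z * indicator L z) + (LINT z|(lborel \<Otimes>\<^sub>M lborel). F z * indicator R z)"
    by (subst Bochner_Integration.integral_add[OF FL FR, symmetric]) (simp flip: split)
  also have "(LINT z|(lborel \<Otimes>\<^sub>M lborel). F z * indicator R z) = (LINT s|lborel. LINT t|lborel. F (t, s) * indicator R (t, s))"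
    using lborel_pair.integral_snd[of "\<lambda>t s. F (t, s) * indicator R (t, s)"] FR by (simp add: split_beta')
  \<comment> \<open>Only the names of the variables change: by symmetry of \<open>k\<close> one
    triangle becomes the other.\<close>
  also have "\<dots> = (LINT t|lborel. LINT s|lborel. F (t, s) * indicator L (t, s))"
    by (intro Bochner_Integration.integral_cong refl)
      (auto simp: F_def k_def L_def R_def indicator_def abs_minus_commute power2_commute)
  also have "(LINT z|(lborel \<Otimes>\<^sub>M lborel). F z * indicator L z) = (LINT t|lborel. LINT s|lborel. F (t, s) * indicator L (t, s))"
    using lborel_pair.integral_fst'[OF FL] by simp
  also have "(LINT t|lborel. LINT s|lborel. F (t, s) * indicator L (t, s))
      = (LINT t:{0<..<T}|lborel. LINT s:{0<..<t}|lborel. (p t - p s)\<^sup>2 * (t - s) powr (- 1 - \<beta>))"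
    unfolding set_lebesgue_integral_def integral_scaleR_right[symmetric]
  proof (intro Bochner_Integration.integral_cong refl)
    fix t s :: real
    have "\<bar>t - s\<bar> powr (1 + \<beta>) = inverse ((t - s) powr (- 1 - \<beta>))" if "s < t"
      using that powr_minus[of "t - s" "1 + \<beta>"] by (simp add: algebra_simps)
    then show "F (t, s) * indicator L (t, s)
        = indicator {0<..<T} t *\<^sub>R indicator {0<..<t} s *\<^sub>R ((p t - p s)\<^sup>2 * (t - s) powr (- 1 - \<beta>))"
      by (auto simp: F_def k_def L_def indicator_def divide_inverse)
  qed
  finally show ?thesis by simp
qed

text \<open>The identity \<open>(a - b) a = ((a - b)\<^sup>2 + a\<^sup>2 - b\<^sup>2) / 2\<close> in Marchaud's formula turns \<open>p D\<^sup>\<beta> p\<close> into a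
  Slobodeckij density plus \<open>D\<^sup>\<beta> (p\<^sup>2) / 2\<close>, whose integral is nonnegative.\<close>
lemma frac_form_coercive:
  assumes \<alpha>: "0 < \<alpha>" "\<alpha> < 1 / 2" and T: "0 < T" and \<beta>: "\<beta> = 2 * \<alpha>"
  shows "(\<Sum>i<n. \<Sum>j<n. c i * c j * weight_form T \<beta> i j) / 2
      + \<beta> / 4 * (\<Sum>i<n. \<Sum>j<n. c i * c j * slob_form T \<beta> i j)
    \<le> Gamma (1 - \<beta>) * (\<Sum>i<n. \<Sum>j<n. c i * c j * frac_form T \<alpha> i j)"
proof -
  define p where "p t = (\<Sum>i<n. c i * t ^ i)" for t
  let ?J = "{..<n} \<times> {..<n}"
  define d where "d z = c (fst z) * c (snd z)" for z
  define e where "e z = fst z + snd z" for z :: "nat \<times> nat"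
  have b: "0 < \<beta>" "\<beta> < 1" using \<alpha> \<beta> by auto
  \<comment> \<open>The square of \<open>p\<close> as a polynomial indexed by pairs of degrees, so
    that Marchaud's formula and \<open>rl_mono_integral_nonneg\<close> apply to it directly.\<close>
  have q: "(p t)\<^sup>2 = (\<Sum>z\<in>?J. d z * t ^ e z)" for t
    by (simp add: p_def d_def e_def power2_eq_square sum_product sum.cartesian_product split_beta power_add mult_ac)
  let ?G = "\<lambda>t. Gamma (1 - \<beta>) * (\<Sum>i<n. c i * rl_mono \<beta> i t)"
  let ?H = "\<lambda>t. Gamma (1 - \<beta>) * (\<Sum>z\<in>?J. d z * rl_mono \<beta> (e z) t)"
  let ?S = "\<lambda>t. LINT s:{0<..<t}|lborel. (p t - p s)\<^sup>2 * (t - s) powr (- 1 - \<beta>)"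
  have pt: "\<beta> * ?S t = 2 * (p t * ?G t) - ?H t - (p t)\<^sup>2 * t powr (- \<beta>)" if "0 < t" for t
  proof -
    note Mp = marchaud_poly[OF b that finite_lessThan[of n] p_def]
    have "finite ?J" by simp
    note Mq = marchaud_poly[OF b that this q]
    have "(p t - p s)\<^sup>2 * (t - s) powr (- 1 - \<beta>)
        = (2 * p t) * ((p t - p s) * (t - s) powr (- 1 - \<beta>)) - ((p t)\<^sup>2 - (p s)\<^sup>2) * (t - s) powr (- 1 - \<beta>)" for s
      by (simp add: algebra_simps power2_eq_square)
    then have "?S t = (2 * p t) * (LINT s:{0<..<t}|lborel. (p t - p s) * (t - s) powr (- 1 - \<beta>))
        - (LINT s:{0<..<t}|lborel. ((p t)\<^sup>2 - (p s)\<^sup>2) * (t - s) powr (- 1 - \<beta>))"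
      using Mp(1) Mq(1) by (simp add: set_integral_diff(2))
    moreover have "\<beta> * S = 2 * (P * G) - H - P\<^sup>2 * w"
      if "S = (2 * P) * I1 - I2" "G = P * w + \<beta> * I1" "H = P\<^sup>2 * w + \<beta> * I2" for S P G H w I1 I2 :: real
      unfolding that by (simp add: algebra_simps power2_eq_square)
    ultimately show ?thesis using Mp(2) Mq(2) by blast
  qed
  have eqpG: "p t * ?G t = Gamma (1 - \<beta>) * (\<Sum>i<n. \<Sum>j<n. c i * c j * (rl_mono \<beta> i t * t ^ j))" for t
    by (simp add: p_def sum_product sum_distrib_left mult_ac)
  have int1: "set_integrable lborel {0<..<T} (\<lambda>t. p t * ?G t)"
    unfolding eqpG using b T by (intro set_integrable_mult_right set_integrable_sum rl_mono_power_integrable)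
  have pG: "(LINT t:{0<..<T}|lborel. p t * ?G t) = Gamma (1 - \<beta>) * (\<Sum>i<n. \<Sum>j<n. c i * c j * frac_form T \<alpha> i j)"
  proof -
    have "(LINT t:{0<..<T}|lborel. \<Sum>i<n. \<Sum>j<n. c i * c j * (rl_mono \<beta> i t * t ^ j))
        = (\<Sum>i<n. \<Sum>j<n. c i * c j * (LINT t:{0<..<T}|lborel. rl_mono \<beta> i t * t ^ j))"
      using rl_mono_power_integrable[OF b(2) T]
      by (subst set_integral_sum, intro set_integrable_sum set_integrable_mult_right, blast,
          intro sum.cong refl, subst set_integral_sum, intro set_integrable_mult_right, blast, simp)
    then show ?thesis unfolding eqpG using frac_form_eq[OF \<alpha>(2,1) T] \<beta> by simp
  qed
  have H: "set_integrable lborel {0<..<T} ?H" "0 \<le> (LINT t:{0<..<T}|lborel. ?H t)"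
    using rl_mono_integral_nonneg[OF b(2) T _ q] Gamma_real_pos[of "1 - \<beta>"] b by auto
  note W = weight_form_poly[OF b(2) T, where n = n and c = c, folded p_def]
  \<comment> \<open>Integrating \<open>pt\<close> shows that twice the fractional form is the weight
    term plus the integral of \<open>?H\<close> plus \<open>\<beta>\<close> times the triangle
    integral, which is half the Slobodeckij form. Dropping \<open>?H\<close> and halving gives the
    factors 1/2 and \<open>\<beta> / 4\<close>.\<close>
  have "\<beta> * (LINT t:{0<..<T}|lborel. ?S t) = (LINT t:{0<..<T}|lborel. 2 * (p t * ?G t) - ?H t - (p t)\<^sup>2 * t powr (- \<beta>))"
    unfolding set_integral_mult_right[symmetric] by (rule set_integral_cong_on) (use pt in auto)
  also have "\<dots> = 2 * (LINT t:{0<..<T}|lborel. p t * ?G t) - (LINT t:{0<..<T}|lborel. ?H t)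
      - (LINT t:{0<..<T}|lborel. (p t)\<^sup>2 * t powr (- \<beta>))"
    by (subst set_integral_diff(2)[OF set_integral_diff(1)[OF set_integrable_mult_right[OF int1] H(1)] W(1)],
        subst set_integral_diff(2)[OF set_integrable_mult_right[OF int1] H(1)]) simp
  finally show ?thesis
    using H(2) pG W(2) slob_form_poly[OF b(2) T p_def] by (simp add: field_simps)
qed

text \<open>The derivative of order \<open>\<beta>\<close> of the constant \<open>a\<close> is
  \<open>a * t powr (- \<beta>) / Gamma (1 - \<beta>)\<close>, so the left side is a weighted
  pairing of \<open>a\<close> with \<open>p\<close>. Young's inequality from the square of
  \<open>p t / 2 - a\<close> spends only half of the weight term in
  \<open>frac_form_coercive\<close>; \<open>T powr (1 - \<beta>) / (1 - \<beta>)\<close> is the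
  integral of the weight.\<close>

lemma frac_form_0_bound:
  assumes \<alpha>: "0 < \<alpha>" "\<alpha> < 1 / 2" and T: "0 < T" and \<beta>: "\<beta> = 2 * \<alpha>"
  shows "Gamma (1 - \<beta>) * (a * (\<Sum>j<n. c j * frac_form T \<alpha> 0 j))
    \<le> (\<Sum>i<n. \<Sum>j<n. c i * c j * weight_form T \<beta> i j) / 4 + T powr (1 - \<beta>) / (1 - \<beta>) * a\<^sup>2"
proof -
  define p where "p t = (\<Sum>i<n. c i * t ^ i)" for t
  have b: "0 < \<beta>" "\<beta> < 1" using \<alpha> \<beta> by auto
  have G: "0 < Gamma (1 - \<beta>)" using b by (intro Gamma_real_pos) simp
  note W = weight_form_poly[OF b(2) T, where n = n and c = c, folded p_def]
  have w0: "set_integrable lborel {0<..<T} (\<lambda>t. t powr (- \<beta>))"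
    using weight_integrable[OF b(2) T, of 0] by simp
  have w0v: "(LINT t:{0<..<T}|lborel. t powr (- \<beta>)) = T powr (1 - \<beta>) / (1 - \<beta>)"
  proof -
    have "((\<lambda>t. t powr (- \<beta>)) has_integral T powr (- \<beta> + 1) / (- \<beta> + 1)) {0..T}"
      using b T by (intro has_integral_powr_from_0) auto
    then show ?thesis
      using set_borel_integral_eq_integral(2)[OF w0] b by (simp add: has_integral_Icc_iff_Ioo integral_unique)
  qed
  have eq: "Gamma (1 - \<beta>) * (a * (\<Sum>j<n. c j * frac_form T \<alpha> 0 j)) = (LINT t:{0<..<T}|lborel. a * p t * t powr (- \<beta>))"
  proof -
    have "(LINT t:{0<..<T}|lborel. a * p t * t powr (- \<beta>)) = (LINT t:{0<..<T}|lborel. \<Sum>j<n. (Gamma (1 - \<beta>) * a * c j) * (rl_mono \<beta> 0 t * t ^ j))"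
      using G by (intro set_integral_cong_on) (simp add: p_def rl_mono_def sum_distrib_left sum_distrib_right mult_ac)
    also have "\<dots> = (\<Sum>j<n. (Gamma (1 - \<beta>) * a * c j) * (LINT t:{0<..<T}|lborel. rl_mono \<beta> 0 t * t ^ j))"
      using rl_mono_power_integrable[OF b(2) T] by (subst set_integral_sum) auto
    finally show ?thesis
      using frac_form_eq[OF \<alpha>(2,1) T] \<beta> by (simp add: sum_distrib_left mult_ac)
  qed
  have pw: "set_integrable lborel {0<..<T} (\<lambda>t. a * p t * t powr (- \<beta>))"
  proof -
    have "set_integrable lborel {0<..<T} (\<lambda>t. \<Sum>j<n. (a * c j) * (t ^ j * t powr (- \<beta>)))"
      by (intro set_integrable_sum set_integrable_mult_right weight_integrable b T)
    then show ?thesis by (simp add: p_def sum_distrib_left sum_distrib_right mult_ac)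
  qed
  have "(LINT t:{0<..<T}|lborel. a * p t * t powr (- \<beta>))
      \<le> (LINT t:{0<..<T}|lborel. (1 / 4) * ((p t)\<^sup>2 * t powr (- \<beta>)) + a\<^sup>2 * t powr (- \<beta>))"
  proof (rule set_integral_mono[OF pw])
    show "set_integrable lborel {0<..<T} (\<lambda>t. (1 / 4) * ((p t)\<^sup>2 * t powr (- \<beta>)) + a\<^sup>2 * t powr (- \<beta>))"
      by (intro set_integral_add(1) set_integrable_mult_right W w0)
    fix t
    have "0 \<le> (p t / 2 - a)\<^sup>2" by simp
    then have "a * p t \<le> (1 / 4) * (p t)\<^sup>2 + a\<^sup>2" by (simp add: power2_eq_square algebra_simps)
    from mult_right_mono[OF this, of "t powr (- \<beta>)"]
    show "a * p t * t powr (- \<beta>) \<le> (1 / 4) * ((p t)\<^sup>2 * t powr (- \<beta>)) + a\<^sup>2 * t powr (- \<beta>)"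
      by (simp add: algebra_simps)
  qed
  also have "\<dots> = (1 / 4) * (LINT t:{0<..<T}|lborel. (p t)\<^sup>2 * t powr (- \<beta>)) + a\<^sup>2 * (T powr (1 - \<beta>) / (1 - \<beta>))"
    using W(1) w0 w0v by (subst set_integral_add(2)) auto
  finally show ?thesis unfolding eq W(2) by (simp add: mult.commute)
qed

text \<open>On (0, T) the weight is at least \<open>T powr (- \<beta>)\<close>.\<close>

lemma l2_le_weight_form:
  assumes "0 < \<beta>" "\<beta> < 1" "0 < T"
  shows "(LINT t:{0<..<T}|lborel. (\<Sum>i<n. c i * t ^ i)\<^sup>2)
    \<le> T powr \<beta> * (\<Sum>i<n. \<Sum>j<n. c i * c j * weight_form T \<beta> i j)"
proof -
  note W = weight_form_poly[OF assms(2,3), where n = n and c = c]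
  have "(LINT t:{0<..<T}|lborel. (\<Sum>i<n. c i * t ^ i)\<^sup>2)
      \<le> (LINT t:{0<..<T}|lborel. T powr \<beta> * ((\<Sum>i<n. c i * t ^ i)\<^sup>2 * t powr (- \<beta>)))"
  proof (rule set_integral_mono)
    have "set_integrable lborel {0..T} (\<lambda>t. (\<Sum>i<n. c i * t ^ i)\<^sup>2)"
      by (intro borel_integrable_atLeastAtMost' continuous_intros)
    then show "set_integrable lborel {0<..<T} (\<lambda>t. (\<Sum>i<n. c i * t ^ i)\<^sup>2)"
      by (rule set_integrable_subset) auto
    show "set_integrable lborel {0<..<T} (\<lambda>t. T powr \<beta> * ((\<Sum>i<n. c i * t ^ i)\<^sup>2 * t powr (- \<beta>)))"
      by (intro set_integrable_mult_right W(1))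
    fix t assume t: "t \<in> {0<..<T}"
    then have "t powr \<beta> \<le> T powr \<beta>" using assms by (intro powr_mono2) auto
    then have "1 \<le> T powr \<beta> * t powr (- \<beta>)" using t by (simp add: powr_minus field_simps)
    from mult_left_mono[OF this, of "(\<Sum>i<n. c i * t ^ i)\<^sup>2"]
    show "(\<Sum>i<n. c i * t ^ i)\<^sup>2 \<le> T powr \<beta> * ((\<Sum>i<n. c i * t ^ i)\<^sup>2 * t powr (- \<beta>))"
      by (simp add: mult_ac)
  qed
  then show ?thesis by (simp add: W(2))
qed

section \<open>The discrete problem\<close>

lemma ip_sum_left:
  assumes "finite I" "\<And>i. i \<in> I \<Longrightarrow> L2 \<Omega> (w i)" "L2 \<Omega> v"
  shows "ip \<Omega> (\<lambda>x. \<Sum>i\<in>I. c i * w i x) v = (\<Sum>i\<in>I. c i * ip \<Omega> (w i) v)"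
proof -
  have "ip \<Omega> (\<lambda>x. \<Sum>i\<in>I. c i * w i x) v = (LINT x:\<Omega>|lebesgue. \<Sum>i\<in>I. c i * (w i x * v x))"
    by (simp add: ip_def sum_distrib_right mult.assoc)
  also have "\<dots> = (\<Sum>i\<in>I. c i * ip \<Omega> (w i) v)"
    unfolding ip_def using assms
    by (subst set_integral_sum) (auto intro!: set_integrable_mult_right L2_times simp del: set_integrable_mult_right_iff)
  finally show ?thesis .
qed

lemma ip_sum_right:
  assumes "finite I" "\<And>i. i \<in> I \<Longrightarrow> L2 \<Omega> (w i)" "L2 \<Omega> v"
  shows "ip \<Omega> v (\<lambda>x. \<Sum>i\<in>I. c i * w i x) = (\<Sum>i\<in>I. c i * ip \<Omega> v (w i))"
  unfolding ip_sym[of \<Omega> v] by (rule ip_sum_left[OF assms])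

text \<open>The passage to functions of \<open>x\<close>: a quadratic form at the values
  \<open>d i x\<close>, integrated over \<open>\<Omega>\<close>, is the same form with products
  replaced by inner products.\<close>

lemma quadratic_form_integral:
  assumes "\<And>i. i < n \<Longrightarrow> L2 \<Omega> (d i)"
  shows "set_integrable lebesgue \<Omega> (\<lambda>x. \<Sum>i<n. \<Sum>j<n. d i x * d j x * m i j)"
    and "(LINT x:\<Omega>|lebesgue. \<Sum>i<n. \<Sum>j<n. d i x * d j x * m i j) = (\<Sum>i<n. \<Sum>j<n. ip \<Omega> (d i) (d j) * m i j)"
proof -
  have int: "set_integrable lebesgue \<Omega> (\<lambda>x. d i x * d j x * m i j)" if "i < n" "j < n" for i j
    using L2_times[OF assms[OF that(1)] assms[OF that(2)]] by (intro set_integrable_mult_left)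
  then show "set_integrable lebesgue \<Omega> (\<lambda>x. \<Sum>i<n. \<Sum>j<n. d i x * d j x * m i j)"
    by (intro set_integrable_sum) auto
  have "(LINT x:\<Omega>|lebesgue. \<Sum>i<n. \<Sum>j<n. d i x * d j x * m i j) = (\<Sum>i<n. LINT x:\<Omega>|lebesgue. \<Sum>j<n. d i x * d j x * m i j)"
    using int by (intro set_integral_sum set_integrable_sum) auto
  also have "\<dots> = (\<Sum>i<n. \<Sum>j<n. LINT x:\<Omega>|lebesgue. d i x * d j x * m i j)"
    using int by (intro sum.cong refl set_integral_sum) auto
  finally show "(LINT x:\<Omega>|lebesgue. \<Sum>i<n. \<Sum>j<n. d i x * d j x * m i j) = (\<Sum>i<n. \<Sum>j<n. ip \<Omega> (d i) (d j) * m i j)"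
    by (simp add: ip_def)
qed

lemma L2norm_combination:
  assumes "\<And>i. i < n \<Longrightarrow> L2 \<Omega> (d i)"
  shows "(L2norm \<Omega> (\<lambda>x. \<Sum>i<n. d i x * a i))\<^sup>2 = (\<Sum>i<n. \<Sum>j<n. ip \<Omega> (d i) (d j) * (a i * a j))"
proof -
  have "(L2norm \<Omega> (\<lambda>x. \<Sum>i<n. d i x * a i))\<^sup>2 = (LINT x:\<Omega>|lebesgue. \<Sum>i<n. \<Sum>j<n. d i x * d j x * (a i * a j))"
    unfolding L2norm_power2 by (simp add: power2_eq_square sum_product mult_ac)
  also have "\<dots> = (\<Sum>i<n. \<Sum>j<n. ip \<Omega> (d i) (d j) * (a i * a j))"
    by (rule quadratic_form_integral(2)) (rule assms)
  finally show ?thesis .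
qed

definition gram :: "real \<Rightarrow> nat \<Rightarrow> nat \<Rightarrow> real" where
  "gram T i j = (LINT t:{0<..<T}|lborel. t ^ i * t ^ j)"

lemma set_integrable_continuous_Ioo:
  fixes f :: "real \<Rightarrow> real"
  assumes "continuous_on {a..b} f"
  shows "set_integrable lborel {a<..<b} f"
  using borel_integrable_atLeastAtMost'[OF assms] by (rule set_integrable_subset) auto

lemma gram_bilinear:
  "(LINT t:{0<..<T}|lborel. \<Sum>i\<in>I. \<Sum>j\<in>J. m i j * (t ^ i * t ^ j)) = (\<Sum>i\<in>I. \<Sum>j\<in>J. m i j * gram T i j)"
proof -
  have int: "set_integrable lborel {0<..<T} (\<lambda>t. m i j * (t ^ i * t ^ j))" for i j
    by (intro set_integrable_continuous_Ioo continuous_intros)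
  have "(LINT t:{0<..<T}|lborel. \<Sum>i\<in>I. \<Sum>j\<in>J. m i j * (t ^ i * t ^ j))
      = (\<Sum>i\<in>I. LINT t:{0<..<T}|lborel. \<Sum>j\<in>J. m i j * (t ^ i * t ^ j))"
    by (intro set_integral_sum set_integrable_sum int)
  also have "\<dots> = (\<Sum>i\<in>I. \<Sum>j\<in>J. LINT t:{0<..<T}|lborel. m i j * (t ^ i * t ^ j))"
    by (intro sum.cong refl set_integral_sum int)
  finally show ?thesis by (simp add: gram_def)
qed

lemma gram_eq: "0 \<le> T \<Longrightarrow> gram T i j = T ^ (i + j + 1) / real (i + j + 1)"
proof -
  assume "0 \<le> T"
  from integral_power[OF this, of "i + j"]
  have "(LINT t:{0..T}|lborel. t ^ i * t ^ j) = T ^ (i + j + 1) / real (i + j + 1)"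
    by (simp add: set_lebesgue_integral_def power_add mult_ac)
  then show ?thesis by (simp add: gram_def set_integral_Icc_eq_Ioo)
qed

lemma gram_poly: "(LINT t:{0<..<T}|lborel. (\<Sum>i<n. c i * t ^ i)\<^sup>2) = (\<Sum>i<n. \<Sum>j<n. c i * c j * gram T i j)"
proof -
  have "(\<Sum>i<n. c i * t ^ i)\<^sup>2 = (\<Sum>i<n. \<Sum>j<n. (c i * c j) * (t ^ i * t ^ j))" for t
    by (simp add: power2_eq_square sum_product mult_ac)
  then show ?thesis by (simp add: gram_bilinear)
qed

lemma time_L2norm:
  assumes "\<And>i. i < n \<Longrightarrow> L2 \<Omega> (d i)"
  shows "(LINT t:{0<..<T}|lborel. (L2norm \<Omega> (\<lambda>x. \<Sum>i<n. d i x * t ^ i))\<^sup>2) = (\<Sum>i<n. \<Sum>j<n. ip \<Omega> (d i) (d j) * gram T i j)"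
proof -
  have "(L2norm \<Omega> (\<lambda>x. \<Sum>i<n. d i x * t ^ i))\<^sup>2 = (\<Sum>i<n. \<Sum>j<n. ip \<Omega> (d i) (d j) * (t ^ i * t ^ j))" for t
    by (rule L2norm_combination) (rule assms)
  then show ?thesis by (simp only: gram_bilinear)
qed

lemma time_slobodeckij:
  assumes "\<And>i. i < n \<Longrightarrow> L2 \<Omega> (d i)" "\<beta> < 1" "0 < T"
  shows "(LINT t:{0<..<T}|lborel. LINT s:{0<..<T}|lborel.
      (L2norm \<Omega> (\<lambda>x. (\<Sum>i<n. d i x * t ^ i) - (\<Sum>i<n. d i x * s ^ i)))\<^sup>2 / \<bar>t - s\<bar> powr (1 + \<beta>))
    = (\<Sum>i<n. \<Sum>j<n. ip \<Omega> (d i) (d j) * slob_form T \<beta> i j)"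
proof -
  have "(L2norm \<Omega> (\<lambda>x. (\<Sum>i<n. d i x * t ^ i) - (\<Sum>i<n. d i x * s ^ i)))\<^sup>2 / r
      = (\<Sum>i<n. \<Sum>j<n. ip \<Omega> (d i) (d j) * ((t ^ i - s ^ i) * (t ^ j - s ^ j) / r))" for t s r
  proof -
    have "(\<lambda>x. (\<Sum>i<n. d i x * t ^ i) - (\<Sum>i<n. d i x * s ^ i)) = (\<lambda>x. \<Sum>i<n. d i x * (t ^ i - s ^ i))"
      by (simp add: right_diff_distrib sum_subtractf)
    then show ?thesis
      by (simp add: L2norm_combination[OF assms(1)] sum_divide_distrib)
  qed
  then show ?thesis by (simp only:) (rule slob_form_bilinear[OF assms(2,3)])
qed

text \<open>The variance of \<open>p\<close> over \<open>(0, t)\<close> is nonnegative.\<close>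
lemma primitive_square_le:
  assumes "0 \<le> t" "t \<le> T"
  shows "(\<Sum>i<n. c i * (t ^ (i + 1) / real (i + 1)))\<^sup>2 \<le> T * (\<Sum>i<n. \<Sum>j<n. c i * c j * gram T i j)"
proof -
  define p where "p t = (\<Sum>i<n. c i * t ^ i)" for t
  \<comment> \<open>\<open>I\<close> is the primitive of \<open>p\<close> at \<open>t\<close>; if
    \<open>c\<close> lists the coefficients of a derivative, it is the increment from time 0 to
    \<open>t\<close>.\<close>
  define I where "I = (\<Sum>i<n. c i * (t ^ (i + 1) / real (i + 1)))"
  define Q where "Q r = (LINT s:{0<..<r}|lborel. (p s)\<^sup>2)" for r
  have int: "set_integrable lborel {0<..<r} (\<lambda>s. p s)" "set_integrable lborel {0<..<r} (\<lambda>s. (p s)\<^sup>2)" for r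
    unfolding p_def by (intro set_integrable_continuous_Ioo continuous_intros)+
  have QT: "Q T = (\<Sum>i<n. \<Sum>j<n. c i * c j * gram T i j)"
    unfolding Q_def p_def by (rule gram_poly)
  have Q0: "0 \<le> Q r" for r unfolding Q_def by (rule set_integral_nonneg_real) simp
  have "Q t \<le> Q T"
  proof -
    have "Q t = (LINT s|lborel. indicator {0<..<t} s * (p s)\<^sup>2)" by (simp add: Q_def set_lebesgue_integral_def)
    also have "\<dots> \<le> (LINT s|lborel. indicator {0<..<T} s * (p s)\<^sup>2)"
      using int(2)[of t] int(2)[of T] assms
      by (intro integral_mono) (auto simp: set_integrable_def indicator_def)
    finally show ?thesis by (simp add: Q_def set_lebesgue_integral_def)
  qed
  have pI: "(LINT s:{0<..<t}|lborel. p s) = I"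
  proof -
    have "(LINT s:{0<..<t}|lborel. p s) = (LINT s:{0<..<t}|lborel. \<Sum>i<n. \<Sum>j\<in>{0}. c i * (s ^ i * s ^ j))"
      by (simp add: p_def)
    also have "\<dots> = I" unfolding gram_bilinear using assms(1) by (simp add: gram_eq I_def)
    finally show ?thesis .
  qed
  have "I\<^sup>2 \<le> t * Q t"
  proof (cases "t = 0")
    case False
    then have t: "0 < t" using assms by simp
    have c: "set_integrable lborel {0<..<t} (\<lambda>s. (I / t)\<^sup>2)" by (intro set_integrable_continuous_Ioo continuous_intros)
    have "0 \<le> (LINT s:{0<..<t}|lborel. (p s - I / t)\<^sup>2)" by (rule set_integral_nonneg_real) simp
    also have "\<dots> = (LINT s:{0<..<t}|lborel. (p s)\<^sup>2 - (2 * (I / t)) * p s + (I / t)\<^sup>2)"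
      by (simp add: power2_diff algebra_simps)
    also have "\<dots> = Q t - (2 * (I / t)) * I + t * (I / t)\<^sup>2"
      using t by (subst set_integral_add(2)[OF set_integral_diff(1)[OF int(2) set_integrable_mult_right[OF int(1)]] c],
          subst set_integral_diff(2)[OF int(2) set_integrable_mult_right[OF int(1)]])
        (simp add: Q_def pI set_integral_const)
    also have "\<dots> = Q t - I\<^sup>2 / t" using t by (simp add: power2_eq_square field_simps)
    finally show ?thesis using t by (simp add: field_simps)
  qed (use assms in \<open>simp add: I_def\<close>)
  also have "\<dots> \<le> T * Q T" using \<open>Q t \<le> Q T\<close> assms Q0 by (intro mult_mono) auto
  finally show ?thesis unfolding I_def QT .
qed

lemma sqrt_add_le:
  fixes a b :: real
  assumes "0 \<le> a" "0 \<le> b"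
  shows "sqrt a + sqrt b \<le> sqrt (2 * (a + b))"
proof (rule real_le_rsqrt)
  show "(sqrt a + sqrt b)\<^sup>2 \<le> 2 * (a + b)"
    using zero_le_power2[of "sqrt a - sqrt b"] assms by (simp add: power2_diff power2_sum)
qed

lemma atMost_pred_eq_lessThan: "1 \<le> M \<Longrightarrow> {..M - 1} = {..<M::nat}"
  by auto

section \<open>The discrete problem in coefficients\<close>

definition load :: "real \<Rightarrow> (real^'n) set \<Rightarrow> (real \<Rightarrow> real^'n \<Rightarrow> real) \<Rightarrow> nat \<Rightarrow> (real^'n \<Rightarrow> real) \<Rightarrow> real" where
  "load T \<Omega> f j v = (LINT z:({0<..<T} \<times> \<Omega>)|lebesgue. f (fst z) (snd z) * (fst z ^ j * v (snd z)))"

text \<open>The coefficient form of the discrete problem: \<open>w\<close> lists the coefficients of \<open>U\<close>, and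
  \<open>dcoeff w\<close> those of \<open>U'\<close>.\<close>
definition dcoeff :: "(nat \<Rightarrow> 'a \<Rightarrow> real) \<Rightarrow> nat \<Rightarrow> 'a \<Rightarrow> real" where
  "dcoeff w i x = real (Suc i) * w (Suc i) x"

text \<open>\<open>uh\<close> is constant in time, that is a multiple of the power of degree 0, and
  hence meets row 0 of \<open>frac_form\<close>.\<close>

definition coeff_form :: "real \<Rightarrow> real \<Rightarrow> (real^'n) set \<Rightarrow> nat \<Rightarrow> (real^'n \<Rightarrow> real) \<Rightarrow>
    (nat \<Rightarrow> real^'n \<Rightarrow> real) \<Rightarrow> (nat \<Rightarrow> real^'n \<Rightarrow> real) \<Rightarrow> real" where
  "coeff_form T \<alpha> \<Omega> M uh w v =
     (\<Sum>i<M. \<Sum>j<M. ip \<Omega> (dcoeff w i) (v j) * frac_form T \<alpha> i j)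
     - (\<Sum>j<M. ip \<Omega> uh (v j) * frac_form T \<alpha> 0 j)
     + (\<Sum>i\<le>M. \<Sum>j<M. dirichlet \<Omega> (w i) (v j) * gram T i j)"

lemma dt_tensor:
  assumes "\<And>t x. U t x = (\<Sum>i\<le>M. t ^ i * w i x)"
  shows "dt U t x = (\<Sum>i<M. dcoeff w i x * t ^ i)"
proof -
  have "((\<lambda>t. U t x) has_real_derivative (\<Sum>i\<le>M. real i * t ^ (i - 1) * w i x)) (at t)"
    unfolding assms by (auto intro!: derivative_eq_intros sum.cong)
  then have "dt U t x = (\<Sum>i\<le>M. real i * t ^ (i - 1) * w i x)"
    unfolding dt_def by (rule DERIV_imp_deriv)
  also have "\<dots> = (\<Sum>i<M. dcoeff w i x * t ^ i)"
    unfolding lessThan_Suc_atMost[symmetric] sum.lessThan_Suc_shift by (simp add: dcoeff_def mult_ac)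
  finally show ?thesis .
qed

context
  fixes \<Omega> :: "(real^'n) set" and Th :: "(real^'n) set set" and m :: nat
    and T \<alpha> :: real and M :: nat
  assumes opn: "open \<Omega>" and bdd: "bounded \<Omega>" and tri: "triangulation \<Omega> Th"
    and T: "0 < T" and \<alpha>: "0 < \<alpha>" "\<alpha> < 1 / 2" and M: "1 \<le> M"
begin

lemma dcoeff_Vh0:
  "(\<And>i. i \<le> M \<Longrightarrow> Vh0 \<Omega> Th m (w i)) \<Longrightarrow> i < M \<Longrightarrow> Vh0 \<Omega> Th m (dcoeff w i)"
  using Vh0_lin[OF opn bdd tri, of m "w (Suc i)" "\<lambda>x. 0" "real (Suc i)" 0] Vh0_zero[OF opn bdd tri]
  by (simp add: dcoeff_def[abs_def])

lemmas VhL2 = Vh_L2[OF opn bdd tri] and Vh0L2 = Vh0_L2[OF opn bdd tri] and Vh0H1 = Vh0_H1[OF opn bdd tri]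

lemma fractional_term:
  assumes U: "\<And>t x. U t x = (\<Sum>i\<le>M. t ^ i * w i x)" and V: "\<And>t x. V t x = (\<Sum>j<M. t ^ j * v j x)"
    and w: "\<And>i. i \<le> M \<Longrightarrow> Vh0 \<Omega> Th m (w i)" and v: "\<And>j. j < M \<Longrightarrow> Vh0 \<Omega> Th m (v j)"
    and uh: "L2 \<Omega> uh"
  shows "(LINT t:{0<..<T}|lborel. LINT x:\<Omega>|lebesgue.
      RL_D0 \<alpha> (\<lambda>s. dt U s x - uh x) t * RL_DT T \<alpha> (\<lambda>s. V s x) t)
    = (\<Sum>i<M. \<Sum>j<M. ip \<Omega> (dcoeff w i) (v j) * frac_form T \<alpha> i j) - (\<Sum>j<M. ip \<Omega> uh (v j) * frac_form T \<alpha> 0 j)"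
proof -
  have a1: "\<alpha> < 1" using \<alpha> by simp
  let ?D = "rl_mono \<alpha>" and ?DT = "rl_monoT T \<alpha>"
  have D0: "RL_D0 \<alpha> (\<lambda>s. dt U s x - uh x) t = (\<Sum>i<M. dcoeff w i x * ?D i t) - uh x * ?D 0 t" if "0 < t" for t x
  proof -
    \<comment> \<open>\<open>- uh x\<close> is appended as term number \<open>M\<close> with
      exponent 0, so that a single polynomial is differentiated.\<close>
    let ?c = "\<lambda>i. if i < M then dcoeff w i x else - uh x" and ?e = "\<lambda>i. if i < M then i else 0"
    have "dt U s x - uh x = (\<Sum>i<Suc M. ?c i * s ^ ?e i)" for s
      by (simp add: dt_tensor[OF U])
    then have "RL_D0 \<alpha> (\<lambda>s. dt U s x - uh x) t = (\<Sum>i<Suc M. ?c i * ?D (?e i) t)"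
      by (simp only:) (rule RL_D0_poly[OF finite_lessThan \<alpha>(1) a1 that])
    then show ?thesis by simp
  qed
  have DT: "RL_DT T \<alpha> (\<lambda>s. V s x) t = (\<Sum>j<M. v j x * ?DT j t)" if "t < T" for t x
    unfolding V using RL_DT_poly'[OF \<alpha>(1) a1 that, of "\<lambda>j. v j x" M] by (simp add: mult.commute)
  have d: "\<And>i. i < M \<Longrightarrow> L2 \<Omega> (dcoeff w i)" by (rule Vh0L2[OF dcoeff_Vh0]) (use w in auto)
  have vL: "\<And>j. j < M \<Longrightarrow> L2 \<Omega> (v j)" using Vh0L2[OF v] by blast
  have inner: "(LINT x:\<Omega>|lebesgue. RL_D0 \<alpha> (\<lambda>s. dt U s x - uh x) t * RL_DT T \<alpha> (\<lambda>s. V s x) t)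
      = (\<Sum>i<M. \<Sum>j<M. ip \<Omega> (dcoeff w i) (v j) * (?D i t * ?DT j t)) - (\<Sum>j<M. ip \<Omega> uh (v j) * (?D 0 t * ?DT j t))"
    if t: "t \<in> {0<..<T}" for t
  proof -
    have eq: "RL_D0 \<alpha> (\<lambda>s. dt U s x - uh x) t * RL_DT T \<alpha> (\<lambda>s. V s x) t
        = (\<Sum>i<M. ?D i t * dcoeff w i x) * (\<Sum>j<M. ?DT j t * v j x) - ?D 0 t * (uh x * (\<Sum>j<M. ?DT j t * v j x))" for x
    proof -
      have "0 < t" "t < T" using t by auto
      then show ?thesis unfolding D0[OF \<open>0 < t\<close>] DT[OF \<open>t < T\<close>] by (simp add: left_diff_distrib right_diff_distrib mult_ac)
    qed
    have L: "L2 \<Omega> (\<lambda>x. \<Sum>i<M. ?D i t * dcoeff w i x)" "L2 \<Omega> (\<lambda>x. \<Sum>j<M. ?DT j t * v j x)"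
      using d vL by (auto intro!: L2_sum)
    have "(LINT x:\<Omega>|lebesgue. RL_D0 \<alpha> (\<lambda>s. dt U s x - uh x) t * RL_DT T \<alpha> (\<lambda>s. V s x) t)
        = ip \<Omega> (\<lambda>x. \<Sum>i<M. ?D i t * dcoeff w i x) (\<lambda>x. \<Sum>j<M. ?DT j t * v j x)
          - ?D 0 t * ip \<Omega> uh (\<lambda>x. \<Sum>j<M. ?DT j t * v j x)"
      unfolding eq ip_def
      by (subst set_integral_diff(2)[OF L2_times[OF L] set_integrable_mult_right[OF L2_times[OF uh L(2)]]]) simp
    also have "ip \<Omega> uh (\<lambda>x. \<Sum>j<M. ?DT j t * v j x) = (\<Sum>j<M. ?DT j t * ip \<Omega> uh (v j))"
      by (rule ip_sum_right) (use vL uh in auto)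
    also have "ip \<Omega> (\<lambda>x. \<Sum>i<M. ?D i t * dcoeff w i x) (\<lambda>x. \<Sum>j<M. ?DT j t * v j x)
        = (\<Sum>i<M. ?D i t * (\<Sum>j<M. ?DT j t * ip \<Omega> (dcoeff w i) (v j)))"
      by (subst ip_sum_left[OF finite_lessThan _ L(2)], use d in simp, intro sum.cong refl,
          subst ip_sum_right) (use d vL in auto)
    finally show ?thesis by (simp add: sum_distrib_left mult_ac)
  qed
  have int: "set_integrable lborel {0<..<T} (\<lambda>t. r * (?D i t * ?DT j t))" for r i j
    by (intro set_integrable_mult_right frac_form_integrable a1 T)
  have "(LINT t:{0<..<T}|lborel. LINT x:\<Omega>|lebesgue. RL_D0 \<alpha> (\<lambda>s. dt U s x - uh x) t * RL_DT T \<alpha> (\<lambda>s. V s x) t)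
      = (LINT t:{0<..<T}|lborel. (\<Sum>i<M. \<Sum>j<M. ip \<Omega> (dcoeff w i) (v j) * (?D i t * ?DT j t)) - (\<Sum>j<M. ip \<Omega> uh (v j) * (?D 0 t * ?DT j t)))"
    by (rule set_integral_cong_on) (rule inner)
  also have "\<dots> = (LINT t:{0<..<T}|lborel. \<Sum>i<M. \<Sum>j<M. ip \<Omega> (dcoeff w i) (v j) * (?D i t * ?DT j t))
      - (LINT t:{0<..<T}|lborel. \<Sum>j<M. ip \<Omega> uh (v j) * (?D 0 t * ?DT j t))"
    by (intro set_integral_diff(2) set_integrable_sum int)
  also have "(LINT t:{0<..<T}|lborel. \<Sum>j<M. ip \<Omega> uh (v j) * (?D 0 t * ?DT j t)) = (\<Sum>j<M. ip \<Omega> uh (v j) * frac_form T \<alpha> 0 j)"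
    unfolding frac_form_def by (subst set_integral_sum) (auto intro!: int)
  also have "(LINT t:{0<..<T}|lborel. \<Sum>i<M. \<Sum>j<M. ip \<Omega> (dcoeff w i) (v j) * (?D i t * ?DT j t))
      = (\<Sum>i<M. \<Sum>j<M. ip \<Omega> (dcoeff w i) (v j) * frac_form T \<alpha> i j)"
    unfolding frac_form_def
    by (subst set_integral_sum, intro set_integrable_sum int, intro sum.cong refl, subst set_integral_sum, intro int) simp
  finally show ?thesis .
qed

lemma gradient_term:
  assumes U: "\<And>t x. U t x = (\<Sum>i\<le>M. t ^ i * w i x)" and V: "\<And>t x. V t x = (\<Sum>j<M. t ^ j * v j x)"
    and w: "\<And>i. i \<le> M \<Longrightarrow> Vh0 \<Omega> Th m (w i)" and v: "\<And>j. j < M \<Longrightarrow> Vh0 \<Omega> Th m (v j)"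
  shows "(LINT t:{0<..<T}|lborel. LINT x:\<Omega>|lebesgue. wgrad \<Omega> (U t) x \<bullet> wgrad \<Omega> (V t) x)
    = (\<Sum>i\<le>M. \<Sum>j<M. dirichlet \<Omega> (w i) (v j) * gram T i j)"
proof -
  have w1: "\<And>i. i \<in> {..M} \<Longrightarrow> H1 \<Omega> (w i)" using Vh0H1[OF w] by simp
  have v1: "\<And>i. i \<in> {..<M} \<Longrightarrow> H1 \<Omega> (v i)" using Vh0H1[OF v] by simp
  have "dirichlet \<Omega> (U t) (V t) = (\<Sum>i\<le>M. \<Sum>j<M. dirichlet \<Omega> (w i) (v j) * (t ^ i * t ^ j))" for t
  proof -
    have "U t = (\<lambda>x. \<Sum>i\<le>M. t ^ i * w i x)" "V t = (\<lambda>x. \<Sum>j<M. t ^ j * v j x)"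
      by (auto simp: U V)
    moreover have "H1 \<Omega> (\<lambda>x. \<Sum>j<M. t ^ j * v j x)"
      using v1 by (intro H1_sum[OF opn bdd]) auto
    ultimately have "dirichlet \<Omega> (U t) (V t) = (\<Sum>i\<le>M. t ^ i * dirichlet \<Omega> (w i) (\<lambda>x. \<Sum>j<M. t ^ j * v j x))"
      using dirichlet_sum_left[OF opn bdd finite_atMost w1, where c = "\<lambda>i. t ^ i"] by simp
    also have "\<dots> = (\<Sum>i\<le>M. t ^ i * (\<Sum>j<M. t ^ j * dirichlet \<Omega> (w i) (v j)))"
      by (intro sum.cong refl arg_cong2[where f = "(*)"] dirichlet_sum_right[OF opn bdd finite_lessThan v1 w1])
    finally show ?thesis by (simp add: sum_distrib_left mult_ac)
  qed
  then show ?thesis by (simp add: gram_bilinear flip: dirichlet_def)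
qed

text \<open>Finite element functions are continuous up to the boundary, so the tensor product is
  continuous on a compact set; this secures joint Borel measurability.\<close>

lemma set_integrable_tensor:
  assumes "Vh \<Omega> Th m v"
  shows "set_integrable lborel ({0<..<T} \<times> \<Omega>) (\<lambda>z. fst z ^ j * v (snd z))"
proof -
  have "continuous_on ({0..T} \<times> closure \<Omega>) (\<lambda>z. fst z ^ j * v (snd z))"
    by (intro continuous_on_mult continuous_on_power continuous_on_fst continuous_on_id
        continuous_on_compose2[OF Vh_continuous[OF tri assms] continuous_on_snd[OF continuous_on_id]]) auto
  then have "set_integrable lborel ({0..T} \<times> closure \<Omega>) (\<lambda>z. fst z ^ j * v (snd z))"
    unfolding set_integrable_def using bdd
    by (intro borel_integrable_compact compact_Times compact_Icc) (auto simp: compact_closure)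
  then show ?thesis
    by (rule set_integrable_subset) (use opn closure_subset in \<open>auto intro!: borel_open open_Times\<close>)
qed

lemma tensor_measurable:
  assumes "Vh \<Omega> Th m v"
  shows "set_borel_measurable lebesgue ({0<..<T} \<times> \<Omega>) (\<lambda>z. fst z ^ j * v (snd z))"
  using set_integrable_tensor[OF assms, of j] unfolding set_integrable_def set_borel_measurable_def
  by (intro measurable_completion) auto

text \<open>The load is an integral against the completed measure of the product space; Fubini's
  theorem is reached through the Borel product measure.\<close>

lemma tensor_product_integral:
  assumes u: "Vh \<Omega> Th m u" and v: "Vh \<Omega> Th m v"
  shows "set_integrable lebesgue ({0<..<T} \<times> \<Omega>) (\<lambda>z. (fst z ^ i * u (snd z)) * (fst z ^ j * v (snd z)))"
    and "(LINT z:({0<..<T} \<times> \<Omega>)|lebesgue. (fst z ^ i * u (snd z)) * (fst z ^ j * v (snd z))) = ip \<Omega> u v * gram T i j"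
proof -
  let ?g = "\<lambda>z. (fst z ^ i * u (snd z)) * (fst z ^ j * v (snd z))"
  have "continuous_on ({0..T} \<times> closure \<Omega>) ?g"
    by (intro continuous_on_mult continuous_on_power continuous_on_fst continuous_on_id
        continuous_on_compose2[OF Vh_continuous[OF tri u] continuous_on_snd[OF continuous_on_id]]
        continuous_on_compose2[OF Vh_continuous[OF tri v] continuous_on_snd[OF continuous_on_id]]) auto
  then have "set_integrable lborel ({0..T} \<times> closure \<Omega>) ?g"
    unfolding set_integrable_def using bdd
    by (intro borel_integrable_compact compact_Times compact_Icc) (auto simp: compact_closure)
  then have g: "set_integrable lborel ({0<..<T} \<times> \<Omega>) ?g"
    by (rule set_integrable_subset) (use opn closure_subset in \<open>auto intro!: borel_open open_Times\<close>)
  then have gm: "(\<lambda>z. indicator ({0<..<T} \<times> \<Omega>) z *\<^sub>R ?g z) \<in> borel_measurable lborel"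
    by (auto simp: set_integrable_def)
  then show "set_integrable lebesgue ({0<..<T} \<times> \<Omega>) ?g"
    using g by (simp add: set_integrable_def integrable_completion)
  have "continuous_on \<Omega> (\<lambda>x. u x * v x)"
    using Vh_continuous[OF tri u] Vh_continuous[OF tri v] closure_subset
    by (auto intro!: continuous_on_mult intro: continuous_on_subset)
  then have "(\<lambda>x. if x \<in> \<Omega> then u x * v x else 0) \<in> borel_measurable borel"
    using opn by (intro borel_measurable_continuous_on_if) auto
  also have "(\<lambda>x. if x \<in> \<Omega> then u x * v x else 0) = (\<lambda>x. indicator \<Omega> x *\<^sub>R (u x * v x))"
    by (auto simp: indicator_def)
  finally have uvm: "(\<lambda>x. indicator \<Omega> x *\<^sub>R (u x * v x)) \<in> borel_measurable borel" .
  have "(LINT z:({0<..<T} \<times> \<Omega>)|lebesgue. ?g z) = (LINT z|lborel. indicator ({0<..<T} \<times> \<Omega>) z *\<^sub>R ?g z)"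
    unfolding set_lebesgue_integral_def by (rule integral_completion[OF gm])
  also have "\<dots> = (LINT z|(lborel \<Otimes>\<^sub>M lborel). indicator ({0<..<T} \<times> \<Omega>) z *\<^sub>R ?g z)"
    by (simp add: lborel_prod)
  also have "\<dots> = (LINT t|lborel. LINT x|lborel. indicator ({0<..<T} \<times> \<Omega>) (t, x) *\<^sub>R ?g (t, x))"
    using g by (intro lborel_pair.integral_fst'[symmetric]) (simp add: set_integrable_def lborel_prod)
  also have "\<dots> = (LINT t|lborel. LINT x|lborel. (indicator {0<..<T} t * (t ^ i * t ^ j)) * (indicator \<Omega> x *\<^sub>R (u x * v x)))"
    by (simp add: indicator_times mult_ac)
  also have "\<dots> = (LINT t|lborel. indicator {0<..<T} t * (t ^ i * t ^ j)) * (LINT x|lborel. indicator \<Omega> x *\<^sub>R (u x * v x))"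
    by (simp only: integral_mult_right_zero integral_mult_left_zero)
  also have "\<dots> = (LINT x|lborel. indicator \<Omega> x *\<^sub>R (u x * v x)) * gram T i j"
    by (simp add: gram_def set_lebesgue_integral_def)
  also have "(LINT x|lborel. indicator \<Omega> x *\<^sub>R (u x * v x)) = ip \<Omega> u v"
    unfolding ip_def set_lebesgue_integral_def using uvm by (intro integral_completion[symmetric]) simp
  finally show "(LINT z:({0<..<T} \<times> \<Omega>)|lebesgue. ?g z) = ip \<Omega> u v * gram T i j" .
qed

lemma load_integrable:
  assumes f: "L2T T \<Omega> f" and v: "Vh \<Omega> Th m v"
  shows "set_integrable lebesgue ({0<..<T} \<times> \<Omega>) (\<lambda>z. f (fst z) (snd z) * (fst z ^ j * v (snd z)))"
proof (rule set_integrable_times_of_squares[OF _ _ tensor_measurable[OF v]])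
  show "set_integrable lebesgue ({0<..<T} \<times> \<Omega>) (\<lambda>z. (fst z ^ j * v (snd z))\<^sup>2)"
    using tensor_product_integral(1)[OF v v, of j j] by (simp add: power2_eq_square)
qed (use f in \<open>auto simp: L2T_def\<close>)

lemma load_sum:
  assumes f: "L2T T \<Omega> f" and v: "\<And>j. j < M \<Longrightarrow> Vh \<Omega> Th m (v j)"
  shows "(LINT z:({0<..<T} \<times> \<Omega>)|lebesgue. f (fst z) (snd z) * (\<Sum>j<M. fst z ^ j * v j (snd z))) = (\<Sum>j<M. load T \<Omega> f j (v j))"
  unfolding load_def sum_distrib_left
  by (rule set_integral_sum) (use load_integrable[OF f v] in auto)

lemma load_combination:
  assumes f: "L2T T \<Omega> f" and b: "\<And>k. k < N \<Longrightarrow> Vh \<Omega> Th m (b k)"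
    and v: "\<And>x. x \<in> \<Omega> \<Longrightarrow> v x = (\<Sum>k<N. c k * b k x)"
  shows "load T \<Omega> f j v = (\<Sum>k<N. c k * load T \<Omega> f j (b k))"
proof -
  have "load T \<Omega> f j v = (LINT z:({0<..<T} \<times> \<Omega>)|lebesgue. \<Sum>k<N. c k * (f (fst z) (snd z) * (fst z ^ j * b k (snd z))))"
    unfolding load_def by (rule set_integral_cong_on) (auto simp: v sum_distrib_left mult_ac)
  also have "\<dots> = (\<Sum>k<N. c k * load T \<Omega> f j (b k))"
    unfolding load_def using load_integrable[OF f b] by (subst set_integral_sum) auto
  finally show ?thesis .
qed

text \<open>Young's inequality with a free weight \<open>r\<close>, which
  \<open>energy_estimate\<close> fixes.\<close>

lemma load_bound:
  assumes f: "L2T T \<Omega> f" and v: "\<And>j. j < M \<Longrightarrow> Vh \<Omega> Th m (v j)" and r: "0 < r"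
  shows "(\<Sum>j<M. load T \<Omega> f j (v j)) \<le> r * (\<Sum>i<M. \<Sum>j<M. ip \<Omega> (v i) (v j) * gram T i j) + (L2Tnorm T \<Omega> f)\<^sup>2 / (4 * r)"
proof -
  let ?S = "{0<..<T} \<times> \<Omega>"
  let ?V = "\<lambda>z. \<Sum>j<M. fst z ^ j * v j (snd z)"
  have V2: "(?V z)\<^sup>2 = (\<Sum>i<M. \<Sum>j<M. (fst z ^ i * v i (snd z)) * (fst z ^ j * v j (snd z)))" for z
    by (simp add: power2_eq_square sum_product)
  have V2i: "set_integrable lebesgue ?S (\<lambda>z. (?V z)\<^sup>2)"
    unfolding V2 using tensor_product_integral(1)[OF v v] by (intro set_integrable_sum) auto
  have V2v: "(LINT z:?S|lebesgue. (?V z)\<^sup>2) = (\<Sum>i<M. \<Sum>j<M. ip \<Omega> (v i) (v j) * gram T i j)"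
  proof -
    have "(LINT z:?S|lebesgue. (?V z)\<^sup>2) = (\<Sum>i<M. LINT z:?S|lebesgue. \<Sum>j<M. (fst z ^ i * v i (snd z)) * (fst z ^ j * v j (snd z)))"
      unfolding V2 using tensor_product_integral(1)[OF v v] by (intro set_integral_sum set_integrable_sum) auto
    also have "\<dots> = (\<Sum>i<M. \<Sum>j<M. LINT z:?S|lebesgue. (fst z ^ i * v i (snd z)) * (fst z ^ j * v j (snd z)))"
      using tensor_product_integral(1)[OF v v] by (intro sum.cong refl set_integral_sum) auto
    also have "\<dots> = (\<Sum>i<M. \<Sum>j<M. ip \<Omega> (v i) (v j) * gram T i j)"
      by (intro sum.cong refl tensor_product_integral(2) v) auto
    finally show ?thesis .
  qed
  have f2: "set_integrable lebesgue ?S (\<lambda>z. (f (fst z) (snd z))\<^sup>2)" using f by (simp add: L2T_def)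
  have f2v: "(LINT z:?S|lebesgue. (f (fst z) (snd z))\<^sup>2) = (L2Tnorm T \<Omega> f)\<^sup>2"
    by (simp add: L2Tnorm_def set_integral_nonneg_real)
  have "(\<Sum>j<M. load T \<Omega> f j (v j)) = (LINT z:?S|lebesgue. f (fst z) (snd z) * ?V z)"
    using load_sum[OF f v] by simp
  also have "\<dots> \<le> (LINT z:?S|lebesgue. r * (?V z)\<^sup>2 + (1 / (4 * r)) * (f (fst z) (snd z))\<^sup>2)"
  proof (rule set_integral_mono)
    show "set_integrable lebesgue ?S (\<lambda>z. f (fst z) (snd z) * ?V z)"
      unfolding sum_distrib_left using load_integrable[OF f v] by (intro set_integrable_sum) auto
    show "set_integrable lebesgue ?S (\<lambda>z. r * (?V z)\<^sup>2 + (1 / (4 * r)) * (f (fst z) (snd z))\<^sup>2)"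
      by (intro set_integral_add(1) set_integrable_mult_right V2i f2)
    fix z
    have "a * b \<le> r * b\<^sup>2 + (1 / (4 * r)) * a\<^sup>2" for a b :: real
    proof -
      have "0 \<le> r * (b - a / (2 * r))\<^sup>2" using r by simp
      also have "\<dots> = r * b\<^sup>2 + (1 / (4 * r)) * a\<^sup>2 - a * b" using r by (simp add: power2_eq_square field_simps)
      finally show ?thesis by simp
    qed
    then show "f (fst z) (snd z) * ?V z \<le> r * (?V z)\<^sup>2 + (1 / (4 * r)) * (f (fst z) (snd z))\<^sup>2" .
  qed
  also have "\<dots> = r * (LINT z:?S|lebesgue. (?V z)\<^sup>2) + (1 / (4 * r)) * (LINT z:?S|lebesgue. (f (fst z) (snd z))\<^sup>2)"
    using V2i f2 by (subst set_integral_add(2)) auto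
  finally show ?thesis unfolding V2v f2v by simp
qed

text \<open>For any coefficient family \<open>w\<close> representing \<open>U\<close>, the scheme is
  a statement about \<open>coeff_form\<close> and \<open>load\<close>. Existence, uniqueness and the
  estimates are all derived from this form.\<close>

lemma disc_sol_iff:
  assumes U: "\<And>t x. U t x = (\<Sum>i\<le>M. t ^ i * w i x)" and w: "\<And>i. i \<le> M \<Longrightarrow> Vh0 \<Omega> Th m (w i)"
    and uh: "L2 \<Omega> uh" and f: "L2T T \<Omega> f"
  shows "disc_sol \<alpha> T \<Omega> Th m M u0 uh f U \<longleftrightarrow> ritz \<Omega> Th m u0 (w 0) \<and>
    (\<forall>v. (\<forall>j<M. Vh0 \<Omega> Th m (v j)) \<longrightarrow> coeff_form T \<alpha> \<Omega> M uh w v = (\<Sum>j<M. load T \<Omega> f j (v j)))"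
proof -
  have U0: "U 0 = w 0"
  proof
    fix x show "U 0 x = w 0 x" unfolding U
      by (subst sum.remove[of _ 0]) (auto simp: power_0_left intro!: sum.neutral)
  qed
  have ten: "tensor_space \<Omega> Th m M U" unfolding tensor_space_def using U w by blast
  have lhs: "(LINT t:{0<..<T}|lborel. LINT x:\<Omega>|lebesgue. RL_D0 \<alpha> (\<lambda>s. dt U s x - uh x) t * RL_DT T \<alpha> (\<lambda>s. V s x) t)
      + (LINT t:{0<..<T}|lborel. LINT x:\<Omega>|lebesgue. wgrad \<Omega> (U t) x \<bullet> wgrad \<Omega> (V t) x) = coeff_form T \<alpha> \<Omega> M uh w v"
    and rhs: "(LINT z:({0<..<T} \<times> \<Omega>)|lebesgue. f (fst z) (snd z) * V (fst z) (snd z)) = (\<Sum>j<M. load T \<Omega> f j (v j))"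
    if v: "\<And>j. j < M \<Longrightarrow> Vh0 \<Omega> Th m (v j)" and V: "\<And>t x. V t x = (\<Sum>j<M. t ^ j * v j x)" for v V
  proof -
    show "(LINT t:{0<..<T}|lborel. LINT x:\<Omega>|lebesgue. RL_D0 \<alpha> (\<lambda>s. dt U s x - uh x) t * RL_DT T \<alpha> (\<lambda>s. V s x) t)
      + (LINT t:{0<..<T}|lborel. LINT x:\<Omega>|lebesgue. wgrad \<Omega> (U t) x \<bullet> wgrad \<Omega> (V t) x) = coeff_form T \<alpha> \<Omega> M uh w v"
      unfolding coeff_form_def using fractional_term[OF U V w v uh] gradient_term[OF U V w v] by simp
    have "Vh \<Omega> Th m (v j)" if "j < M" for j by (rule Vh0_Vh[OF opn bdd tri v[OF that]])
    from load_sum[OF f this]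
    show "(LINT z:({0<..<T} \<times> \<Omega>)|lebesgue. f (fst z) (snd z) * V (fst z) (snd z)) = (\<Sum>j<M. load T \<Omega> f j (v j))"
      by (simp add: V)
  qed
  show ?thesis
  proof
    assume L: "disc_sol \<alpha> T \<Omega> Th m M u0 uh f U"
    have "coeff_form T \<alpha> \<Omega> M uh w v = (\<Sum>j<M. load T \<Omega> f j (v j))" if v: "\<forall>j<M. Vh0 \<Omega> Th m (v j)" for v
    proof -
      define V where "V t x = (\<Sum>j<M. t ^ j * v j x)" for t x
      \<comment> \<open>\<open>tensor_space\<close> sums over degrees up to \<open>M - 1\<close>,
        the coefficient form over degrees below \<open>M\<close>; these agree since
        \<open>1 \<le> M\<close>.\<close>
      have ten': "tensor_space \<Omega> Th m (M - 1) V"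
        unfolding tensor_space_def atMost_pred_eq_lessThan[OF M] V_def using v M by (intro exI[of _ v]) auto
      have "coeff_form T \<alpha> \<Omega> M uh w v = (LINT t:{0<..<T}|lborel. LINT x:\<Omega>|lebesgue. RL_D0 \<alpha> (\<lambda>s. dt U s x - uh x) t * RL_DT T \<alpha> (\<lambda>s. V s x) t)
        + (LINT t:{0<..<T}|lborel. LINT x:\<Omega>|lebesgue. wgrad \<Omega> (U t) x \<bullet> wgrad \<Omega> (V t) x)"
        by (rule lhs[symmetric]) (use v V_def in auto)
      also have "\<dots> = (LINT z:({0<..<T} \<times> \<Omega>)|lebesgue. f (fst z) (snd z) * V (fst z) (snd z))"
        using L ten' unfolding disc_sol_def by blast
      also have "\<dots> = (\<Sum>j<M. load T \<Omega> f j (v j))"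
        by (rule rhs) (use v V_def in auto)
      finally show ?thesis .
    qed
    moreover have "ritz \<Omega> Th m u0 (w 0)" using L U0 by (simp add: disc_sol_def)
    ultimately show "ritz \<Omega> Th m u0 (w 0) \<and>
      (\<forall>v. (\<forall>j<M. Vh0 \<Omega> Th m (v j)) \<longrightarrow> coeff_form T \<alpha> \<Omega> M uh w v = (\<Sum>j<M. load T \<Omega> f j (v j)))"
      by blast
  next
    assume R: "ritz \<Omega> Th m u0 (w 0) \<and>
      (\<forall>v. (\<forall>j<M. Vh0 \<Omega> Th m (v j)) \<longrightarrow> coeff_form T \<alpha> \<Omega> M uh w v = (\<Sum>j<M. load T \<Omega> f j (v j)))"
    show "disc_sol \<alpha> T \<Omega> Th m M u0 uh f U"
      unfolding disc_sol_def
    proof (intro conjI allI impI)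
      fix V assume "tensor_space \<Omega> Th m (M - 1) V"
      then obtain v where v': "\<forall>j\<le>M - 1. Vh0 \<Omega> Th m (v j)" and V: "\<And>t x. V t x = (\<Sum>j<M. t ^ j * v j x)"
        unfolding tensor_space_def atMost_pred_eq_lessThan[OF M] by blast
      have v: "Vh0 \<Omega> Th m (v j)" if "j < M" for j using v' that by auto
      show "(LINT t:{0<..<T}|lborel. LINT x:\<Omega>|lebesgue. RL_D0 \<alpha> (\<lambda>s. dt U s x - uh x) t * RL_DT T \<alpha> (\<lambda>s. V s x) t)
        + (LINT t:{0<..<T}|lborel. LINT x:\<Omega>|lebesgue. wgrad \<Omega> (U t) x \<bullet> wgrad \<Omega> (V t) x)
        = (LINT z:({0<..<T} \<times> \<Omega>)|lebesgue. f (fst z) (snd z) * V (fst z) (snd z))"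
      proof -
        have "coeff_form T \<alpha> \<Omega> M uh w v = (\<Sum>j<M. load T \<Omega> f j (v j))" using R v by blast
        then show ?thesis using lhs[of v V] rhs[of v V] v V by simp
      qed
    qed (use R ten U0 in auto)
  qed
qed

lemma gradient_energy:
  assumes U: "\<And>t x. U t x = (\<Sum>i\<le>M. t ^ i * w i x)" and w: "\<And>i. i \<le> M \<Longrightarrow> Vh0 \<Omega> Th m (w i)"
  shows "2 * (\<Sum>i\<le>M. \<Sum>j<M. dirichlet \<Omega> (w i) (dcoeff w j) * gram T i j) = dirichlet \<Omega> (U T) (U T) - dirichlet \<Omega> (w 0) (w 0)"
proof -
  let ?D = "\<lambda>i j. dirichlet \<Omega> (w i) (w j)"
  have w1: "\<And>i. i \<in> {..M} \<Longrightarrow> H1 \<Omega> (w i)" using Vh0H1[OF w] by simp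
  \<comment> \<open>Shifted by one against \<open>dcoeff\<close>: column \<open>Suc j\<close> of
    \<open>a\<close> is column \<open>j\<close> of the form, and column 0 vanishes.\<close>
  define a where "a i j = real j * (T ^ (i + j) / real (i + j)) * ?D i j" for i j
  have dc: "dirichlet \<Omega> (w i) (dcoeff w j) = real (Suc j) * ?D i (Suc j)" if "i \<le> M" "j < M" for i j
    using dirichlet_sum_right[OF opn bdd, of "{Suc j}" w "w i" "\<lambda>_. real (Suc j)"] w1 that
    by (simp add: dcoeff_def[abs_def])
  have "(\<Sum>j<M. dirichlet \<Omega> (w i) (dcoeff w j) * gram T i j) = (\<Sum>j\<le>M. a i j)" if "i \<le> M" for i
  proof -
    have "(\<Sum>j\<le>M. a i j) = a i 0 + (\<Sum>j<M. a i (Suc j))"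
      unfolding lessThan_Suc_atMost[symmetric] sum.lessThan_Suc_shift ..
    also have "\<dots> = (\<Sum>j<M. dirichlet \<Omega> (w i) (dcoeff w j) * gram T i j)"
      using T that by (auto simp: a_def gram_eq dc intro!: sum.cong)
    finally show ?thesis ..
  qed
  then have "2 * (\<Sum>i\<le>M. \<Sum>j<M. dirichlet \<Omega> (w i) (dcoeff w j) * gram T i j) = (\<Sum>i\<le>M. \<Sum>j\<le>M. a i j) + (\<Sum>i\<le>M. \<Sum>j\<le>M. a i j)"
    by simp
  also have "\<dots> = (\<Sum>i\<le>M. \<Sum>j\<le>M. a i j + a j i)"
    by (subst (2) sum.swap) (simp add: sum.distrib)
  \<comment> \<open>After symmetrisation the factors i / (i + j) and j / (i + j) add up to 1. The
    entry at i = j = 0 is the exception: there both are 0, and the excess is the energy at time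
    0.\<close>
  also have "\<dots> = (\<Sum>i\<le>M. \<Sum>j\<le>M. T ^ i * T ^ j * ?D i j - (if j = 0 then if i = 0 then ?D 0 0 else 0 else 0))"
  proof (intro sum.cong refl)
    fix i j
    show "a i j + a j i = T ^ i * T ^ j * ?D i j - (if j = 0 then if i = 0 then ?D 0 0 else 0 else 0)"
    proof (cases "i + j = 0")
      case False
      have "a i j + a j i = (real i + real j) * (T ^ (i + j) / real (i + j)) * ?D i j"
        by (simp add: a_def dirichlet_sym[of \<Omega> "w j"] add.commute[of j] distrib_right add_divide_distrib)
      also have "\<dots> = T ^ (i + j) * ?D i j"
      proof -
        have "real i + real j \<noteq> 0" using False by linarith
        then show ?thesis by simp
      qed
      finally show ?thesis using False by (auto simp: power_add)
    qed (simp add: a_def)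
  qed
  also have "\<dots> = (\<Sum>i\<le>M. \<Sum>j\<le>M. T ^ i * T ^ j * ?D i j) - ?D 0 0"
    by (simp add: sum_subtractf)
  also have "(\<Sum>i\<le>M. \<Sum>j\<le>M. T ^ i * T ^ j * ?D i j) = dirichlet \<Omega> (U T) (U T)"
  proof -
    have UT: "U T = (\<lambda>x. \<Sum>i\<le>M. T ^ i * w i x)" by (auto simp: U)
    have "H1 \<Omega> (\<lambda>x. \<Sum>i\<le>M. T ^ i * w i x)" using w1 by (intro H1_sum[OF opn bdd]) auto
    then have "dirichlet \<Omega> (U T) (U T) = (\<Sum>i\<le>M. T ^ i * dirichlet \<Omega> (w i) (\<lambda>x. \<Sum>j\<le>M. T ^ j * w j x))"
      unfolding UT by (intro dirichlet_sum_left[OF opn bdd finite_atMost w1])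
    also have "\<dots> = (\<Sum>i\<le>M. T ^ i * (\<Sum>j\<le>M. T ^ j * ?D i j))"
      by (intro sum.cong refl arg_cong2[where f = "(*)"] dirichlet_sum_right[OF opn bdd finite_atMost w1 w1])
    finally show ?thesis by (simp add: sum_distrib_left mult_ac)
  qed
  finally show ?thesis .
qed

section \<open>Energy estimates\<close>

text \<open>For \<open>d = dcoeff w\<close>, this and the next two are squares of norms of
  \<open>U'\<close> with values in L2 of \<open>\<Omega>\<close>: weighted by
  \<open>t powr (- 2 * \<alpha>)\<close>, the Slobodeckij seminorm of order \<open>\<alpha>\<close>,
  and plain L2 in time.\<close>

definition weight_sq :: "(nat \<Rightarrow> real^'n \<Rightarrow> real) \<Rightarrow> real" where
  "weight_sq d = (\<Sum>i<M. \<Sum>j<M. ip \<Omega> (d i) (d j) * weight_form T (2 * \<alpha>) i j)"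

definition slob_sq :: "(nat \<Rightarrow> real^'n \<Rightarrow> real) \<Rightarrow> real" where
  "slob_sq d = (\<Sum>i<M. \<Sum>j<M. ip \<Omega> (d i) (d j) * slob_form T (2 * \<alpha>) i j)"

definition gram_sq :: "(nat \<Rightarrow> real^'n \<Rightarrow> real) \<Rightarrow> real" where
  "gram_sq d = (\<Sum>i<M. \<Sum>j<M. ip \<Omega> (d i) (d j) * gram T i j)"

text \<open>Contracting a Gram matrix of functions with a nonnegative form: the sum is the integral
  over \<open>x\<close> of the form at the values \<open>d i x\<close>.\<close>

lemma quadratic_nonneg:
  assumes "\<And>i. i < M \<Longrightarrow> L2 \<Omega> (d i)" "\<And>c. 0 \<le> (\<Sum>i<M. \<Sum>j<M. c i * c j * r i j)"
  shows "0 \<le> (\<Sum>i<M. \<Sum>j<M. ip \<Omega> (d i) (d j) * r i j)"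
  using assms(2)
  by (subst quadratic_form_integral(2)[symmetric]) (use assms in \<open>auto intro!: set_integral_nonneg_real\<close>)

lemma slob_sq_nonneg: "(\<And>i. i < M \<Longrightarrow> L2 \<Omega> (d i)) \<Longrightarrow> 0 \<le> slob_sq d"
  unfolding slob_sq_def
proof (rule quadratic_nonneg)
  fix c
  have "0 \<le> (LINT t:{0<..<T}|lborel. LINT s:{0<..<t}|lborel.
     ((\<Sum>i<M. c i * t ^ i) - (\<Sum>i<M. c i * s ^ i))\<^sup>2 * (t - s) powr (- 1 - 2 * \<alpha>))"
    by (intro set_integral_nonneg_real) auto
  then show "0 \<le> (\<Sum>i<M. \<Sum>j<M. c i * c j * slob_form T (2 * \<alpha>) i j)"
    using slob_form_poly[OF _ T, of "2 * \<alpha>" "\<lambda>s. \<Sum>i<M. c i * s ^ i" c M] \<alpha> by simp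
qed

lemma gram_sq_le: "(\<And>i. i < M \<Longrightarrow> L2 \<Omega> (d i)) \<Longrightarrow> gram_sq d \<le> T powr (2 * \<alpha>) * weight_sq d"
proof -
  assume d: "\<And>i. i < M \<Longrightarrow> L2 \<Omega> (d i)"
  have "0 \<le> (\<Sum>i<M. \<Sum>j<M. ip \<Omega> (d i) (d j) * (T powr (2 * \<alpha>) * weight_form T (2 * \<alpha>) i j - gram T i j))"
  proof (rule quadratic_nonneg[OF d])
    fix c
    have "(\<Sum>i<M. \<Sum>j<M. c i * c j * gram T i j) \<le> T powr (2 * \<alpha>) * (\<Sum>i<M. \<Sum>j<M. c i * c j * weight_form T (2 * \<alpha>) i j)"
      using l2_le_weight_form[of "2 * \<alpha>" T c M] \<alpha> T by (simp add: gram_poly)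
    then show "0 \<le> (\<Sum>i<M. \<Sum>j<M. c i * c j * (T powr (2 * \<alpha>) * weight_form T (2 * \<alpha>) i j - gram T i j))"
      by (simp add: right_diff_distrib sum_subtractf sum_distrib_left mult_ac)
  qed
  then show ?thesis
    by (simp add: gram_sq_def weight_sq_def right_diff_distrib sum_subtractf sum_distrib_left mult_ac)
qed

lemma gram_sq_nonneg: "(\<And>i. i < M \<Longrightarrow> L2 \<Omega> (d i)) \<Longrightarrow> 0 \<le> gram_sq d"
  unfolding gram_sq_def
proof (rule quadratic_nonneg)
  show "0 \<le> (\<Sum>i<M. \<Sum>j<M. c i * c j * gram T i j)" for c
    unfolding gram_poly[symmetric] by (rule set_integral_nonneg_real) simp
qed

lemma weight_sq_nonneg: "(\<And>i. i < M \<Longrightarrow> L2 \<Omega> (d i)) \<Longrightarrow> 0 \<le> weight_sq d"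
  using gram_sq_le[of d] gram_sq_nonneg[of d] T by (smt (verit) powr_gt_zero zero_le_mult_iff)

text \<open>Coercivity and the Young bound for \<open>uh\<close> hold at each \<open>x\<close> and
  are integrated over \<open>\<Omega>\<close>. The weight term keeps 1/2 - 1/4 = 1/4, and
  \<open>\<beta> / 4\<close> is \<open>\<alpha> / 2\<close>.\<close>

lemma fractional_energy:
  assumes d: "\<And>i. i < M \<Longrightarrow> L2 \<Omega> (d i)" and uh: "L2 \<Omega> uh"
  shows "weight_sq d / 4 + \<alpha> / 2 * slob_sq d - T powr (1 - 2 * \<alpha>) / (1 - 2 * \<alpha>) * ip \<Omega> uh uh
    \<le> Gamma (1 - 2 * \<alpha>) * ((\<Sum>i<M. \<Sum>j<M. ip \<Omega> (d i) (d j) * frac_form T \<alpha> i j) - (\<Sum>j<M. ip \<Omega> uh (d j) * frac_form T \<alpha> 0 j))"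
proof -
  let ?W = "weight_form T (2 * \<alpha>)" and ?S = "slob_form T (2 * \<alpha>)" and ?A = "frac_form T \<alpha>"
  let ?G = "Gamma (1 - 2 * \<alpha>)" and ?K = "T powr (1 - 2 * \<alpha>) / (1 - 2 * \<alpha>)"
  let ?R = "\<lambda>i j. ?W i j / 4 + \<alpha> / 2 * ?S i j"
  have pw: "(\<Sum>i<M. \<Sum>j<M. d i x * d j x * ?R i j) - ?K * (uh x * uh x)
      \<le> ?G * ((\<Sum>i<M. \<Sum>j<M. d i x * d j x * ?A i j) - (\<Sum>j<M. ?A 0 j * (uh x * d j x)))" for x
  proof -
    let ?c = "\<lambda>i. d i x"
    have "(\<Sum>i<M. \<Sum>j<M. ?c i * ?c j * ?R i j)
        = (\<Sum>i<M. \<Sum>j<M. ?c i * ?c j * ?W i j) / 4 + \<alpha> / 2 * (\<Sum>i<M. \<Sum>j<M. ?c i * ?c j * ?S i j)"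
      by (simp add: distrib_left sum.distrib sum_distrib_left sum_divide_distrib mult_ac)
    moreover have "(\<Sum>j<M. ?A 0 j * (uh x * d j x)) = uh x * (\<Sum>j<M. ?c j * ?A 0 j)"
      by (simp add: sum_distrib_left mult_ac)
    moreover have "2 * \<alpha> / 4 = \<alpha> / 2" by simp
    ultimately show ?thesis
      using frac_form_coercive[OF \<alpha> T refl, of ?c M] frac_form_0_bound[OF \<alpha> T refl, of "uh x" ?c M]
      by (simp add: right_diff_distrib power2_eq_square)
  qed
  have i1: "set_integrable lebesgue \<Omega> (\<lambda>x. \<Sum>i<M. \<Sum>j<M. d i x * d j x * r i j)" for r
    by (rule quadratic_form_integral(1)) (rule d)
  have i2: "set_integrable lebesgue \<Omega> (\<lambda>x. \<Sum>j<M. ?A 0 j * (uh x * d j x))"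
    using d uh by (intro set_integrable_sum set_integrable_mult_right L2_times) auto
  have i3: "set_integrable lebesgue \<Omega> (\<lambda>x. ?K * (uh x * uh x))"
    by (intro set_integrable_mult_right L2_times uh)
  have v1: "(LINT x:\<Omega>|lebesgue. \<Sum>i<M. \<Sum>j<M. d i x * d j x * r i j) = (\<Sum>i<M. \<Sum>j<M. ip \<Omega> (d i) (d j) * r i j)" for r
    by (rule quadratic_form_integral(2)) (rule d)
  have v2: "(LINT x:\<Omega>|lebesgue. \<Sum>j<M. ?A 0 j * (uh x * d j x)) = (\<Sum>j<M. ip \<Omega> uh (d j) * ?A 0 j)"
    unfolding ip_def using d uh
    by (subst set_integral_sum) (auto intro!: L2_times set_integrable_mult_right simp: mult.commute simp del: set_integrable_mult_right_iff)
  have "(LINT x:\<Omega>|lebesgue. (\<Sum>i<M. \<Sum>j<M. d i x * d j x * ?R i j) - ?K * (uh x * uh x))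
      \<le> (LINT x:\<Omega>|lebesgue. ?G * ((\<Sum>i<M. \<Sum>j<M. d i x * d j x * ?A i j) - (\<Sum>j<M. ?A 0 j * (uh x * d j x))))"
    by (rule set_integral_mono) (intro set_integral_diff(1) i1 i3, intro set_integrable_mult_right set_integral_diff(1) i1 i2, rule pw)
  also have "\<dots> = ?G * ((\<Sum>i<M. \<Sum>j<M. ip \<Omega> (d i) (d j) * ?A i j) - (\<Sum>j<M. ip \<Omega> uh (d j) * ?A 0 j))"
    unfolding set_integral_mult_right set_integral_diff(2)[OF i1 i2] v1 v2 ..
  also have "(LINT x:\<Omega>|lebesgue. (\<Sum>i<M. \<Sum>j<M. d i x * d j x * ?R i j) - ?K * (uh x * uh x))
      = (\<Sum>i<M. \<Sum>j<M. ip \<Omega> (d i) (d j) * ?R i j) - ?K * ip \<Omega> uh uh"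
    unfolding set_integral_diff(2)[OF i1 i3] set_integral_mult_right v1 ip_def[of \<Omega> uh uh] ..
  also have "(\<Sum>i<M. \<Sum>j<M. ip \<Omega> (d i) (d j) * ?R i j) = weight_sq d / 4 + \<alpha> / 2 * slob_sq d"
    by (simp add: weight_sq_def slob_sq_def distrib_left sum.distrib sum_distrib_left sum_divide_distrib mult_ac)
  finally show ?thesis .
qed

text \<open>The weight in Young's inequality for the load is chosen so that half of \<open>weight_sq\<close> absorbs it.\<close>
lemma energy_estimate:
  assumes U: "\<And>t x. U t x = (\<Sum>i\<le>M. t ^ i * w i x)" and w: "\<And>i. i \<le> M \<Longrightarrow> Vh0 \<Omega> Th m (w i)"
    and uh: "L2 \<Omega> uh" and f: "L2T T \<Omega> f" and sol: "disc_sol \<alpha> T \<Omega> Th m M u0 uh f U"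
  shows "weight_sq (dcoeff w) / 8 + \<alpha> / 2 * slob_sq (dcoeff w) + Gamma (1 - 2 * \<alpha>) / 2 * dirichlet \<Omega> (U T) (U T)
    \<le> T powr (1 - 2 * \<alpha>) / (1 - 2 * \<alpha>) * ip \<Omega> uh uh + 2 * (Gamma (1 - 2 * \<alpha>))\<^sup>2 * T powr (2 * \<alpha>) * (L2Tnorm T \<Omega> f)\<^sup>2
      + Gamma (1 - 2 * \<alpha>) / 2 * dirichlet \<Omega> (w 0) (w 0)"
proof -
  let ?G = "Gamma (1 - 2 * \<alpha>)" and ?d = "dcoeff w" and ?F = "(L2Tnorm T \<Omega> f)\<^sup>2"
  have G: "0 < ?G" using \<alpha> by (intro Gamma_real_pos) simp
  have dV: "Vh0 \<Omega> Th m (?d i)" if "i < M" for i by (rule dcoeff_Vh0[OF w that])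
  then have d: "L2 \<Omega> (?d i)" if "i < M" for i using that by (intro Vh0L2)
  \<comment> \<open>With this \<open>r\<close> the load costs exactly
    \<open>weight_sq ?d / 8\<close> after multiplication by \<open>?G\<close>, and its data term
    \<open>?F / (4 * r)\<close> becomes
    \<open>2 * ?G\<^sup>2 * T powr (2 * \<alpha>) * ?F\<close>.\<close>
  define r where "r = 1 / (8 * ?G * T powr (2 * \<alpha>))"
  have r: "0 < r" using G T by (simp add: r_def)
  have dV': "Vh \<Omega> Th m (?d i)" if "i < M" for i using Vh0_Vh[OF opn bdd tri dV[OF that]] .
  have "(\<Sum>i<M. \<Sum>j<M. ip \<Omega> (?d i) (?d j) * frac_form T \<alpha> i j) - (\<Sum>j<M. ip \<Omega> uh (?d j) * frac_form T \<alpha> 0 j)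
      + (dirichlet \<Omega> (U T) (U T) - dirichlet \<Omega> (w 0) (w 0)) / 2 = (\<Sum>j<M. load T \<Omega> f j (?d j))"
  proof -
    have "coeff_form T \<alpha> \<Omega> M uh w ?d = (\<Sum>j<M. load T \<Omega> f j (?d j))"
      using disc_sol_iff[OF U w uh f, of u0] sol dV by blast
    moreover have "2 * (\<Sum>i\<le>M. \<Sum>j<M. dirichlet \<Omega> (w i) (?d j) * gram T i j) = dirichlet \<Omega> (U T) (U T) - dirichlet \<Omega> (w 0) (w 0)"
      by (rule gradient_energy[OF U w])
    then have "(\<Sum>i\<le>M. \<Sum>j<M. dirichlet \<Omega> (w i) (?d j) * gram T i j) = (dirichlet \<Omega> (U T) (U T) - dirichlet \<Omega> (w 0) (w 0)) / 2"
      by simp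
    ultimately show ?thesis unfolding coeff_form_def by simp
  qed
  moreover have "(\<Sum>j<M. load T \<Omega> f j (?d j)) \<le> r * gram_sq ?d + ?F / (4 * r)"
    unfolding gram_sq_def by (rule load_bound[OF f dV' r])
  moreover have "r * gram_sq ?d \<le> r * (T powr (2 * \<alpha>) * weight_sq ?d)"
    using gram_sq_le[of ?d] d r by (intro mult_left_mono) auto
  ultimately have A: "(\<Sum>i<M. \<Sum>j<M. ip \<Omega> (?d i) (?d j) * frac_form T \<alpha> i j) - (\<Sum>j<M. ip \<Omega> uh (?d j) * frac_form T \<alpha> 0 j)
      \<le> r * (T powr (2 * \<alpha>) * weight_sq ?d) + ?F / (4 * r) - (dirichlet \<Omega> (U T) (U T) - dirichlet \<Omega> (w 0) (w 0)) / 2"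
    by linarith
  have "weight_sq ?d / 4 + \<alpha> / 2 * slob_sq ?d - T powr (1 - 2 * \<alpha>) / (1 - 2 * \<alpha>) * ip \<Omega> uh uh
    \<le> ?G * ((\<Sum>i<M. \<Sum>j<M. ip \<Omega> (?d i) (?d j) * frac_form T \<alpha> i j) - (\<Sum>j<M. ip \<Omega> uh (?d j) * frac_form T \<alpha> 0 j))"
    by (rule fractional_energy[OF d uh])
  also have "\<dots> \<le> ?G * (r * (T powr (2 * \<alpha>) * weight_sq ?d) + ?F / (4 * r) - (dirichlet \<Omega> (U T) (U T) - dirichlet \<Omega> (w 0) (w 0)) / 2)"
    using mult_left_mono[OF A less_imp_le[OF G]] .
  also have "\<dots> = weight_sq ?d / 8 + 2 * ?G\<^sup>2 * T powr (2 * \<alpha>) * ?F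
      - ?G / 2 * dirichlet \<Omega> (U T) (U T) + ?G / 2 * dirichlet \<Omega> (w 0) (w 0)"
    using G T by (simp add: r_def field_simps power2_eq_square)
  finally show ?thesis by simp
qed

text \<open>\<open>U t\<close> is the initial value plus the primitive of \<open>U'\<close>; split
  the square with a factor 2 and apply \<open>primitive_square_le\<close> at each
  \<open>x\<close>.\<close>

lemma solution_L2_bound:
  assumes U: "\<And>t x. U t x = (\<Sum>i\<le>M. t ^ i * w i x)" and w: "\<And>i. i \<le> M \<Longrightarrow> Vh0 \<Omega> Th m (w i)"
    and t: "0 \<le> t" "t \<le> T"
  shows "ip \<Omega> (U t) (U t) \<le> 2 * ip \<Omega> (w 0) (w 0) + 2 * T * gram_sq (dcoeff w)"
proof -
  let ?d = "dcoeff w"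
  have d: "L2 \<Omega> (?d i)" if "i < M" for i by (rule Vh0L2[OF dcoeff_Vh0[OF w that]])
  have w0: "L2 \<Omega> (w 0)" using Vh0L2[OF w] by simp
  have Ut: "U t x = w 0 x + (\<Sum>i<M. ?d i x * (t ^ (i + 1) / real (i + 1)))" for x
    unfolding U lessThan_Suc_atMost[symmetric] sum.lessThan_Suc_shift
    by (auto simp: dcoeff_def mult_ac intro!: sum.cong simp del: of_nat_Suc)
  have UtL: "L2 \<Omega> (U t)"
  proof -
    have "U t = (\<lambda>x. \<Sum>i\<le>M. t ^ i * w i x)" by (auto simp: U)
    then show ?thesis using L2_sum[of "{..M}" \<Omega> w "\<lambda>i. t ^ i"] Vh0L2[OF w] by simp
  qed
  have "ip \<Omega> (U t) (U t) \<le> (LINT x:\<Omega>|lebesgue. 2 * (w 0 x * w 0 x) + 2 * T * (\<Sum>i<M. \<Sum>j<M. ?d i x * ?d j x * gram T i j))"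
    unfolding ip_def
  proof (rule set_integral_mono)
    show "set_integrable lebesgue \<Omega> (\<lambda>x. 2 * (w 0 x * w 0 x) + 2 * T * (\<Sum>i<M. \<Sum>j<M. ?d i x * ?d j x * gram T i j))"
      by (intro set_integral_add(1) set_integrable_mult_right L2_times w0 quadratic_form_integral(1) d)
    fix x
    let ?I = "\<Sum>i<M. ?d i x * (t ^ (i + 1) / real (i + 1))"
    have "(w 0 x + ?I)\<^sup>2 \<le> 2 * (w 0 x)\<^sup>2 + 2 * ?I\<^sup>2"
      using zero_le_power2[of "w 0 x - ?I"] by (simp add: power2_eq_square algebra_simps)
    then show "U t x * U t x \<le> 2 * (w 0 x * w 0 x) + 2 * T * (\<Sum>i<M. \<Sum>j<M. ?d i x * ?d j x * gram T i j)"
      using primitive_square_le[OF t, of "\<lambda>i. ?d i x" M] by (simp add: Ut power2_eq_square)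
  qed (intro L2_times UtL)
  also have "\<dots> = 2 * ip \<Omega> (w 0) (w 0) + 2 * T * gram_sq ?d"
  proof -
    have "(LINT x:\<Omega>|lebesgue. \<Sum>i<M. \<Sum>j<M. ?d i x * ?d j x * gram T i j) = gram_sq ?d"
      unfolding gram_sq_def by (rule quadratic_form_integral(2)) (rule d)
    then show ?thesis
      unfolding ip_def
      by (subst set_integral_add(2)) (intro set_integrable_mult_right L2_times w0 quadratic_form_integral(1) d | simp)+
  qed
  finally show ?thesis .
qed

text \<open>The two derivative parts of the norm equal \<open>gram_sq\<close> and
  \<open>slob_sq\<close>. The remaining part is bounded uniformly in time by
  \<open>solution_L2_bound\<close>, whence the extra factor \<open>T\<close>.\<close>

lemma time_norm_le:
  assumes U: "\<And>t x. U t x = (\<Sum>i\<le>M. t ^ i * w i x)" and w: "\<And>i. i \<le> M \<Longrightarrow> Vh0 \<Omega> Th m (w i)"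
  shows "H1s_time_norm \<alpha> T \<Omega> U \<le> sqrt (T * (2 * ip \<Omega> (w 0) (w 0) + 2 * T * gram_sq (dcoeff w))
    + gram_sq (dcoeff w) + slob_sq (dcoeff w))"
proof -
  let ?d = "dcoeff w"
  have d: "L2 \<Omega> (?d i)" if "i < M" for i by (rule Vh0L2[OF dcoeff_Vh0[OF w that]])
  have dU: "dt U t = (\<lambda>x. \<Sum>i<M. ?d i x * t ^ i)" for t
    by (rule ext) (rule dt_tensor[OF U])
  have "(LINT t:{0<..<T}|lborel. (L2norm \<Omega> (dt U t))\<^sup>2) = gram_sq ?d"
    unfolding dU gram_sq_def by (rule time_L2norm) (rule d)
  moreover have "(LINT t:{0<..<T}|lborel. LINT s:{0<..<T}|lborel.
      (L2norm \<Omega> (\<lambda>x. dt U t x - dt U s x))\<^sup>2 / \<bar>t - s\<bar> powr (1 + 2 * \<alpha>)) = slob_sq ?d"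
    unfolding dU slob_sq_def by (rule time_slobodeckij[OF d]) (use \<alpha> T in auto)
  moreover have "(LINT t:{0<..<T}|lborel. (L2norm \<Omega> (U t))\<^sup>2) \<le> T * (2 * ip \<Omega> (w 0) (w 0) + 2 * T * gram_sq ?d)"
  proof -
    let ?B = "2 * ip \<Omega> (w 0) (w 0) + 2 * T * gram_sq ?d"
    have wL: "L2 \<Omega> (w i)" if "i < Suc M" for i using Vh0L2[OF w] that by simp
    have Ut: "U t = (\<lambda>x. \<Sum>i<Suc M. w i x * t ^ i)" for t
      by (rule ext) (simp only: U lessThan_Suc_atMost mult.commute)
    have sq: "(L2norm \<Omega> (U t))\<^sup>2 = (\<Sum>i<Suc M. \<Sum>j<Suc M. ip \<Omega> (w i) (w j) * (t ^ i * t ^ j))" for t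
      unfolding Ut by (rule L2norm_combination) (rule wL)
    have "(LINT t:{0<..<T}|lborel. (L2norm \<Omega> (U t))\<^sup>2) \<le> (LINT t:{0<..<T}|lborel. ?B)"
    proof (rule set_integral_mono)
      show "set_integrable lborel {0<..<T} (\<lambda>t. (L2norm \<Omega> (U t))\<^sup>2)"
        unfolding sq by (intro set_integrable_continuous_Ioo continuous_intros)
      show "set_integrable lborel {0<..<T} (\<lambda>t. ?B)" by (intro set_integrable_continuous_Ioo continuous_intros)
      fix t assume "t \<in> {0<..<T}"
      then show "(L2norm \<Omega> (U t))\<^sup>2 \<le> ?B"
        unfolding L2norm_ip by (intro solution_L2_bound[OF U w]) auto
    qed
    also have "\<dots> = T * ?B" using T by (simp add: set_integral_const)
    finally show ?thesis .
  qed
  ultimately show ?thesis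
    unfolding H1s_time_norm_def by (intro real_sqrt_le_mono) simp
qed

section \<open>Uniqueness, existence and stability\<close>

text \<open>\<open>uh\<close> enters affinely and cancels between two solutions, so their difference
  solves the problem with zero data.\<close>

lemma coeff_form_diff:
  assumes w: "\<And>i. i \<le> M \<Longrightarrow> Vh0 \<Omega> Th m (w i)" and w': "\<And>i. i \<le> M \<Longrightarrow> Vh0 \<Omega> Th m (w' i)"
    and v: "\<And>j. j < M \<Longrightarrow> Vh0 \<Omega> Th m (v j)"
  shows "coeff_form T \<alpha> \<Omega> M (\<lambda>x. 0) (\<lambda>i x. w' i x - w i x) v = coeff_form T \<alpha> \<Omega> M uh w' v - coeff_form T \<alpha> \<Omega> M uh w v"
proof -
  have "ip \<Omega> (dcoeff (\<lambda>i x. w' i x - w i x) i) (v j) = ip \<Omega> (dcoeff w' i) (v j) - ip \<Omega> (dcoeff w i) (v j)"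
    if "i < M" "j < M" for i j
  proof -
    have "dcoeff (\<lambda>i x. w' i x - w i x) i = (\<lambda>x. 1 * dcoeff w' i x + (- 1) * dcoeff w i x)"
      by (simp add: dcoeff_def fun_eq_iff right_diff_distrib)
    moreover have "L2 \<Omega> (dcoeff w' i)" by (rule Vh0L2[OF dcoeff_Vh0[OF w' that(1)]])
    moreover have "L2 \<Omega> (dcoeff w i)" by (rule Vh0L2[OF dcoeff_Vh0[OF w that(1)]])
    ultimately show ?thesis
      using ip_lin[of \<Omega> "dcoeff w' i" "dcoeff w i" "v j" 1 "- 1"] Vh0L2[OF v[OF that(2)]] by simp
  qed
  moreover have "dirichlet \<Omega> (\<lambda>x. w' i x - w i x) (v j) = dirichlet \<Omega> (w' i) (v j) - dirichlet \<Omega> (w i) (v j)"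
    if "i \<le> M" "j < M" for i j
    using dirichlet_lin[OF opn bdd Vh0H1[OF w'[OF that(1)]] Vh0H1[OF w[OF that(1)]] Vh0H1[OF v[OF that(2)]], of 1 "- 1"] by simp
  moreover have "ip \<Omega> (\<lambda>x. 0) (v j) = 0" for j by (simp add: ip_def)
  ultimately show ?thesis
    by (simp add: coeff_form_def left_diff_distrib sum_subtractf)
qed

text \<open>Zero energy kills the derivative of the difference, Poincare's inequality its initial
  value, and \<open>Vh_eq_0\<close> passes to points. Equality is claimed on \<open>\<Omega>\<close>
  because representatives are free outside its closure.\<close>

lemma disc_sol_unique:
  assumes sol: "disc_sol \<alpha> T \<Omega> Th m M u0 uh f U" "disc_sol \<alpha> T \<Omega> Th m M u0 uh f U'"
    and u0: "H10 \<Omega> u0" and uh: "L2 \<Omega> uh" and f: "L2T T \<Omega> f" and t: "0 \<le> t" "t \<le> T" and x: "x \<in> \<Omega>"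
  shows "U' t x = U t x"
proof -
  obtain w where w: "\<And>i. i \<le> M \<Longrightarrow> Vh0 \<Omega> Th m (w i)" and U: "\<And>t x. U t x = (\<Sum>i\<le>M. t ^ i * w i x)"
    using sol(1) unfolding disc_sol_def tensor_space_def[of _ _ _ M U] by blast
  obtain w' where w': "\<And>i. i \<le> M \<Longrightarrow> Vh0 \<Omega> Th m (w' i)" and U': "\<And>t x. U' t x = (\<Sum>i\<le>M. t ^ i * w' i x)"
    using sol(2) unfolding disc_sol_def tensor_space_def[of _ _ _ M U'] by blast
  have 1: "ritz \<Omega> Th m u0 (w 0)"
    "\<And>v. (\<And>j. j < M \<Longrightarrow> Vh0 \<Omega> Th m (v j)) \<Longrightarrow> coeff_form T \<alpha> \<Omega> M uh w v = (\<Sum>j<M. load T \<Omega> f j (v j))"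
    using disc_sol_iff[OF U w uh f, of u0] sol(1) by auto
  have 2: "ritz \<Omega> Th m u0 (w' 0)"
    "\<And>v. (\<And>j. j < M \<Longrightarrow> Vh0 \<Omega> Th m (v j)) \<Longrightarrow> coeff_form T \<alpha> \<Omega> M uh w' v = (\<Sum>j<M. load T \<Omega> f j (v j))"
    using disc_sol_iff[OF U' w' uh f, of u0] sol(2) by auto
  define z where "z i x = w' i x - w i x" for i x
  define Z where "Z t x = (\<Sum>i\<le>M. t ^ i * z i x)" for t x
  have z: "Vh0 \<Omega> Th m (z i)" if "i \<le> M" for i
    using Vh0_lin[OF opn bdd tri w'[OF that] w[OF that], of 1 "- 1"] by (simp add: z_def[abs_def])
  have f0: "L2T T \<Omega> (\<lambda>t x. 0)" by (simp add: L2T_def set_borel_measurable_def set_integrable_def)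
  \<comment> \<open>Both initial coefficients are Ritz projections of \<open>u0\<close>. Their
    difference is orthogonal to the discrete space, hence of zero energy and, by Poincare's
    inequality below, zero in L2.\<close>
  have D0: "dirichlet \<Omega> (z 0) v = 0" if v: "Vh0 \<Omega> Th m v" for v
    using dirichlet_lin[OF opn bdd Vh0H1[OF w'[of 0]] Vh0H1[OF w[of 0]] Vh0H1[OF v], of 1 "- 1"]
      ritz_dirichlet[OF opn bdd tri 1(1) u0 v] ritz_dirichlet[OF opn bdd tri 2(1) u0 v]
    by (simp add: z_def[abs_def])
  have "ritz \<Omega> Th m (\<lambda>x. 0) (z 0)"
  proof -
    have "dirichlet \<Omega> (\<lambda>y. 0 - z 0 y) v = 0" if v: "Vh0 \<Omega> Th m v" for v
      using dirichlet_lin[OF opn bdd Vh0H1[OF z[of 0]] H1_zero[OF opn bdd] Vh0H1[OF v], of "- 1" 0] D0[OF v] by simp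
    then show ?thesis using z[of 0] by (auto simp: ritz_def dirichlet_def)
  qed
  moreover have "coeff_form T \<alpha> \<Omega> M (\<lambda>x. 0) z v = (\<Sum>j<M. load T \<Omega> (\<lambda>t x. 0) j (v j))"
    if v: "\<forall>j<M. Vh0 \<Omega> Th m (v j)" for v
  proof -
    have "coeff_form T \<alpha> \<Omega> M (\<lambda>x. 0) z v = coeff_form T \<alpha> \<Omega> M uh w' v - coeff_form T \<alpha> \<Omega> M uh w v"
      unfolding z_def[abs_def] by (rule coeff_form_diff) (use w w' v in auto)
    also have "\<dots> = 0" using 1(2)[of v] 2(2)[of v] v by simp
    finally show ?thesis by (simp add: load_def)
  qed
  ultimately have "disc_sol \<alpha> T \<Omega> Th m M (\<lambda>x. 0) (\<lambda>x. 0) (\<lambda>t x. 0) Z"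
    using disc_sol_iff[OF Z_def z L2_zero f0, of "\<lambda>x. 0"] by blast
  from energy_estimate[OF Z_def z L2_zero f0 this]
  have "weight_sq (dcoeff z) / 8 + \<alpha> / 2 * slob_sq (dcoeff z) + Gamma (1 - 2 * \<alpha>) / 2 * dirichlet \<Omega> (Z T) (Z T) \<le> 0"
    using D0[OF z[of 0]] by (simp add: L2Tnorm_def ip_def)
  moreover have d: "L2 \<Omega> (dcoeff z i)" if "i < M" for i by (rule Vh0L2[OF dcoeff_Vh0[OF z that]])
  have "0 \<le> \<alpha> / 2 * slob_sq (dcoeff z)" using slob_sq_nonneg[of "dcoeff z"] d \<alpha> by simp
  moreover have "0 \<le> Gamma (1 - 2 * \<alpha>) / 2 * dirichlet \<Omega> (Z T) (Z T)"
    using \<alpha> Gamma_real_pos[of "1 - 2 * \<alpha>"] by (simp add: dirichlet_nonneg)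
  ultimately have "weight_sq (dcoeff z) \<le> 0" by linarith
  then have "T powr (2 * \<alpha>) * weight_sq (dcoeff z) \<le> 0" by (simp add: mult_nonneg_nonpos)
  then have g: "gram_sq (dcoeff z) \<le> 0" using order_trans[OF gram_sq_le[of "dcoeff z"]] d by blast
  obtain C where C: "\<And>v. H10 \<Omega> v \<Longrightarrow> ip \<Omega> v v \<le> C * dirichlet \<Omega> v v"
    using poincare[OF opn bdd] by blast
  have "ip \<Omega> (z 0) (z 0) \<le> 0" using C[OF Vh0_H10[OF opn bdd tri z[of 0]]] D0[OF z[of 0]] by simp
  moreover have "2 * T * gram_sq (dcoeff z) \<le> 0" using g T by (simp add: mult_nonneg_nonpos)
  ultimately have "ip \<Omega> (Z t) (Z t) \<le> 0"
    using solution_L2_bound[OF Z_def z t] by linarith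
  then have "ip \<Omega> (Z t) (Z t) = 0" using ip_nonneg[of \<Omega> "Z t"] by linarith
  moreover have "Vh0 \<Omega> Th m (\<lambda>x. \<Sum>i\<le>M. t ^ i * z i x)" by (rule Vh0_sum[OF opn bdd tri]) (use z in auto)
  then have "Vh \<Omega> Th m (Z t)" unfolding Z_def by (rule Vh0_Vh[OF opn bdd tri])
  ultimately have "Z t x = 0" using Vh_eq_0[OF opn bdd tri _ _ x] by blast
  moreover have "Z t x = U' t x - U t x" by (simp add: Z_def z_def U U' right_diff_distrib sum_subtractf)
  ultimately show ?thesis by simp
qed

text \<open>The division by \<open>Suc i\<close> cancels in \<open>dcoeff\<close>, so the unknowns
  \<open>c\<close> are the coefficients of \<open>U'\<close>. Trial and test functions then share
  one index set, the matrix is square, and its quadratic form is the scheme tested with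
  \<open>U'\<close>.\<close>

lemma coeff_form_expand:
  fixes N :: nat
  assumes b: "\<And>k. k < N \<Longrightarrow> Vh0 \<Omega> Th m (b k)" and uh: "L2 \<Omega> uh" and w0: "Vh0 \<Omega> Th m (w 0)"
    and w: "\<And>i. i < M \<Longrightarrow> w (Suc i) = (\<lambda>x. \<Sum>k<N. (c i k / real (Suc i)) * b k x)"
    and v: "\<And>j x. j < M \<Longrightarrow> x \<in> \<Omega> \<Longrightarrow> v j x = (\<Sum>l<N. e j l * b l x)"
  shows "coeff_form T \<alpha> \<Omega> M uh w v
    = (\<Sum>i<M. \<Sum>k<N. \<Sum>j<M. \<Sum>l<N. c i k * e j l * (ip \<Omega> (b k) (b l) * frac_form T \<alpha> i j
        + dirichlet \<Omega> (b k) (b l) * gram T (Suc i) j / real (Suc i)))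
      - (\<Sum>j<M. \<Sum>l<N. e j l * (ip \<Omega> uh (b l) * frac_form T \<alpha> 0 j - dirichlet \<Omega> (w 0) (b l) * gram T 0 j))"
proof -
  have bL: "\<And>k. k \<in> {..<N} \<Longrightarrow> L2 \<Omega> (b k)" using Vh0L2[OF b] by simp
  have bH: "\<And>k. k \<in> {..<N} \<Longrightarrow> H1 \<Omega> (b k)" using Vh0H1[OF b] by simp
  have sL: "L2 \<Omega> (\<lambda>x. \<Sum>l<N. a l * b l x)" for a by (rule L2_sum) (use bL in auto)
  have sH: "H1 \<Omega> (\<lambda>x. \<Sum>l<N. a l * b l x)" for a by (rule H1_sum[OF opn bdd]) (use bH in auto)
  have ipR: "ip \<Omega> u (\<lambda>x. \<Sum>l<N. a l * b l x) = (\<Sum>l<N. a l * ip \<Omega> u (b l))" if "L2 \<Omega> u" for u a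
    by (rule ip_sum_right) (use bL that in auto)
  have ipL: "ip \<Omega> (\<lambda>x. \<Sum>l<N. a l * b l x) u = (\<Sum>l<N. a l * ip \<Omega> (b l) u)" if "L2 \<Omega> u" for u a
    by (rule ip_sum_left) (use bL that in auto)
  have dR: "dirichlet \<Omega> u (\<lambda>x. \<Sum>l<N. a l * b l x) = (\<Sum>l<N. a l * dirichlet \<Omega> u (b l))" if "H1 \<Omega> u" for u a
    by (rule dirichlet_sum_right[OF opn bdd]) (use bH that in auto)
  have dL: "dirichlet \<Omega> (\<lambda>x. \<Sum>l<N. a l * b l x) u = (\<Sum>l<N. a l * dirichlet \<Omega> (b l) u)" if "H1 \<Omega> u" for u a
    by (rule dirichlet_sum_left[OF opn bdd]) (use bH that in auto)
  have ipv: "ip \<Omega> u (v j) = (\<Sum>l<N. e j l * ip \<Omega> u (b l))" if "j < M" "L2 \<Omega> u" for u j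
    unfolding ipR[OF that(2), symmetric] by (rule ip_cong) (simp_all add: v that)
  have dv: "dirichlet \<Omega> u (v j) = (\<Sum>l<N. e j l * dirichlet \<Omega> u (b l))" if "j < M" "H1 \<Omega> u" for u j
    unfolding dR[OF that(2), symmetric] by (rule dirichlet_cong) (simp_all add: v that)
  have dc: "dcoeff w i = (\<lambda>x. \<Sum>k<N. c i k * b k x)" if "i < M" for i
    using w[OF that] by (simp add: dcoeff_def[abs_def] sum_distrib_left)
  have 1: "ip \<Omega> (dcoeff w i) (v j) = (\<Sum>k<N. \<Sum>l<N. c i k * e j l * ip \<Omega> (b k) (b l))" if "i < M" "j < M" for i j
  proof -
    have "ip \<Omega> (dcoeff w i) (v j) = (\<Sum>k<N. c i k * ip \<Omega> (b k) (v j))"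
      unfolding dc[OF that(1)] by (rule ipL) (use sL v that L2_cong[of \<Omega> "v j" "\<lambda>x. \<Sum>l<N. e j l * b l x"] in auto)
    also have "\<dots> = (\<Sum>k<N. c i k * (\<Sum>l<N. e j l * ip \<Omega> (b k) (b l)))"
      by (intro sum.cong refl arg_cong2[where f = "(*)"] ipv that bL)
    finally show ?thesis by (simp add: sum_distrib_left mult.assoc)
  qed
  have 2: "dirichlet \<Omega> (w (Suc i)) (v j) = (\<Sum>k<N. \<Sum>l<N. c i k * e j l * dirichlet \<Omega> (b k) (b l)) / real (Suc i)"
    if "i < M" "j < M" for i j
  proof -
    have "dirichlet \<Omega> (w (Suc i)) (v j) = dirichlet \<Omega> (w (Suc i)) (\<lambda>x. \<Sum>l<N. e j l * b l x)"
      by (rule dirichlet_cong) (simp_all add: v that)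
    also have "\<dots> = (\<Sum>k<N. (c i k / real (Suc i)) * dirichlet \<Omega> (b k) (\<lambda>x. \<Sum>l<N. e j l * b l x))"
      unfolding w[OF that(1)] by (rule dL[OF sH])
    also have "\<dots> = (\<Sum>k<N. (c i k / real (Suc i)) * (\<Sum>l<N. e j l * dirichlet \<Omega> (b k) (b l)))"
      by (intro sum.cong refl arg_cong2[where f = "(*)"] dR bH)
    finally show ?thesis by (simp add: sum_distrib_left sum_divide_distrib mult_ac)
  qed
  have split: "(\<Sum>i\<le>M. \<Sum>j<M. dirichlet \<Omega> (w i) (v j) * gram T i j)
      = (\<Sum>j<M. dirichlet \<Omega> (w 0) (v j) * gram T 0 j) + (\<Sum>i<M. \<Sum>j<M. dirichlet \<Omega> (w (Suc i)) (v j) * gram T (Suc i) j)"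
    unfolding lessThan_Suc_atMost[symmetric] sum.lessThan_Suc_shift ..
  have "(\<Sum>i<M. \<Sum>j<M. ip \<Omega> (dcoeff w i) (v j) * frac_form T \<alpha> i j) + (\<Sum>i<M. \<Sum>j<M. dirichlet \<Omega> (w (Suc i)) (v j) * gram T (Suc i) j)
      = (\<Sum>i<M. \<Sum>j<M. \<Sum>k<N. \<Sum>l<N. c i k * e j l * (ip \<Omega> (b k) (b l) * frac_form T \<alpha> i j
        + dirichlet \<Omega> (b k) (b l) * gram T (Suc i) j / real (Suc i)))"
    unfolding sum.distrib[symmetric]
  proof (intro sum.cong refl)
    fix i j assume "i \<in> {..<M}" "j \<in> {..<M}"
    then show "ip \<Omega> (dcoeff w i) (v j) * frac_form T \<alpha> i j + dirichlet \<Omega> (w (Suc i)) (v j) * gram T (Suc i) j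
        = (\<Sum>k<N. \<Sum>l<N. c i k * e j l * (ip \<Omega> (b k) (b l) * frac_form T \<alpha> i j
          + dirichlet \<Omega> (b k) (b l) * gram T (Suc i) j / real (Suc i)))"
      by (simp add: 1 2 distrib_left sum.distrib sum_distrib_right sum_divide_distrib mult.assoc del: of_nat_Suc)
  qed
  also have "\<dots> = (\<Sum>i<M. \<Sum>k<N. \<Sum>j<M. \<Sum>l<N. c i k * e j l * (ip \<Omega> (b k) (b l) * frac_form T \<alpha> i j
        + dirichlet \<Omega> (b k) (b l) * gram T (Suc i) j / real (Suc i)))"
    by (rule sum.cong[OF refl]) (rule sum.swap)
  finally have main: "(\<Sum>i<M. \<Sum>j<M. ip \<Omega> (dcoeff w i) (v j) * frac_form T \<alpha> i j)
      + (\<Sum>i<M. \<Sum>j<M. dirichlet \<Omega> (w (Suc i)) (v j) * gram T (Suc i) j) = \<dots>" .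
  have "(\<Sum>j<M. ip \<Omega> uh (v j) * frac_form T \<alpha> 0 j) - (\<Sum>j<M. dirichlet \<Omega> (w 0) (v j) * gram T 0 j)
      = (\<Sum>j<M. \<Sum>l<N. e j l * (ip \<Omega> uh (b l) * frac_form T \<alpha> 0 j - dirichlet \<Omega> (w 0) (b l) * gram T 0 j))"
    unfolding sum_subtractf[symmetric]
    by (intro sum.cong refl)
      (simp add: ipv uh dv Vh0H1[OF w0] right_diff_distrib sum_subtractf sum_distrib_right mult.assoc)
  then show ?thesis unfolding coeff_form_def split using main by linarith
qed

lemma disc_sol_exists:
  assumes u0: "H10 \<Omega> u0" and uh: "L2 \<Omega> uh" and f: "L2T T \<Omega> f"
  shows "\<exists>U. disc_sol \<alpha> T \<Omega> Th m M u0 uh f U"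
proof -
  obtain N :: nat and b where b: "\<And>k. k < N \<Longrightarrow> Vh0 \<Omega> Th m (b k)"
    and span: "\<And>v. Vh0 \<Omega> Th m v \<Longrightarrow> \<exists>c. \<forall>x\<in>\<Omega>. v x = (\<Sum>k<N. c k * b k x)"
    and ind: "\<And>c k. \<forall>x\<in>\<Omega>. (\<Sum>k<N. c k * b k x) = 0 \<Longrightarrow> k < N \<Longrightarrow> c k = 0"
    by (rule Vh0_basis[OF opn bdd tri]) (rule that)
  obtain w0 where w0: "ritz \<Omega> Th m u0 w0" using ritz_exists[OF opn bdd tri u0] by blast
  then have w0V: "Vh0 \<Omega> Th m w0" by (simp add: ritz_def)
  define A where "A p q = ip \<Omega> (b (snd p)) (b (snd q)) * frac_form T \<alpha> (fst p) (fst q)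
      + dirichlet \<Omega> (b (snd p)) (b (snd q)) * gram T (Suc (fst p)) (fst q) / real (Suc (fst p))" for p q
  \<comment> \<open>\<open>co y c\<close> has initial value \<open>y\<close> and derivative
    coefficients \<open>c\<close>. With \<open>y = 0\<close> it serves the definiteness of
    \<open>A\<close>, with the Ritz projection \<open>w0\<close> the actual system.\<close>
  define co where "co y c = (\<lambda>i x. case i of 0 \<Rightarrow> y x | Suc i \<Rightarrow> \<Sum>k<N. (c (i, k) / real (Suc i)) * b k x)"
    for y :: "real^'n \<Rightarrow> real" and c :: "nat \<times> nat \<Rightarrow> real"
  let ?I = "{..<M} \<times> {..<N}"
  have coV: "Vh0 \<Omega> Th m (co y c i)" if "Vh0 \<Omega> Th m y" for y c i
  proof (cases i)
    case 0 then show ?thesis using that by (simp add: co_def)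
  next
    case (Suc i')
    then have "co y c i = (\<lambda>x. \<Sum>k<N. (c (i', k) / real (Suc i')) * b k x)" by (simp add: co_def)
    moreover have "Vh0 \<Omega> Th m (\<lambda>x. \<Sum>k<N. (c (i', k) / real (Suc i')) * b k x)"
      by (rule Vh0_sum[OF opn bdd tri]) (use b in auto)
    ultimately show ?thesis by simp
  qed
  have pair: "(\<Sum>p\<in>?I. h p) = (\<Sum>i<M. \<Sum>k<N. h (i, k))" for h :: "nat \<times> nat \<Rightarrow> real"
    by (simp add: sum.cartesian_product split_beta)
  have expand: "coeff_form T \<alpha> \<Omega> M g (co y c) v = (\<Sum>p\<in>?I. \<Sum>q\<in>?I. c p * e (fst q) (snd q) * A p q)
      - (\<Sum>q\<in>?I. e (fst q) (snd q) * (ip \<Omega> g (b (snd q)) * frac_form T \<alpha> 0 (fst q) - dirichlet \<Omega> y (b (snd q)) * gram T 0 (fst q)))"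
    if "L2 \<Omega> g" "Vh0 \<Omega> Th m y" "\<And>j x. j < M \<Longrightarrow> x \<in> \<Omega> \<Longrightarrow> v j x = (\<Sum>l<N. e j l * b l x)" for g y c v e
  proof -
    have "co y c 0 = y" by (simp add: co_def)
    moreover have "coeff_form T \<alpha> \<Omega> M g (co y c) v
      = (\<Sum>i<M. \<Sum>k<N. \<Sum>j<M. \<Sum>l<N. c (i, k) * e j l * (ip \<Omega> (b k) (b l) * frac_form T \<alpha> i j
        + dirichlet \<Omega> (b k) (b l) * gram T (Suc i) j / real (Suc i)))
      - (\<Sum>j<M. \<Sum>l<N. e j l * (ip \<Omega> g (b l) * frac_form T \<alpha> 0 j - dirichlet \<Omega> (co y c 0) (b l) * gram T 0 j))"
      by (rule coeff_form_expand) (use b that coV in \<open>auto simp: co_def\<close>)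
    ultimately show ?thesis by (simp only: A_def pair fst_conv snd_conv)
  qed
  \<comment> \<open>The right side collects the load, the contribution of \<open>uh\<close> and,
    with a minus sign, the gradient term of the prescribed initial value.\<close>
  have "\<exists>c. \<forall>q\<in>?I. (\<Sum>p\<in>?I. c p * A p q) = load T \<Omega> f (fst q) (b (snd q))
      + ip \<Omega> uh (b (snd q)) * frac_form T \<alpha> 0 (fst q) - dirichlet \<Omega> w0 (b (snd q)) * gram T 0 (fst q)"
  proof (rule positive_definite_solvable)
    fix c :: "nat \<times> nat \<Rightarrow> real" assume c: "\<exists>p\<in>?I. c p \<noteq> 0"
    define w where "w = co (\<lambda>x. 0) c"
    define U where "U t x = (\<Sum>i\<le>M. t ^ i * w i x)" for t x
    have w: "Vh0 \<Omega> Th m (w i)" for i unfolding w_def by (rule coV[OF Vh0_zero[OF opn bdd tri]])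
    have dw: "dcoeff w i x = (\<Sum>k<N. c (i, k) * b k x)" for i x
      by (simp add: w_def co_def dcoeff_def sum_distrib_left)
    have dL: "L2 \<Omega> (dcoeff w i)" if "i < M" for i by (rule Vh0L2[OF dcoeff_Vh0[OF w that]])
    have w00: "w 0 = (\<lambda>x. 0)" by (simp add: w_def co_def)
    have ip0: "ip \<Omega> (\<lambda>x. 0) v = 0" for v by (simp add: ip_def)
    have d0: "dirichlet \<Omega> (\<lambda>x. 0) v = 0" if "H1 \<Omega> v" for v
      using dirichlet_lin[OF opn bdd H1_zero[OF opn bdd] H1_zero[OF opn bdd] that, of 0 0] by simp
    have "coeff_form T \<alpha> \<Omega> M (\<lambda>x. 0) w (dcoeff w) = (\<Sum>p\<in>?I. \<Sum>q\<in>?I. c p * c q * A p q)"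
      unfolding w_def
      by (subst expand[OF L2_zero Vh0_zero[OF opn bdd tri], where e = "\<lambda>j l. c (j, l)"])
        (use dw[unfolded w_def] ip0 d0 Vh0H1[OF b] in \<open>auto intro!: sum.neutral\<close>)
    moreover have "0 < coeff_form T \<alpha> \<Omega> M (\<lambda>x. 0) w (dcoeff w)"
    proof -
      let ?G = "Gamma (1 - 2 * \<alpha>)"
      have G: "0 < ?G" using \<alpha> by (intro Gamma_real_pos) simp
      \<comment> \<open>Otherwise \<open>U\<close> vanishes on \<open>\<Omega>\<close> throughout
        \<open>{0..T}\<close>. A polynomial in time with infinitely many zeros has zero
        coefficients, and independence of the basis contradicts the choice of
        \<open>c\<close>.\<close>
      have "0 < weight_sq (dcoeff w)"
      proof (rule ccontr)
        assume "\<not> 0 < weight_sq (dcoeff w)"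
        then have "T powr (2 * \<alpha>) * weight_sq (dcoeff w) \<le> 0" by (simp add: mult_nonneg_nonpos)
        then have "gram_sq (dcoeff w) \<le> 0" using order_trans[OF gram_sq_le[of "dcoeff w"]] dL by blast
        then have g: "2 * T * gram_sq (dcoeff w) \<le> 0" using T by (simp add: mult_nonneg_nonpos)
        have Uz: "U t x = 0" if t: "0 \<le> t" "t \<le> T" and x: "x \<in> \<Omega>" for t x
        proof -
          have "ip \<Omega> (U t) (U t) \<le> 0"
            using solution_L2_bound[OF U_def w t] g ip0 by (simp add: w00)
          then have "ip \<Omega> (U t) (U t) = 0" using ip_nonneg[of \<Omega> "U t"] by linarith
          moreover have "Vh0 \<Omega> Th m (\<lambda>x. \<Sum>i\<le>M. t ^ i * w i x)" by (rule Vh0_sum[OF opn bdd tri]) (use w in auto)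
          then have "Vh \<Omega> Th m (U t)" unfolding U_def by (rule Vh0_Vh[OF opn bdd tri])
          ultimately show ?thesis using Vh_eq_0[OF opn bdd tri _ _ x] by blast
        qed
        have wz: "w i x = 0" if "i \<le> M" "x \<in> \<Omega>" for i x
        proof (rule ccontr)
          assume "w i x \<noteq> 0"
          then have "finite {t. (\<Sum>i\<le>M. w i x * t ^ i) = 0}"
            using that(1) by (subst polyfun_finite_roots) blast
          moreover have "{0..T} \<subseteq> {t. (\<Sum>i\<le>M. w i x * t ^ i) = 0}"
            using Uz that(2) by (auto simp: U_def mult.commute)
          ultimately have "finite {0..T}" by (rule finite_subset[rotated])
          then show False using T infinite_Icc by blast
        qed
        obtain i k where ik: "i < M" "k < N" "c (i, k) \<noteq> 0" using c by auto
        have "\<forall>x\<in>\<Omega>. (\<Sum>k<N. c (i, k) * b k x) = 0"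
          unfolding dw[symmetric] using wz[of "Suc i"] ik(1) by (simp add: dcoeff_def)
        from ind[OF this ik(2)] ik(3) show False by simp
      qed
      moreover have "0 \<le> \<alpha> / 2 * slob_sq (dcoeff w)"
        using slob_sq_nonneg[OF dL] \<alpha> by (intro mult_nonneg_nonneg) auto
      moreover have "T powr (1 - 2 * \<alpha>) / (1 - 2 * \<alpha>) * ip \<Omega> (\<lambda>x. 0) (\<lambda>x. 0) = 0" by (simp add: ip0)
      moreover have "weight_sq (dcoeff w) / 4 + \<alpha> / 2 * slob_sq (dcoeff w) - T powr (1 - 2 * \<alpha>) / (1 - 2 * \<alpha>) * ip \<Omega> (\<lambda>x. 0) (\<lambda>x. 0)
        \<le> ?G * ((\<Sum>i<M. \<Sum>j<M. ip \<Omega> (dcoeff w i) (dcoeff w j) * frac_form T \<alpha> i j) - (\<Sum>j<M. ip \<Omega> (\<lambda>x. 0) (dcoeff w j) * frac_form T \<alpha> 0 j))"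
        by (rule fractional_energy[OF dL L2_zero])
      ultimately have "0 < ?G * ((\<Sum>i<M. \<Sum>j<M. ip \<Omega> (dcoeff w i) (dcoeff w j) * frac_form T \<alpha> i j) - (\<Sum>j<M. ip \<Omega> (\<lambda>x. 0) (dcoeff w j) * frac_form T \<alpha> 0 j))"
        by linarith
      then have "0 < (\<Sum>i<M. \<Sum>j<M. ip \<Omega> (dcoeff w i) (dcoeff w j) * frac_form T \<alpha> i j) - (\<Sum>j<M. ip \<Omega> (\<lambda>x. 0) (dcoeff w j) * frac_form T \<alpha> 0 j)"
        using G by (simp add: zero_less_mult_iff)
      moreover have "2 * (\<Sum>i\<le>M. \<Sum>j<M. dirichlet \<Omega> (w i) (dcoeff w j) * gram T i j) = dirichlet \<Omega> (U T) (U T) - dirichlet \<Omega> (w 0) (w 0)"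
        by (rule gradient_energy[OF U_def w])
      \<comment> \<open>Since \<open>w 0\<close> is zero, the gradient part is half the energy at
        time \<open>T\<close>.\<close>
      then have "0 \<le> (\<Sum>i\<le>M. \<Sum>j<M. dirichlet \<Omega> (w i) (dcoeff w j) * gram T i j)"
        using dirichlet_nonneg[of \<Omega> "U T"] d0[OF H1_zero[OF opn bdd]] by (simp add: w00)
      ultimately show ?thesis unfolding coeff_form_def by linarith
    qed
    ultimately show "0 < (\<Sum>p\<in>?I. \<Sum>q\<in>?I. c p * c q * A p q)" by simp
  qed simp
  then obtain c where c: "\<And>q. q \<in> ?I \<Longrightarrow> (\<Sum>p\<in>?I. c p * A p q) = load T \<Omega> f (fst q) (b (snd q))
      + ip \<Omega> uh (b (snd q)) * frac_form T \<alpha> 0 (fst q) - dirichlet \<Omega> w0 (b (snd q)) * gram T 0 (fst q)"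
    by blast
  define w where "w = co w0 c"
  define U where "U t x = (\<Sum>i\<le>M. t ^ i * w i x)" for t x
  have w: "Vh0 \<Omega> Th m (w i)" for i unfolding w_def by (rule coV[OF w0V])
  have "coeff_form T \<alpha> \<Omega> M uh w v = (\<Sum>j<M. load T \<Omega> f j (v j))" if v: "\<forall>j<M. Vh0 \<Omega> Th m (v j)" for v
  proof -
    have "\<forall>j\<in>{..<M}. \<exists>e. \<forall>x\<in>\<Omega>. v j x = (\<Sum>l<N. e l * b l x)" using span v by blast
    from bchoice[OF this] obtain e where e: "\<And>j x. j < M \<Longrightarrow> x \<in> \<Omega> \<Longrightarrow> v j x = (\<Sum>l<N. e j l * b l x)"
      by blast
    have "(\<Sum>p\<in>?I. \<Sum>q\<in>?I. c p * e (fst q) (snd q) * A p q) = (\<Sum>q\<in>?I. e (fst q) (snd q) * (\<Sum>p\<in>?I. c p * A p q))"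
      by (subst sum.swap) (simp add: sum_distrib_left mult_ac)
    also have "\<dots> = (\<Sum>q\<in>?I. e (fst q) (snd q) * (load T \<Omega> f (fst q) (b (snd q))
      + ip \<Omega> uh (b (snd q)) * frac_form T \<alpha> 0 (fst q) - dirichlet \<Omega> w0 (b (snd q)) * gram T 0 (fst q)))"
      by (intro sum.cong refl arg_cong2[where f = "(*)"] c)
    finally have *: "(\<Sum>p\<in>?I. \<Sum>q\<in>?I. c p * e (fst q) (snd q) * A p q) = \<dots>" .
    have "coeff_form T \<alpha> \<Omega> M uh w v = (\<Sum>p\<in>?I. \<Sum>q\<in>?I. c p * e (fst q) (snd q) * A p q)
      - (\<Sum>q\<in>?I. e (fst q) (snd q) * (ip \<Omega> uh (b (snd q)) * frac_form T \<alpha> 0 (fst q) - dirichlet \<Omega> w0 (b (snd q)) * gram T 0 (fst q)))"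
      unfolding w_def by (rule expand[OF uh w0V e])
    also have "\<dots> = (\<Sum>q\<in>?I. e (fst q) (snd q) * load T \<Omega> f (fst q) (b (snd q)))"
      unfolding * sum_subtractf[symmetric] by (rule sum.cong) (simp_all add: algebra_simps)
    finally have "coeff_form T \<alpha> \<Omega> M uh w v = (\<Sum>q\<in>?I. e (fst q) (snd q) * load T \<Omega> f (fst q) (b (snd q)))" .
    also have "\<dots> = (\<Sum>j<M. \<Sum>l<N. e j l * load T \<Omega> f j (b l))"
      by (simp add: sum.cartesian_product split_beta)
    also have "\<dots> = (\<Sum>j<M. load T \<Omega> f j (v j))"
    proof (intro sum.cong refl)
      fix j assume "j \<in> {..<M}"
      then show "(\<Sum>l<N. e j l * load T \<Omega> f j (b l)) = load T \<Omega> f j (v j)"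
        by (intro load_combination[OF f, symmetric] Vh0_Vh[OF opn bdd tri] b) (auto simp: e)
    qed
    finally show ?thesis .
  qed
  moreover have "ritz \<Omega> Th m u0 (w 0)" using w0 by (simp add: w_def co_def)
  ultimately have "disc_sol \<alpha> T \<Omega> Th m M u0 uh f U"
    using disc_sol_iff[OF U_def w uh f, of u0] by blast
  then show ?thesis by blast
qed

text \<open>\<open>E\<close> adds up the data factors of \<open>energy_estimate\<close>, each datum
  being at most the total \<open>D\<close>. This bounds \<open>weight_sq\<close> by 8 E D,
  \<open>slob_sq\<close> by (2 / \<open>\<alpha>\<close>) E D and the final energy by (2 / G) E D.
  The initial value adds 2 T C D, and \<open>gram_sq\<close>, being at most 8 r E D, enters once as
  16 T^2 r E D and once as 8 r E D. The outer factor 2 under the root comes from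
  \<open>sqrt_add_le\<close>.\<close>

lemma disc_sol_stable:
  assumes sol: "disc_sol \<alpha> T \<Omega> Th m M u0 uh f U" and u0: "H10 \<Omega> u0" and u1: "L2 \<Omega> u1"
    and proj: "l2proj \<Omega> Th m u1 uh" and f: "L2T T \<Omega> f"
    and C: "0 < C" "\<And>v. H10 \<Omega> v \<Longrightarrow> ip \<Omega> v v \<le> C * dirichlet \<Omega> v v"
    and G: "G = Gamma (1 - 2 * \<alpha>)" and r: "r = T powr (2 * \<alpha>)"
    and E: "E = T powr (1 - 2 * \<alpha>) / (1 - 2 * \<alpha>) + 2 * G\<^sup>2 * r + G / 2"
  shows "H1s_time_norm \<alpha> T \<Omega> U + H10norm \<Omega> (U T)
    \<le> sqrt (2 * (2 * T * C + (16 * T\<^sup>2 * r + 8 * r + 2 / \<alpha> + 2 / G) * E)) * (H10norm \<Omega> u0 + L2norm \<Omega> u1 + L2Tnorm T \<Omega> f)"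
proof -
  obtain w where w: "\<And>i. i \<le> M \<Longrightarrow> Vh0 \<Omega> Th m (w i)" and U: "\<And>t x. U t x = (\<Sum>i\<le>M. t ^ i * w i x)"
    using sol unfolding disc_sol_def tensor_space_def[of _ _ _ M U] by blast
  have uhL: "L2 \<Omega> uh" using proj unfolding l2proj_def by (blast intro: VhL2)
  have w0: "ritz \<Omega> Th m u0 (w 0)" using disc_sol_iff[OF U w uhL f, of u0] sol by blast
  let ?d = "dcoeff w" and ?K = "T powr (1 - 2 * \<alpha>) / (1 - 2 * \<alpha>)"
  have d: "L2 \<Omega> (?d i)" if "i < M" for i by (rule Vh0L2[OF dcoeff_Vh0[OF w that]])
  define D where "D = dirichlet \<Omega> u0 u0 + ip \<Omega> u1 u1 + (L2Tnorm T \<Omega> f)\<^sup>2"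
  have G0: "0 < G" unfolding G using \<alpha> by (intro Gamma_real_pos) simp
  have r0: "0 < r" using T by (simp add: r)
  have K0: "0 \<le> ?K" using \<alpha> by simp
  have E0: "0 < E" unfolding E using K0 G0 r0 by (intro add_nonneg_pos add_nonneg_nonneg) auto
  have parts: "dirichlet \<Omega> (w 0) (w 0) \<le> D" "ip \<Omega> uh uh \<le> D" "(L2Tnorm T \<Omega> f)\<^sup>2 \<le> D" "0 \<le> D"
    using ritz_stable[OF opn bdd tri w0 u0] l2proj_stable[OF opn bdd tri proj u1]
      dirichlet_nonneg[of \<Omega> u0] ip_nonneg[of \<Omega> u1] zero_le_power2[of "L2Tnorm T \<Omega> f"]
    unfolding D_def by linarith+
  have "weight_sq ?d / 8 + \<alpha> / 2 * slob_sq ?d + G / 2 * dirichlet \<Omega> (U T) (U T)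
      \<le> ?K * ip \<Omega> uh uh + 2 * G\<^sup>2 * r * (L2Tnorm T \<Omega> f)\<^sup>2 + G / 2 * dirichlet \<Omega> (w 0) (w 0)"
    unfolding G r by (rule energy_estimate[OF U w uhL f sol])
  also have "\<dots> \<le> ?K * D + 2 * G\<^sup>2 * r * D + G / 2 * D"
    using parts K0 G0 r0 by (intro add_mono mult_left_mono) auto
  also have "\<dots> = E * D" by (simp add: E algebra_simps)
  finally have en: "weight_sq ?d / 8 + \<alpha> / 2 * slob_sq ?d + G / 2 * dirichlet \<Omega> (U T) (U T) \<le> E * D" .
  have nn: "0 \<le> weight_sq ?d" "0 \<le> \<alpha> / 2 * slob_sq ?d" "0 \<le> G / 2 * dirichlet \<Omega> (U T) (U T)"
    using weight_sq_nonneg[of ?d] slob_sq_nonneg[of ?d] d \<alpha> G0 by (simp_all add: dirichlet_nonneg)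
  have b1: "weight_sq ?d \<le> 8 * (E * D)" using en nn by linarith
  have b2: "slob_sq ?d \<le> 2 / \<alpha> * (E * D)"
  proof -
    have "\<alpha> / 2 * slob_sq ?d \<le> E * D" using en nn by linarith
    then show ?thesis using \<alpha> by (simp add: field_simps)
  qed
  have b3: "dirichlet \<Omega> (U T) (U T) \<le> 2 / G * (E * D)"
  proof -
    have "G / 2 * dirichlet \<Omega> (U T) (U T) \<le> E * D" using en nn by linarith
    then show ?thesis using G0 by (simp add: field_simps)
  qed
  have b4: "gram_sq ?d \<le> r * (8 * (E * D))"
  proof -
    have "gram_sq ?d \<le> r * weight_sq ?d" unfolding r by (rule gram_sq_le[OF d])
    also have "\<dots> \<le> r * (8 * (E * D))" using b1 r0 by (intro mult_left_mono) auto
    finally show ?thesis .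
  qed
  have b5: "ip \<Omega> (w 0) (w 0) \<le> C * D"
    using order_trans[OF C(2)[OF Vh0_H10[OF opn bdd tri w[of 0]]] mult_left_mono[OF parts(1)]] C(1) by simp
  let ?X = "T * (2 * ip \<Omega> (w 0) (w 0) + 2 * T * gram_sq ?d) + gram_sq ?d + slob_sq ?d"
  let ?K2 = "2 * T * C + (16 * T\<^sup>2 * r + 8 * r + 2 / \<alpha> + 2 / G) * E"
  have "?X + dirichlet \<Omega> (U T) (U T)
      \<le> T * (2 * (C * D) + 2 * T * (r * (8 * (E * D)))) + r * (8 * (E * D)) + 2 / \<alpha> * (E * D) + 2 / G * (E * D)"
    using b2 b3 b4 b5 T by (intro add_mono mult_left_mono) auto
  also have "\<dots> = ?K2 * D" by (simp add: algebra_simps power2_eq_square)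
  finally have XD: "?X + dirichlet \<Omega> (U T) (U T) \<le> ?K2 * D" .
  have "0 \<le> gram_sq ?d" by (rule gram_sq_nonneg[OF d])
  moreover have "0 \<le> slob_sq ?d" by (rule slob_sq_nonneg[OF d])
  ultimately have X0: "0 \<le> ?X" using ip_nonneg[of \<Omega> "w 0"] T by simp
  have "H1s_time_norm \<alpha> T \<Omega> U + H10norm \<Omega> (U T) \<le> sqrt ?X + sqrt (dirichlet \<Omega> (U T) (U T))"
    using time_norm_le[OF U w] by (simp add: H10norm_def dirichlet_def power2_norm_eq_inner)
  also have "\<dots> \<le> sqrt (2 * (?X + dirichlet \<Omega> (U T) (U T)))"
    by (rule sqrt_add_le[OF X0 dirichlet_nonneg])
  also have "\<dots> \<le> sqrt ((2 * ?K2) * D)"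
  proof (rule real_sqrt_le_mono)
    have "a \<le> k * D \<Longrightarrow> 2 * a \<le> (2 * k) * D" for a k by simp
    then show "2 * (?X + dirichlet \<Omega> (U T) (U T)) \<le> (2 * ?K2) * D" using XD by blast
  qed
  also have "\<dots> = sqrt (2 * ?K2) * sqrt D" by (rule real_sqrt_mult)
  also have "\<dots> \<le> sqrt (2 * ?K2) * (H10norm \<Omega> u0 + L2norm \<Omega> u1 + L2Tnorm T \<Omega> f)"
  proof (rule mult_left_mono)
    have n: "0 \<le> H10norm \<Omega> u0" "0 \<le> L2norm \<Omega> u1" "0 \<le> L2Tnorm T \<Omega> f"
      by (simp_all add: H10norm_def L2norm_def L2Tnorm_def set_integral_nonneg_real)
    have "D = (H10norm \<Omega> u0)\<^sup>2 + (L2norm \<Omega> u1)\<^sup>2 + (L2Tnorm T \<Omega> f)\<^sup>2"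
      by (simp add: D_def H10norm_power2 L2norm_ip)
    also have "\<dots> \<le> (H10norm \<Omega> u0 + L2norm \<Omega> u1 + L2Tnorm T \<Omega> f)\<^sup>2"
      using n by (simp add: power2_eq_square algebra_simps)
    finally show "sqrt D \<le> H10norm \<Omega> u0 + L2norm \<Omega> u1 + L2Tnorm T \<Omega> f"
      using n by (intro real_le_lsqrt) auto
    show "0 \<le> sqrt (2 * ?K2)"
      using C(1) E0 G0 r0 T \<alpha> by (intro real_sqrt_ge_zero mult_nonneg_nonneg add_nonneg_nonneg) auto
  qed
  finally show ?thesis .
qed

end

theorem theorem4p1:
  fixes \<Omega> :: "(real^'n) set" and \<gamma> T \<sigma> :: real and m :: nat
  assumes "CARD('n) = 2 \<or> CARD('n) = 3"
    and "1 < \<gamma>" and "\<gamma> < 2" and "0 < T"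
    and "polyhedral_domain \<Omega>" and "1 \<le> m"
  shows "\<exists>c>0. \<forall>Th M u0 u1 f uh1.
    triangulation \<Omega> Th \<longrightarrow> shape_param Th \<le> \<sigma> \<longrightarrow> 2 \<le> M \<longrightarrow>
    H10 \<Omega> u0 \<longrightarrow> L2 \<Omega> u1 \<longrightarrow> L2T T \<Omega> f \<longrightarrow> l2proj \<Omega> Th m u1 uh1 \<longrightarrow>
      (\<exists>U. disc_sol ((\<gamma> - 1) / 2) T \<Omega> Th m M u0 uh1 f U) \<and>
      (\<forall>U U'. disc_sol ((\<gamma> - 1) / 2) T \<Omega> Th m M u0 uh1 f U \<longrightarrow>
              disc_sol ((\<gamma> - 1) / 2) T \<Omega> Th m M u0 uh1 f U' \<longrightarrow>
              (\<forall>t\<in>{0..T}. \<forall>x\<in>\<Omega>. U' t x = U t x)) \<and>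
      (\<forall>U. disc_sol ((\<gamma> - 1) / 2) T \<Omega> Th m M u0 uh1 f U \<longrightarrow>
           H1s_time_norm ((\<gamma> - 1) / 2) T \<Omega> U + H10norm \<Omega> (U T)
             \<le> c * (H10norm \<Omega> u0 + L2norm \<Omega> u1 + L2Tnorm T \<Omega> f))"
proof -
  have dom: "open \<Omega>" "bounded \<Omega>" using assms(5) by (auto simp: polyhedral_domain_def)
  define \<alpha> where "\<alpha> = (\<gamma> - 1) / 2"
  have \<alpha>: "0 < \<alpha>" "\<alpha> < 1 / 2" using assms(2,3) by (auto simp: \<alpha>_def)
  obtain C where C: "0 < C" "\<And>v. H10 \<Omega> v \<Longrightarrow> ip \<Omega> v v \<le> C * dirichlet \<Omega> v v"
    using poincare[OF dom] by blast
  define G where "G = Gamma (1 - 2 * \<alpha>)"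
  define r where "r = T powr (2 * \<alpha>)"
  define E where "E = T powr (1 - 2 * \<alpha>) / (1 - 2 * \<alpha>) + 2 * G\<^sup>2 * r + G / 2"
  \<comment> \<open>Fixed before mesh, degree \<open>M\<close> and data are introduced: it is built
    from \<open>T\<close>, \<open>\<gamma>\<close> and the Poincare constant \<open>C\<close> of
    \<open>\<Omega>\<close>.\<close>
  define c where "c = sqrt (2 * (2 * T * C + (16 * T\<^sup>2 * r + 8 * r + 2 / \<alpha> + 2 / G) * E))"
  have pos: "0 < G" "0 < r" using \<alpha> assms(4) by (auto simp: G_def r_def intro: Gamma_real_pos)
  then have "0 < E" unfolding E_def using \<alpha> by (intro add_nonneg_pos add_nonneg_nonneg) auto
  then have "0 < (16 * T\<^sup>2 * r + 8 * r + 2 / \<alpha> + 2 / G) * E"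
    using pos \<alpha> by (intro mult_pos_pos add_pos_pos add_nonneg_pos) auto
  then have "0 < c" unfolding c_def using assms(4) C(1) by (simp add: add_pos_pos)
  moreover have "\<forall>Th M u0 u1 f uh1.
    triangulation \<Omega> Th \<longrightarrow> shape_param Th \<le> \<sigma> \<longrightarrow> 2 \<le> M \<longrightarrow>
    H10 \<Omega> u0 \<longrightarrow> L2 \<Omega> u1 \<longrightarrow> L2T T \<Omega> f \<longrightarrow> l2proj \<Omega> Th m u1 uh1 \<longrightarrow>
      (\<exists>U. disc_sol \<alpha> T \<Omega> Th m M u0 uh1 f U) \<and>
      (\<forall>U U'. disc_sol \<alpha> T \<Omega> Th m M u0 uh1 f U \<longrightarrow> disc_sol \<alpha> T \<Omega> Th m M u0 uh1 f U' \<longrightarrow>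
              (\<forall>t\<in>{0..T}. \<forall>x\<in>\<Omega>. U' t x = U t x)) \<and>
      (\<forall>U. disc_sol \<alpha> T \<Omega> Th m M u0 uh1 f U \<longrightarrow>
           H1s_time_norm \<alpha> T \<Omega> U + H10norm \<Omega> (U T) \<le> c * (H10norm \<Omega> u0 + L2norm \<Omega> u1 + L2Tnorm T \<Omega> f))"
  proof (intro allI impI)
    fix Th M u0 u1 f uh1
    assume tri: "triangulation \<Omega> Th" and M: "2 \<le> (M::nat)" and u0: "H10 \<Omega> u0" and u1: "L2 \<Omega> u1"
      and f: "L2T T \<Omega> f" and proj: "l2proj \<Omega> Th m u1 uh1"
    have M1: "1 \<le> M" using M by simp
    have uh: "L2 \<Omega> uh1" using proj unfolding l2proj_def by (blast intro: Vh_L2[OF dom tri])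
    note ctx = dom tri assms(4) \<alpha> M1
    show "(\<exists>U. disc_sol \<alpha> T \<Omega> Th m M u0 uh1 f U) \<and>
      (\<forall>U U'. disc_sol \<alpha> T \<Omega> Th m M u0 uh1 f U \<longrightarrow> disc_sol \<alpha> T \<Omega> Th m M u0 uh1 f U' \<longrightarrow>
              (\<forall>t\<in>{0..T}. \<forall>x\<in>\<Omega>. U' t x = U t x)) \<and>
      (\<forall>U. disc_sol \<alpha> T \<Omega> Th m M u0 uh1 f U \<longrightarrow>
           H1s_time_norm \<alpha> T \<Omega> U + H10norm \<Omega> (U T) \<le> c * (H10norm \<Omega> u0 + L2norm \<Omega> u1 + L2Tnorm T \<Omega> f))"
    proof (intro conjI allI impI ballI)
      show "\<exists>U. disc_sol \<alpha> T \<Omega> Th m M u0 uh1 f U" by (rule disc_sol_exists[OF ctx u0 uh f])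
    next
      fix U U' t x
      assume sol: "disc_sol \<alpha> T \<Omega> Th m M u0 uh1 f U" "disc_sol \<alpha> T \<Omega> Th m M u0 uh1 f U'"
        and t: "t \<in> {0..T}" and x: "x \<in> \<Omega>"
      show "U' t x = U t x" by (rule disc_sol_unique[OF ctx sol u0 uh f _ _ x]) (use t in auto)
    next
      fix U assume sol: "disc_sol \<alpha> T \<Omega> Th m M u0 uh1 f U"
      show "H1s_time_norm \<alpha> T \<Omega> U + H10norm \<Omega> (U T) \<le> c * (H10norm \<Omega> u0 + L2norm \<Omega> u1 + L2Tnorm T \<Omega> f)"
        unfolding c_def by (rule disc_sol_stable[OF ctx sol u0 u1 proj f C G_def r_def E_def])
    qed
  qed
  ultimately show ?thesis unfolding \<alpha>_def by blast
qed

end
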